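(* Let $\mathcal{H},\mathcal{K}$ be Hilbert spaces, let $J\subseteq\mathbb{R}$ be an interval, and let $f:J\to\mathbb{R}$ be a monotone convex function. For each $s\in J$ let $C_s$ be a real number such that $C_s(t-s)+f(s)\le f(t)$ for all $t\in J$. Let $A_1,\ldots,A_n\in\mathcal{B}(\mathcal{H})$ be self-adjoint operators with spectra in $J$, and let $\Phi_1,\ldots,\Phi_n:\mathcal{B}(\mathcal{H})\to\mathcal{B}(\mathcal{K})$ be positive linear mappings such that $\sum_{i=1}^n\Phi_i(\mathbf{1}_{\mathcal{H}})=\mathbf{1}_{\mathcal{K}}$. Then $$\sum_{i=1}^n\Phi_i(f(A_i))\le f\left(\sum_{i=1}^n\Phi_i(A_i)\right)+\delta\,\mathbf{1}_{\mathcal{K}},$$ where $$\delta=\sup\left\{\left\langle\sum_{i=1}^n\Phi_i(C_{A_i}A_i)x,x\right\rangle-\left\langle\sum_{i=1}^n\Phi_i(A_i)x,x\right\rangle\left\langle\sum_{i=1}^n\Phi_i(C_{A_i})x,x\right\rangle:\ x\in\mathcal{K},\ \|x\|=1\right\}.$$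
   Context: Hilbert spaces are complex. $\mathcal{B}(\mathcal{H})$ is the $C^*$-algebra of all bounded linear operators on $\mathcal{H}$, and $\mathbf{1}_{\mathcal{H}}$ is the identity operator. A self-adjoint operator $A$ is positive ($A\ge 0$) if $\langle Ax,x\rangle\ge 0$ for all $x$; for self-adjoint $A,B$, $A\le B$ means $B-A\ge 0$. A linear map $\Phi:\mathcal{B}(\mathcal{H})\to\mathcal{B}(\mathcal{K})$ is positive if $\Phi(A)\ge 0$ whenever $A\ge 0$. For a self-adjoint operator $A$ with spectrum in $J$, $f(A)$ is defined by functional calculus, and $C_A$ denotes the operator obtained by applying the function $s\mapsto C_s$ to $A$ by (bounded Borel) functional calculus; the function $s\mapsto C_s$ is automatically nondecreasing on $J$, hence Borel and bounded on compact subsets of $J$. The convexity of $f$ is ordinary (scalar) convexity; operator convexity is not assumed. *)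

theory Defs
  imports "HOL-Analysis.Analysis"
begin

section \<open>Complex Hilbert spaces\<close>

class scaleC =
  fixes scaleC :: "complex \<Rightarrow> 'a \<Rightarrow> 'a"  (infixr \<open>*\<^sub>C\<close> 75)

class complex_vector = real_vector + scaleC +
  assumes scaleC_add_right: "a *\<^sub>C (x + y) = a *\<^sub>C x + a *\<^sub>C y"
    and scaleC_add_left: "(a + b) *\<^sub>C x = a *\<^sub>C x + b *\<^sub>C x"
    and scaleC_scaleC: "a *\<^sub>C b *\<^sub>C x = (a * b) *\<^sub>C x"
    and scaleR_scaleC: "r *\<^sub>R x = complex_of_real r *\<^sub>C x"

text \<open>
  The inner product is linear in its first argument. That \<open>cinner x x\<close> is real follows from
  \<open>cinner_commute\<close>, that it is nonnegative, and positive for \<open>x \<noteq> 0\<close>, from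
  \<open>norm_eq_sqrt_cinner\<close> (\<open>sqrt\<close> is negative on negative arguments) together with the
  axioms of the norm. The zero space is allowed.
\<close>

class chilbert_space = complex_vector + banach +
  fixes cinner :: "'a \<Rightarrow> 'a \<Rightarrow> complex"
  assumes cinner_commute: "cinner x y = cnj (cinner y x)"
    and cinner_add_left: "cinner (x + y) z = cinner x z + cinner y z"
    and cinner_scaleC_left: "cinner (a *\<^sub>C x) y = a * cinner x y"
    and norm_eq_sqrt_cinner: "norm x = sqrt (Re (cinner x x))"

instantiation complex :: chilbert_space
begin

definition scaleC_complex :: "complex \<Rightarrow> complex \<Rightarrow> complex"
  where "scaleC_complex a x = a * x"

definition cinner_complex :: "complex \<Rightarrow> complex \<Rightarrow> complex"
  where "cinner_complex x y = x * cnj y"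

instance
  by standard
    (simp_all add: scaleC_complex_def cinner_complex_def algebra_simps scaleR_conv_of_real
      cmod_def power2_eq_square)

end

definition clinear :: "('a::complex_vector \<Rightarrow> 'b::complex_vector) \<Rightarrow> bool"
  where "clinear f \<longleftrightarrow> (\<forall>x y. f (x + y) = f x + f y) \<and> (\<forall>c x. f (c *\<^sub>C x) = c *\<^sub>C f x)"

lemma scaleC_zero_right [simp]: "a *\<^sub>C (0::'a::complex_vector) = 0"
  using scaleC_add_right[of a "0::'a" 0] by simp

lemma scaleC_minus_right: "a *\<^sub>C (- x) = - (a *\<^sub>C (x::'a::complex_vector))"
  using scaleC_add_right[of a x "- x"] by (simp add: eq_neg_iff_add_eq_0 add.commute)

lemma scaleC_diff_right: "a *\<^sub>C (x - y) = a *\<^sub>C x - a *\<^sub>C (y::'a::complex_vector)"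
  using scaleC_add_right[of a x "- y"] by (simp add: scaleC_minus_right)

lemma scaleC_one [simp]: "1 *\<^sub>C (x::'a::complex_vector) = x"
  using scaleR_scaleC[of 1 x] by simp

lemma scaleC_commute: "a *\<^sub>C b *\<^sub>C x = b *\<^sub>C a *\<^sub>C (x::'a::complex_vector)"
  by (simp add: scaleC_scaleC mult.commute)

lemma cinner_zero_left [simp]: "cinner 0 (x::'a::chilbert_space) = 0"
  using cinner_add_left[of 0 0 x] by simp

lemma cinner_zero_right [simp]: "cinner (x::'a::chilbert_space) 0 = 0"
  using cinner_commute[of x 0] by simp

lemma cinner_minus_left: "cinner (- x) (y::'a::chilbert_space) = - cinner x y"
  using cinner_add_left[of x "- x" y] by (simp add: eq_neg_iff_add_eq_0 add.commute)

lemma cinner_diff_left: "cinner (x - y) (z::'a::chilbert_space) = cinner x z - cinner y z"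
  using cinner_add_left[of x "- y" z] by (simp add: cinner_minus_left)

lemma cinner_add_right: "cinner (x::'a::chilbert_space) (y + z) = cinner x y + cinner x z"
  by (metis cinner_add_left cinner_commute complex_cnj_add)

lemma cinner_scaleC_right: "cinner (x::'a::chilbert_space) (a *\<^sub>C y) = cnj a * cinner x y"
  by (metis cinner_scaleC_left cinner_commute complex_cnj_mult)

lemma cinner_minus_right: "cinner (x::'a::chilbert_space) (- y) = - cinner x y"
  by (metis cinner_minus_left cinner_commute complex_cnj_minus)

lemma cinner_diff_right: "cinner (x::'a::chilbert_space) (y - z) = cinner x y - cinner x z"
  by (metis cinner_diff_left cinner_commute complex_cnj_diff)

lemma cinner_self_real: "cinner x x = complex_of_real ((norm (x::'a::chilbert_space))\<^sup>2)"
proof -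
  have "Im (cinner x x) = 0"
    using arg_cong[OF cinner_commute[of x x], of Im] by simp
  moreover have "Re (cinner x x) \<ge> 0"
    using norm_ge_zero[of x] unfolding norm_eq_sqrt_cinner by simp
  ultimately show ?thesis
    by (simp add: norm_eq_sqrt_cinner complex_eq_iff)
qed

lemma norm_scaleC: "norm (a *\<^sub>C x) = cmod a * norm (x::'a::chilbert_space)"
proof -
  have "complex_of_real ((norm (a *\<^sub>C x))\<^sup>2) = (a * cnj a) * cinner x x"
    by (simp only: cinner_self_real[symmetric] cinner_scaleC_left cinner_scaleC_right mult_ac)
  also have "\<dots> = complex_of_real ((cmod a * norm x)\<^sup>2)"
    by (simp add: cinner_self_real complex_norm_square[symmetric] power_mult_distrib)
  finally have "(norm (a *\<^sub>C x))\<^sup>2 = (cmod a * norm x)\<^sup>2"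
    by (simp only: of_real_eq_iff)
  then show ?thesis
    by (simp add: power2_eq_iff_nonneg)
qed


section \<open>The algebra of bounded operators\<close>

typedef (overloaded) 'a bounded_op =
  "{T :: 'a::chilbert_space \<Rightarrow> 'a. clinear T \<and> (\<exists>K. \<forall>x. norm (T x) \<le> K * norm x)}"
  morphisms apply_op Abs_bounded_op
proof
  show "(\<lambda>x. 0) \<in> {T :: 'a \<Rightarrow> 'a. clinear T \<and> (\<exists>K. \<forall>x. norm (T x) \<le> K * norm x)}"
    by (auto simp: clinear_def intro!: exI[of _ 0])
qed

setup_lifting type_definition_bounded_op

notation apply_op (infixr \<open>*\<^sub>V\<close> 70)

instantiation bounded_op :: (chilbert_space) complex_vector
begin

lift_definition zero_bounded_op :: "'a bounded_op" is "\<lambda>x. 0"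
  by (auto simp: clinear_def intro!: exI[of _ 0])

lift_definition plus_bounded_op :: "'a bounded_op \<Rightarrow> 'a bounded_op \<Rightarrow> 'a bounded_op"
  is "\<lambda>S T x. S x + T x"
proof -
  fix S T :: "'a \<Rightarrow> 'a"
  assume S: "clinear S \<and> (\<exists>K. \<forall>x. norm (S x) \<le> K * norm x)"
    and T: "clinear T \<and> (\<exists>K. \<forall>x. norm (T x) \<le> K * norm x)"
  from S T obtain K L where "\<And>x. norm (S x) \<le> K * norm x" "\<And>x. norm (T x) \<le> L * norm x"
    by blast
  then have "norm (S x + T x) \<le> (K + L) * norm x" for x
    using norm_triangle_mono[of "S x" _ "T x"] by (simp add: distrib_right)
  with S T show "clinear (\<lambda>x. S x + T x) \<and> (\<exists>K. \<forall>x. norm (S x + T x) \<le> K * norm x)"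
    by (auto simp: clinear_def scaleC_add_right add_ac intro!: exI[of _ "K + L"])
qed

lift_definition scaleC_bounded_op :: "complex \<Rightarrow> 'a bounded_op \<Rightarrow> 'a bounded_op"
  is "\<lambda>c T x. c *\<^sub>C T x"
proof -
  fix c and T :: "'a \<Rightarrow> 'a"
  assume T: "clinear T \<and> (\<exists>K. \<forall>x. norm (T x) \<le> K * norm x)"
  then obtain K where K: "\<And>x. norm (T x) \<le> K * norm x"
    by blast
  have "norm (c *\<^sub>C T x) \<le> (cmod c * K) * norm x" for x
    using K by (simp add: norm_scaleC mult.assoc mult_left_mono)
  with T show "clinear (\<lambda>x. c *\<^sub>C T x) \<and> (\<exists>K. \<forall>x. norm (c *\<^sub>C T x) \<le> K * norm x)"
    by (auto simp: clinear_def scaleC_add_right scaleC_commute)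
qed

definition uminus_bounded_op :: "'a bounded_op \<Rightarrow> 'a bounded_op"
  where "uminus_bounded_op T = (-1) *\<^sub>C T"

definition minus_bounded_op :: "'a bounded_op \<Rightarrow> 'a bounded_op \<Rightarrow> 'a bounded_op"
  where "minus_bounded_op S T = S + - T"

definition scaleR_bounded_op :: "real \<Rightarrow> 'a bounded_op \<Rightarrow> 'a bounded_op"
  where "scaleR_bounded_op r T = complex_of_real r *\<^sub>C T"

instance
proof -
  have neg: "(- 1) *\<^sub>C y = - y" for y :: 'a
    using scaleR_scaleC[of "-1" y] by simp
  show "OFCLASS('a bounded_op, complex_vector_class)"
    by standard
      ((unfold uminus_bounded_op_def minus_bounded_op_def scaleR_bounded_op_def)?;
       transfer; simp add: fun_eq_iff scaleC_add_right scaleC_add_left scaleC_scaleC neg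
         algebra_simps flip: scaleC_add_left)+
qed

end

lemma apply_op_add: "(S + T) *\<^sub>V x = S *\<^sub>V x + T *\<^sub>V x"
  by transfer simp

lemma apply_op_scaleC: "(c *\<^sub>C T) *\<^sub>V x = c *\<^sub>C (T *\<^sub>V x)"
  by transfer simp

lemma apply_op_zero [simp]: "0 *\<^sub>V x = 0"
  by transfer simp

lemma apply_op_minus: "(- T) *\<^sub>V x = - (T *\<^sub>V x)"
  using apply_op_add[of T "- T" x] by (simp add: eq_neg_iff_add_eq_0 add.commute)

lemma apply_op_diff: "(S - T) *\<^sub>V x = S *\<^sub>V x - T *\<^sub>V x"
  using apply_op_add[of S "- T" x] by (simp add: apply_op_minus)

lemma bounded_op_eqI: "(\<And>x. S *\<^sub>V x = T *\<^sub>V x) \<Longrightarrow> S = T"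
  by (simp add: apply_op_inject[symmetric] fun_eq_iff)

lemma apply_op_add_right: "T *\<^sub>V (x + y) = T *\<^sub>V x + T *\<^sub>V y"
  by transfer (simp add: clinear_def)

lemma apply_op_scaleC_right: "T *\<^sub>V (c *\<^sub>C x) = c *\<^sub>C (T *\<^sub>V x)"
  by transfer (simp add: clinear_def)

text \<open>
  The product is composition. The class \<open>ring_1\<close> is not available, since
  \<open>0 = 1\<close> on the zero space.
\<close>

instantiation bounded_op :: (chilbert_space) "{ring, monoid_mult}"
begin

lift_definition one_bounded_op :: "'a bounded_op" is "\<lambda>x. x"
  by (auto simp: clinear_def intro!: exI[of _ 1])

lift_definition times_bounded_op :: "'a bounded_op \<Rightarrow> 'a bounded_op \<Rightarrow> 'a bounded_op"
  is "\<lambda>S T x. S (T x)"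
proof -
  fix S T :: "'a \<Rightarrow> 'a"
  assume S: "clinear S \<and> (\<exists>K. \<forall>x. norm (S x) \<le> K * norm x)"
    and T: "clinear T \<and> (\<exists>K. \<forall>x. norm (T x) \<le> K * norm x)"
  from S T obtain K L where K: "\<And>x. norm (S x) \<le> K * norm x"
    and L: "\<And>x. norm (T x) \<le> L * norm x"
    by blast
  have "norm (S (T x)) \<le> (\<bar>K\<bar> * L) * norm x" for x
  proof -
    have "norm (S (T x)) \<le> \<bar>K\<bar> * norm (T x)"
      using K[of "T x"] by (rule order_trans) (simp add: mult_right_mono)
    also have "\<dots> \<le> \<bar>K\<bar> * (L * norm x)"
      using L by (simp add: mult_left_mono)
    finally show ?thesis by (simp add: mult.assoc)
  qed
  with S T show "clinear (\<lambda>x. S (T x)) \<and> (\<exists>K. \<forall>x. norm (S (T x)) \<le> K * norm x)"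
    by (auto simp: clinear_def)
qed

instance
  by standard (transfer; simp add: clinear_def)+

end

lemma apply_op_one [simp]: "1 *\<^sub>V x = x"
  by transfer simp

lemma apply_op_times: "(S * T) *\<^sub>V x = S *\<^sub>V T *\<^sub>V x"
  by transfer simp

definition selfadjoint :: "'a::chilbert_space bounded_op \<Rightarrow> bool"
  where "selfadjoint T \<longleftrightarrow> (\<forall>x y. cinner (T *\<^sub>V x) y = cinner x (T *\<^sub>V y))"

definition positive_op :: "'a::chilbert_space bounded_op \<Rightarrow> bool"
  where "positive_op T \<longleftrightarrow> selfadjoint T \<and> (\<forall>x. 0 \<le> Re (cinner (T *\<^sub>V x) x))"

lemma selfadjoint_zero_form:
  assumes "selfadjoint T" and form: "\<And>x. Re (cinner (T *\<^sub>V x) x) = 0"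
  shows "T = 0"
proof (rule bounded_op_eqI)
  fix x
  define y where "y = T *\<^sub>V x"
  have "Re (cinner (T *\<^sub>V (x + y)) (x + y)) = 2 * Re (cinner (T *\<^sub>V x) y)"
    using form[of x] form[of y] assms(1) cinner_commute[of y "T *\<^sub>V x"]
    by (simp add: apply_op_add_right cinner_add_left cinner_add_right selfadjoint_def)
  with form[of "x + y"] have "Re (cinner y y) = 0"
    by (simp add: y_def)
  then show "T *\<^sub>V x = 0 *\<^sub>V x"
    by (simp add: cinner_self_real y_def del: of_real_power)
qed

text \<open>
  \<open>A \<le> B\<close> iff \<open>B - A\<close> is positive. For self-adjoint \<open>A\<close>, \<open>B\<close> this is the usual operator order;
  if \<open>B - A\<close> is not self-adjoint, \<open>A\<close> and \<open>B\<close> are incomparable.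
\<close>

instantiation bounded_op :: (chilbert_space) order
begin

definition less_eq_bounded_op :: "'a bounded_op \<Rightarrow> 'a bounded_op \<Rightarrow> bool"
  where "less_eq_bounded_op S T \<longleftrightarrow> positive_op (T - S)"

definition less_bounded_op :: "'a bounded_op \<Rightarrow> 'a bounded_op \<Rightarrow> bool"
  where "less_bounded_op S T \<longleftrightarrow> S \<le> T \<and> S \<noteq> T"

instance
proof
  fix S T U :: "'a bounded_op"
  show refl: "S \<le> S"
    by (simp add: less_eq_bounded_op_def positive_op_def selfadjoint_def)
  show antisym: "S = T" if "S \<le> T" "T \<le> S" for S T :: "'a bounded_op"
  proof -
    have "Re (cinner ((T - S) *\<^sub>V x) x) = 0" for x
    proof -
      have "Re (cinner ((T - S) *\<^sub>V x) x) \<ge> 0" "Re (cinner ((S - T) *\<^sub>V x) x) \<ge> 0"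
        using that by (auto simp: less_eq_bounded_op_def positive_op_def)
      then show ?thesis
        by (simp add: apply_op_diff cinner_diff_left)
    qed
    with that(1) have "T - S = 0"
      by (intro selfadjoint_zero_form) (auto simp: less_eq_bounded_op_def positive_op_def)
    then show ?thesis by simp
  qed
  show "S \<le> U" if "S \<le> T" "T \<le> U"
  proof -
    have eq: "U - S = (U - T) + (T - S)" by simp
    from that show ?thesis
      unfolding less_eq_bounded_op_def eq positive_op_def selfadjoint_def
      by (auto simp only: apply_op_add cinner_add_left cinner_add_right plus_complex.sel
          intro: add_nonneg_nonneg)
  qed
  show "S < T \<longleftrightarrow> S \<le> T \<and> \<not> T \<le> S"
    using antisym refl by (auto simp: less_bounded_op_def)
qed

end

definition spectrum :: "'a::chilbert_space bounded_op \<Rightarrow> complex set"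
  where "spectrum T = {z. \<not> (\<exists>R. R * (T - z *\<^sub>C 1) = 1 \<and> (T - z *\<^sub>C 1) * R = 1)}"

definition positive_linear_map ::
    "('a::chilbert_space bounded_op \<Rightarrow> 'b::chilbert_space bounded_op) \<Rightarrow> bool"
  where "positive_linear_map \<Phi> \<longleftrightarrow> clinear \<Phi> \<and> (\<forall>T. 0 \<le> T \<longrightarrow> 0 \<le> \<Phi> T)"


section \<open>Borel functional calculus of a self-adjoint operator\<close>

text \<open>
  Projection-valued measures on the Borel sets of the real line, countably additive in the
  strong operator topology.
\<close>

definition projection_valued_measure :: "(real set \<Rightarrow> 'a::chilbert_space bounded_op) \<Rightarrow> bool"
  where "projection_valued_measure E \<longleftrightarrow>
    (\<forall>S\<in>sets borel. selfadjoint (E S) \<and> E S * E S = E S) \<and>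
    E UNIV = 1 \<and>
    (\<forall>S\<in>sets borel. \<forall>T\<in>sets borel. E (S \<inter> T) = E S * E T) \<and>
    (\<forall>S :: nat \<Rightarrow> real set. range S \<subseteq> sets borel \<and> disjoint_family S \<longrightarrow>
      (\<forall>x. (\<lambda>n. E (S n) *\<^sub>V x) sums (E (\<Union>n. S n) *\<^sub>V x)))"

text \<open>The scalar measure \<open>S \<mapsto> \<langle>E(S)x, x\<rangle>\<close>.\<close>

definition scalar_measure :: "(real set \<Rightarrow> 'a::chilbert_space bounded_op) \<Rightarrow> 'a \<Rightarrow> real measure"
  where "scalar_measure E x =
    measure_of UNIV (sets borel) (\<lambda>S. ennreal (Re (cinner (E S *\<^sub>V x) x)))"

text \<open>
  \<open>T = \<integral>\<^sub>S g dE\<close>, in the weak sense. By polarization the quadratic form of \<open>T\<close> determines \<open>T\<close>.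
\<close>

definition has_spectral_integral ::
    "(real set \<Rightarrow> 'a::chilbert_space bounded_op) \<Rightarrow> real set \<Rightarrow> (real \<Rightarrow> real) \<Rightarrow> 'a bounded_op \<Rightarrow> bool"
  where "has_spectral_integral E S g T \<longleftrightarrow>
    (\<forall>x. set_integrable (scalar_measure E x) S g \<and>
         cinner (T *\<^sub>V x) x = complex_of_real (LINT t:S|scalar_measure E x. g t))"

definition real_spectrum :: "'a::chilbert_space bounded_op \<Rightarrow> real set"
  where "real_spectrum A = {t. complex_of_real t \<in> spectrum A}"

text \<open>
  By the spectral theorem every self-adjoint \<open>A\<close> has a spectral measure, unique on Borel sets.
\<close>

definition spectral_measure ::
    "'a::chilbert_space bounded_op \<Rightarrow> (real set \<Rightarrow> 'a bounded_op) \<Rightarrow> bool"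
  where "spectral_measure A E \<longleftrightarrow> projection_valued_measure E \<and> E (real_spectrum A) = 1 \<and>
    has_spectral_integral E (real_spectrum A) (\<lambda>t. t) A"

text \<open>
  \<open>g(A) = \<integral> g dE\<close> over the spectrum of \<open>A\<close>; values of \<open>g\<close> off the spectrum are irrelevant, so
  a function on \<open>J\<close> can be represented by any total extension if the spectrum lies in \<open>J\<close>.
\<close>

definition functional_calculus ::
    "(real \<Rightarrow> real) \<Rightarrow> 'a::chilbert_space bounded_op \<Rightarrow> 'a bounded_op"
  where "functional_calculus g A =
    (THE T. \<exists>E. spectral_measure A E \<and> has_spectral_integral E (real_spectrum A) g T)"

end

theory Submission
  imports Defs "HOL-Computational_Algebra.Polynomial" "HOL-Probability.Helly_Selection"
begin

text \<open>
  For real \<open>s\<close> and \<open>t\<close> in \<open>J\<close> the supporting line of \<open>f\<close> at \<open>s\<close> gives \<open>f s \<le> f t + C s * s - t * C s\<close>. This is an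
  inequality between functions of \<open>s\<close> on the spectrum of \<open>A i\<close>, so the functional calculus turns it
  into one between operators; applying \<open>\<Phi> i\<close> and summing over \<open>i\<close> gives
  \<open>L \<le> f t \<cdot> 1 + P - t \<cdot> Q\<close> with \<open>L = \<Sum> \<Phi>\<^sub>i(f(A\<^sub>i))\<close>, \<open>P = \<Sum> \<Phi>\<^sub>i(C\<^bsub>A\<^sub>i\<^esub> A\<^sub>i)\<close> and \<open>Q = \<Sum> \<Phi>\<^sub>i(C\<^bsub>A\<^sub>i\<^esub>)\<close>. Let
  \<open>B = \<Sum> \<Phi>\<^sub>i(A\<^sub>i)\<close>. For a unit vector \<open>x\<close> take \<open>t = \<langle>Bx, x\<rangle>\<close>, which lies in \<open>J\<close>: then
  \<open>\<langle>Lx, x\<rangle> \<le> f t + \<langle>Px, x\<rangle> - \<langle>Bx, x\<rangle>\<langle>Qx, x\<rangle> \<le> f t + \<delta>\<close>. Finally \<open>f \<langle>Bx, x\<rangle> \<le> \<langle>f(B)x, x\<rangle>\<close> is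
  Jensen's inequality, the calculus of \<open>B\<close> applied to the supporting line of \<open>f\<close> at \<open>t\<close>.
  
  Almost all of the work is the functional calculus itself: the description that defines it means
  nothing until the spectral theorem, existence and uniqueness, is proved.
  
  Existence. Let \<open>a \<le> A \<le> b\<close>. For every vector \<open>x\<close> the functional \<open>p \<mapsto> \<langle>p(A)x, x\<rangle>\<close> on real polynomials
  is nonnegative on the products \<open>(X - a)\<^sup>k (b - X)\<^sup>l\<close> (\<open>form_poly_op_nonneg\<close>). That is what Hausdorff's
  moment problem asks for, and its solution (\<open>moment_problem_interval\<close>, by Bernstein weights and
  Helly's selection theorem) is a measure \<open>\<mu>\<^sub>x\<close> on \<open>[a, b]\<close> that represents the functional. Since
  \<open>\<parallel>p(A)x\<parallel>\<^sup>2 = \<integral> p\<^sup>2 d\<mu>\<^sub>x\<close>, the map \<open>p \<mapsto> p(A)x\<close> is isometric from \<open>L\<^sup>2(\<mu>\<^sub>x)\<close>, and polynomials are dense there;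
  so \<open>g(A)x\<close> can be defined as the limit of \<open>p\<^sub>n(A)x\<close> with \<open>p\<^sub>n \<rightarrow> g\<close> in \<open>L\<^sup>2(\<mu>\<^sub>x)\<close>. Density is proved for
  finitely many measures at once (\<open>L2_poly_dense\<close>): one sequence \<open>p\<^sub>n\<close> then serves several vectors,
  and linearity, self-adjointness and multiplicativity of \<open>g(A)\<close> pass to the limit from polynomials.
  The operators \<open>1\<^sub>S(A)\<close> are a spectral measure; the real spectrum is the common support of the
  measures \<open>\<mu>\<^sub>x\<close>.
  
  Uniqueness. A spectral measure \<open>E\<close> of \<open>A\<close> commutes with \<open>A\<close>, because the form of \<open>A\<close> splits along
  \<open>E(S)\<close> and \<open>E(-S)\<close>; hence it commutes with the one constructed. On the common range of
  \<open>P((-\<infinity>, c])\<close> and \<open>Q([d, \<infinity>))\<close>, where \<open>P\<close> and \<open>Q\<close> are the two spectral measures and \<open>c < d\<close>, the form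
  of \<open>A\<close> would be both at most \<open>c\<close> and at least \<open>d\<close>; so that range is zero, and the two measures agree
  on half-lines.
\<close>

section \<open>Inner products and bounded operators\<close>

lemma cinner_scaleR_left: "cinner (r *\<^sub>R x) (y::'a::chilbert_space) = of_real r * cinner x y"
  by (simp add: scaleR_scaleC cinner_scaleC_left)

lemma cinner_scaleR_right: "cinner (x::'a::chilbert_space) (r *\<^sub>R y) = of_real r * cinner x y"
  by (simp add: scaleR_scaleC cinner_scaleC_right)

lemma Cauchy_Schwarz_cinner: "cmod (cinner x y) \<le> norm x * norm (y::'a::chilbert_space)"
proof (cases "y = 0")
  case False
  define c where "c = cinner x y / of_real ((norm y)\<^sup>2)"
  have n: "(norm y)\<^sup>2 > 0" using False by simp
  have "cinner (x - c *\<^sub>C y) (x - c *\<^sub>C y)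
      = cinner x x - c * cinner y x - cnj c * cinner x y + c * cnj c * cinner y y"
    by (simp add: cinner_diff_left cinner_diff_right cinner_scaleC_left cinner_scaleC_right algebra_simps)
  also have "\<dots> = of_real ((norm x)\<^sup>2) - of_real ((cmod (cinner x y))\<^sup>2 / (norm y)\<^sup>2)"
    using n unfolding c_def cinner_self_real cinner_commute[of y x]
    by (simp add: divide_simps complex_norm_square[unfolded power2_eq_square of_real_mult] power2_eq_square)
  finally have "complex_of_real ((norm (x - c *\<^sub>C y))\<^sup>2)
      = of_real ((norm x)\<^sup>2 - (cmod (cinner x y))\<^sup>2 / (norm y)\<^sup>2)"
    by (simp only: cinner_self_real of_real_diff)
  then have "(norm (x - c *\<^sub>C y))\<^sup>2 = (norm x)\<^sup>2 - (cmod (cinner x y))\<^sup>2 / (norm y)\<^sup>2"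
    by (simp only: of_real_eq_iff)
  then have "(cmod (cinner x y))\<^sup>2 / (norm y)\<^sup>2 \<le> (norm x)\<^sup>2"
    by (smt (verit) zero_le_power2)
  then have "(cmod (cinner x y))\<^sup>2 \<le> (norm x * norm y)\<^sup>2"
    using n by (simp add: divide_simps power_mult_distrib split: if_splits)
  then show ?thesis
    by (rule power2_le_imp_le) simp
qed simp

interpretation cinner: bounded_bilinear "cinner :: 'a::chilbert_space \<Rightarrow> 'a \<Rightarrow> complex"
proof
  show "\<exists>K. \<forall>a b::'a. norm (cinner a b) \<le> norm a * norm b * K"
    by (intro exI[of _ 1]) (simp add: Cauchy_Schwarz_cinner)
qed (simp_all add: cinner_add_left cinner_add_right cinner_scaleR_left cinner_scaleR_right scaleR_conv_of_real)

lemma Re_cinner_self: "Re (cinner x x) = (norm (x::'a::chilbert_space))\<^sup>2"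
  by (simp add: cinner_self_real del: of_real_power)

lemma bounded_linear_apply_op: "bounded_linear (apply_op T)"
proof -
  have "\<exists>K. \<forall>x. norm (T *\<^sub>V x) \<le> K * norm x"
    by transfer blast
  then obtain K where "\<And>x. norm (T *\<^sub>V x) \<le> K * norm x" by blast
  then show ?thesis
    by (intro bounded_linear_intro[of _ K])
      (simp_all add: apply_op_add_right scaleR_scaleC apply_op_scaleC_right mult.commute)
qed

lemmas apply_op_zero_right [simp] = linear_0[OF bounded_linear.linear[OF bounded_linear_apply_op]]
lemmas apply_op_scaleR_right = linear_cmul[OF bounded_linear.linear[OF bounded_linear_apply_op]]
lemmas tendsto_apply_op = bounded_linear.tendsto[OF bounded_linear_apply_op]

lemma apply_op_scaleR: "(r *\<^sub>R T) *\<^sub>V x = r *\<^sub>R (T *\<^sub>V x)"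
  by (simp add: scaleR_scaleC apply_op_scaleC)

lemma apply_op_sum: "(\<Sum>i\<in>I. T i) *\<^sub>V x = (\<Sum>i\<in>I. T i *\<^sub>V x)"
  by (induction I rule: infinite_finite_induct) (simp_all add: apply_op_add)

lemma bounded_op_scaleR_left: "(r *\<^sub>R S) * T = r *\<^sub>R (S * (T::'a::chilbert_space bounded_op))"
  by (rule bounded_op_eqI) (simp add: apply_op_times apply_op_scaleR)

lemma bounded_op_scaleR_right: "S * (r *\<^sub>R T) = r *\<^sub>R (S * (T::'a::chilbert_space bounded_op))"
  by (rule bounded_op_eqI) (simp add: apply_op_times apply_op_scaleR apply_op_scaleR_right)

section \<open>Self-adjoint operators and the order\<close>

lemma selfadjointD: "selfadjoint T \<Longrightarrow> cinner (T *\<^sub>V x) y = cinner x (T *\<^sub>V y)"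
  by (simp add: selfadjoint_def)

lemma selfadjoint_one [simp]: "selfadjoint 1"
  and selfadjoint_0 [simp]: "selfadjoint 0"
  by (simp_all add: selfadjoint_def)

lemma selfadjoint_add: "selfadjoint S \<Longrightarrow> selfadjoint T \<Longrightarrow> selfadjoint (S + T)"
  by (simp add: selfadjoint_def apply_op_add cinner_add_left cinner_add_right)

lemma selfadjoint_diff: "selfadjoint S \<Longrightarrow> selfadjoint T \<Longrightarrow> selfadjoint (S - T)"
  by (simp add: selfadjoint_def apply_op_diff cinner_diff_left cinner_diff_right)

lemma selfadjoint_scaleR: "selfadjoint T \<Longrightarrow> selfadjoint (r *\<^sub>R T)"
  by (simp add: selfadjoint_def apply_op_scaleR cinner_scaleR_left cinner_scaleR_right)

lemma selfadjoint_sum: "(\<And>i. i \<in> I \<Longrightarrow> selfadjoint (T i)) \<Longrightarrow> selfadjoint (\<Sum>i\<in>I. T i)"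
  by (induction I rule: infinite_finite_induct) (simp_all add: selfadjoint_add)

lemma selfadjoint_times_commuting:
  "selfadjoint S \<Longrightarrow> selfadjoint T \<Longrightarrow> S * T = T * S \<Longrightarrow> selfadjoint (S * T)"
  by (metis apply_op_times selfadjoint_def)

lemma selfadjoint_form_real:
  assumes "selfadjoint T"
  shows "cinner (T *\<^sub>V x) x = complex_of_real (Re (cinner (T *\<^sub>V x) x))"
proof -
  have "cinner (T *\<^sub>V x) x = cnj (cinner (T *\<^sub>V x) x)"
    using selfadjointD[OF assms, of x x] cinner_commute[of x "T *\<^sub>V x"] by simp
  then show ?thesis
    by (metis cnj.simps(2) complex_eq_iff complex_of_real_def neg_equal_zero complex.sel)
qed

lemma bounded_op_le_iff:
  "S \<le> T \<longleftrightarrow> selfadjoint (T - S) \<and> (\<forall>x. Re (cinner (S *\<^sub>V x) x) \<le> Re (cinner (T *\<^sub>V x) x))"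
  by (simp add: less_eq_bounded_op_def positive_op_def apply_op_diff cinner_diff_left)

instance bounded_op :: (chilbert_space) ordered_ab_group_add
  by standard (simp add: less_eq_bounded_op_def)

lemma selfadjoint_eqI:
  assumes "selfadjoint S" "selfadjoint T"
    and "\<And>x. Re (cinner (S *\<^sub>V x) x) = Re (cinner (T *\<^sub>V x) x)"
  shows "S = T"
  using selfadjoint_zero_form[of "S - T"] assms
  by (simp add: selfadjoint_diff apply_op_diff cinner_diff_left)

section \<open>Polynomials of an operator\<close>

text \<open>
  The Horner scheme, the recursion that also defines \<open>poly\<close>. The latter cannot be used, since
  bounded operators are not commutative and do not form a \<open>comm_semiring_0\<close>.
\<close>

definition poly_op :: "'a::chilbert_space bounded_op \<Rightarrow> real poly \<Rightarrow> 'a bounded_op"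
  where "poly_op A p = fold_coeffs (\<lambda>c T. c *\<^sub>R 1 + A * T) p 0"

lemma poly_op_0 [simp]: "poly_op A 0 = 0"
  by (simp add: poly_op_def)

lemma poly_op_pCons [simp]: "poly_op A (pCons c p) = c *\<^sub>R 1 + A * poly_op A p"
  by (cases "p = 0 \<and> c = 0") (auto simp: poly_op_def)

lemma poly_op_add: "poly_op A (p + q) = poly_op A p + poly_op A q"
  by (induction p q rule: poly_induct2) (simp_all add: algebra_simps)

lemma poly_op_smult: "poly_op A (smult c p) = c *\<^sub>R poly_op A p"
  by (induction p) (simp_all add: scaleR_add_right bounded_op_scaleR_right)

lemma poly_op_diff: "poly_op A (p - q) = poly_op A p - poly_op A q"
  using poly_op_add[of A "p - q" q] by simp

lemma poly_op_mult: "poly_op A (p * q) = poly_op A p * poly_op A q"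
  by (induction p)
    (simp_all add: poly_op_add poly_op_smult bounded_op_scaleR_left distrib_right mult.assoc)

lemma poly_op_commutes:
  assumes "S * A = A * S"
  shows "S * poly_op A p = poly_op A p * S"
proof (induction p)
  case (pCons c p)
  have "S * (A * poly_op A p) = A * (S * poly_op A p)"
    using assms by (simp flip: mult.assoc)
  with pCons show ?case
    by (simp add: distrib_left distrib_right bounded_op_scaleR_left bounded_op_scaleR_right mult.assoc)
qed simp

lemma selfadjoint_poly_op: "selfadjoint A \<Longrightarrow> selfadjoint (poly_op A p)"
  by (induction p)
    (auto simp: poly_op_commutes intro!: selfadjoint_add selfadjoint_scaleR selfadjoint_times_commuting)

text \<open>The form of \<open>r(A)\<close> at \<open>q(A)x\<close> is the form of \<open>(r q\<^sup>2)(A)\<close> at \<open>x\<close>.\<close>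

lemma form_poly_op_square:
  assumes "selfadjoint A"
  shows "cinner (poly_op A (r * q\<^sup>2) *\<^sub>V x) x = cinner (poly_op A r *\<^sub>V poly_op A q *\<^sub>V x) (poly_op A q *\<^sub>V x)"
proof -
  have eq: "r * q\<^sup>2 = q * r * q" by (simp only: power2_eq_square mult_ac)
  show ?thesis
    unfolding eq by (simp add: poly_op_mult apply_op_times selfadjointD[OF selfadjoint_poly_op[OF assms], of q])
qed

lemma norm_poly_op:
  assumes "selfadjoint A"
  shows "(norm (poly_op A q *\<^sub>V x))\<^sup>2 = Re (cinner (poly_op A (q\<^sup>2) *\<^sub>V x) x)"
  using form_poly_op_square[OF assms, of 1 q x]
  by (simp add: Re_cinner_self one_pCons)

text \<open>
  Write \<open>u = X - a\<close> and \<open>v = b - X\<close>. Even powers split off as squares \<open>q\<^sup>2\<close>, which keep the form of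
  \<open>r(A)\<close> nonnegative because it is merely evaluated at \<open>q(A)x\<close>. There remain the factors \<open>1\<close>, \<open>u\<close>,
  \<open>v\<close> and \<open>u v\<close>, and the last one reduces to squares by \<open>(b - a) u v = u v\<^sup>2 + v u\<^sup>2\<close>.
\<close>

lemma form_poly_op_nonneg:
  assumes A: "selfadjoint A" and "a < b"
    and lo: "\<And>x. a * (norm x)\<^sup>2 \<le> Re (cinner (A *\<^sub>V x) x)"
    and hi: "\<And>x. Re (cinner (A *\<^sub>V x) x) \<le> b * (norm x)\<^sup>2"
  shows "0 \<le> Re (cinner (poly_op A ([:- a, 1:] ^ k * [:b, - 1:] ^ l) *\<^sub>V x) x)"
proof -
  let ?u = "[:- a, 1:]" and ?v = "[:b, - 1:]"
  let ?pos = "\<lambda>r. \<forall>x. 0 \<le> Re (cinner (poly_op A r *\<^sub>V x) x)"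
  have sq: "?pos (r * q\<^sup>2)" if "?pos r" for r q
    using that by (simp add: form_poly_op_square[OF A])
  have 1: "?pos 1" by (simp add: one_pCons Re_cinner_self)
  have u: "?pos ?u"
    using lo by (simp add: apply_op_add apply_op_minus apply_op_scaleR cinner_add_left
        cinner_minus_left cinner_scaleR_left Re_cinner_self apply_op_diff cinner_diff_left)
  have v: "?pos ?v"
    using hi by (simp add: apply_op_add apply_op_minus apply_op_times apply_op_scaleR cinner_add_left
        cinner_minus_left cinner_scaleR_left Re_cinner_self apply_op_diff cinner_diff_left)
  have uv: "?pos (?u * ?v)"
  proof
    fix x
    \<comment> \<open>multiply \<open>u v\<close> by \<open>u + v = b - a\<close>\<close>
    have smult: "smult c p = [:c:] * p" for c and p :: "real poly" by simp
    have "?u * ?v = smult (1 / (b - a)) (smult (b - a) (?u * ?v))"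
      using \<open>a < b\<close> unfolding smult_smult by (simp del: mult_pCons_left mult_pCons_right)
    also have "smult (b - a) (?u * ?v) = (?u + ?v) * (?u * ?v)"
      unfolding smult by simp
    also have "\<dots> = ?u * ?v\<^sup>2 + ?v * ?u\<^sup>2"
      by (simp only: power2_eq_square distrib_left distrib_right mult_ac add_ac)
    finally have "?u * ?v = smult (1 / (b - a)) (?u * ?v\<^sup>2 + ?v * ?u\<^sup>2)" .
    then show "0 \<le> Re (cinner (poly_op A (?u * ?v) *\<^sub>V x) x)"
      using sq[OF u, of ?v] sq[OF v, of ?u] \<open>a < b\<close>
      by (simp only: poly_op_smult poly_op_add apply_op_scaleR apply_op_add cinner_scaleR_left cinner_add_left)
        simp
  qed
  have "?pos (?u ^ (k mod 2) * ?v ^ (l mod 2))"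
    using 1 u v uv by (cases "even k"; cases "even l") (simp_all add: even_iff_mod_2_eq_zero odd_iff_mod_2_eq_one del: mult_pCons_left mult_pCons_right)
  then have "?pos (?u ^ (k mod 2) * ?v ^ (l mod 2) * (?u ^ (k div 2) * ?v ^ (l div 2))\<^sup>2)"
    by (rule sq)
  also have "?u ^ (k mod 2) * ?v ^ (l mod 2) * (?u ^ (k div 2) * ?v ^ (l div 2))\<^sup>2
     = ?u ^ (k mod 2 + (k div 2) * 2) * ?v ^ (l mod 2 + (l div 2) * 2)"
    unfolding power_mult_distrib power_add power_mult by (simp only: mult_ac)
  finally show ?thesis by simp
qed


section \<open>The moment problem on a compact interval\<close>

text \<open>
  Hausdorff's moment problem. Put the Bernstein weight \<open>w n k = (n choose k) L(X\<^sup>k (1 - X)\<^sup>n\<^sup>-\<^sup>k)\<close> at the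
  point \<open>k / n\<close>. Averaging \<open>(k choose m) / (n choose m)\<close> against these weights gives \<open>L(X\<^sup>m)\<close> exactly,
  by the binomial theorem, and this quotient differs from \<open>(k / n)\<^sup>m\<close> by \<open>O(1/n)\<close> uniformly in \<open>k\<close>. So
  the \<open>m\<close>-th moments of the discrete measures tend to \<open>L(X\<^sup>m)\<close>. All of them live on the unit interval,
  hence are tight, and any weak limit point is the measure sought.
\<close>

lemma moment_problem_prob_unit_interval:
  fixes L :: "real poly \<Rightarrow> real"
  assumes add: "\<And>p q. L (p + q) = L p + L q" and smult: "\<And>c p. L (smult c p) = c * L p"
    and pos: "\<And>k l. 0 \<le> L ([:0, 1:] ^ k * [:1, - 1:] ^ l)"
    and one: "L 1 = 1"
  shows "\<exists>M. finite_measure M \<and> sets M = sets borel \<and> (AE t in M. t \<in> {0..1}) \<and>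
    (\<forall>p. integral\<^sup>L M (poly p) = L p)"
proof -
  let ?X = "[:0, 1:] :: real poly" and ?Y = "[:1, - 1:] :: real poly"
  have L0: "L 0 = 0" using smult[of 0 0] by simp
  have L_sum: "L (\<Sum>i\<in>I. c i) = (\<Sum>i\<in>I. L (c i))" if "finite I" for I :: "nat set" and c
    using that by (induction I rule: finite_induct) (simp_all add: add L0)
  define w where "w n k = real (n choose k) * L (?X ^ k * ?Y ^ (n - k))" for n k
  have w_nonneg: "0 \<le> w n k" for n k
    by (simp add: w_def pos)
  have w_moment: "(\<Sum>k\<le>n. w n k * (real (k choose m) / real (n choose m))) = L (?X ^ m)"
    if "m \<le> n" for m n
  proof -
    have "(\<Sum>k\<le>n. w n k * (real (k choose m) / real (n choose m)))
        = (\<Sum>k\<in>{m..n}. w n k * (real (k choose m) / real (n choose m)))"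
      by (rule sum.mono_neutral_right) auto
    also have "\<dots> = (\<Sum>k\<in>{m..n}. real ((n - m) choose (k - m)) * L (?X ^ k * ?Y ^ (n - k)))"
    proof (rule sum.cong)
      fix k assume "k \<in> {m..n}"
      then have "(n choose k) * (k choose m) = (n choose m) * ((n - m) choose (k - m))"
        by (simp add: choose_mult)
      then have "real (n choose k) * real (k choose m) = real (n choose m) * real ((n - m) choose (k - m))"
        by (metis of_nat_mult)
      then show "w n k * (real (k choose m) / real (n choose m))
          = real ((n - m) choose (k - m)) * L (?X ^ k * ?Y ^ (n - k))"
        using that by (simp add: w_def divide_simps)
    qed simp
    also have "\<dots> = (\<Sum>j\<le>n - m. real ((n - m) choose j) * L (?X ^ (j + m) * ?Y ^ (n - (j + m))))"
      using that by (intro sum.reindex_bij_witness[of _ "\<lambda>j. j + m" "\<lambda>k. k - m"]) auto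
    also have "\<dots> = L (?X ^ m * (\<Sum>j\<le>n - m. of_nat ((n - m) choose j) * ?X ^ j * ?Y ^ (n - m - j)))"
    proof -
      have "?X ^ m * (of_nat c * ?X ^ j * ?Y ^ (n - m - j)) = smult (real c) (?X ^ (j + m) * ?Y ^ (n - (j + m)))" for c j
      proof -
        have "?X ^ m * (of_nat c * ?X ^ j * ?Y ^ (n - m - j)) = of_nat c * (?X ^ (j + m) * ?Y ^ (n - (j + m)))"
          by (simp only: power_add mult_ac diff_diff_left add.commute[of m])
        also have "of_nat c * q = smult (real c) q" for q :: "real poly" by (simp add: of_nat_poly)
        finally show ?thesis .
      qed
      then show ?thesis
        by (simp only: sum_distrib_left L_sum[OF finite_atMost] smult)
    qed
    also have "(\<Sum>j\<le>n - m. of_nat ((n - m) choose j) * ?X ^ j * ?Y ^ (n - m - j)) = (?X + ?Y) ^ (n - m)"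
      by (rule binomial_ring[symmetric])
    also have "?X + ?Y = 1" by (simp add: one_pCons)
    finally show ?thesis by simp
  qed
  have w_sum: "(\<Sum>k\<le>n. w n k) = 1" for n
    using w_moment[of 0 n] one by simp
  \<comment> \<open>Both quotients are products of \<open>m\<close> factors in \<open>[-1, 1]\<close>, which differ factor by factor by at
    most \<open>m / (n - m)\<close>.\<close>
  have power_close: "\<bar>real (k choose m) / real (n choose m) - (real k / real n) ^ m\<bar>
      \<le> real m * (real m / real (n - m))" if "k \<le> n" "2 * m < n" for k m n
  proof -
    have "real (k choose m) / real (n choose m) = (\<Prod>i<m. (real k - real i) / (real n - real i))"
      by (simp add: binomial_gbinomial gbinomial_prod_rev prod_dividef atLeast0LessThan)
    then have "\<bar>real (k choose m) / real (n choose m) - (real k / real n) ^ m\<bar>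
        = norm ((\<Prod>i<m. (real k - real i) / (real n - real i)) - (\<Prod>i<m. real k / real n))"
      by simp
    also have "\<dots> \<le> (\<Sum>i<m. norm ((real k - real i) / (real n - real i) - real k / real n))"
      using that by (intro norm_prod_diff) (auto simp: abs_le_iff divide_simps)
    also have "\<dots> \<le> (\<Sum>i<m. real m / real (n - m))"
    proof (rule sum_mono)
      fix i assume "i \<in> {..<m}"
      then have i: "real i \<le> real m" by simp
      have n: "0 < real n" "0 < real n - real i" "0 < real n - real m" using that i by linarith+
      have "(real k - real i) / (real n - real i) - real k / real n
          = - (real i * (real n - real k) / (real n * (real n - real i)))"
        using n by (simp add: field_simps)
      then have "norm ((real k - real i) / (real n - real i) - real k / real n)
          = real i / (real n - real i) * ((real n - real k) / real n)"
        using n that by (simp add: abs_mult)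
      also have "\<dots> \<le> real i / (real n - real i) * 1"
        using n that by (intro mult_left_mono) (auto simp: divide_simps)
      also have "\<dots> \<le> real m / (real n - real m)"
        using n i by (simp add: frac_le)
      finally show "norm ((real k - real i) / (real n - real i) - real k / real n) \<le> real m / real (n - m)"
        using that by (simp add: of_nat_diff)
    qed
    finally show ?thesis by simp
  qed
  have power_lim: "(\<lambda>n. \<Sum>k\<le>n. w n k * (real k / real n) ^ m) \<longlonglongrightarrow> L (?X ^ m)" for m
  proof -
    have "(\<lambda>n. (\<Sum>k\<le>n. w n k * (real k / real n) ^ m) - L (?X ^ m)) \<longlonglongrightarrow> 0"
    proof (rule Lim_null_comparison)
      show "\<forall>\<^sub>F n in sequentially. norm ((\<Sum>k\<le>n. w n k * (real k / real n) ^ m) - L (?X ^ m))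
          \<le> real m * (real m / real (n - m))"
        using eventually_gt_at_top[of "2 * m"]
      proof eventually_elim
        case (elim n)
        have "norm ((\<Sum>k\<le>n. w n k * (real k / real n) ^ m) - L (?X ^ m))
           = norm (\<Sum>k\<le>n. w n k * ((real k / real n) ^ m - real (k choose m) / real (n choose m)))"
          using w_moment[of m n] elim by (simp add: right_diff_distrib sum_subtractf)
        also have "\<dots> \<le> (\<Sum>k\<le>n. norm (w n k * ((real k / real n) ^ m - real (k choose m) / real (n choose m))))"
          by (rule norm_sum)
        also have "\<dots> \<le> (\<Sum>k\<le>n. w n k * (real m * (real m / real (n - m))))"
        proof (rule sum_mono)
          fix k assume "k \<in> {..n}"
          then have "\<bar>(real k / real n) ^ m - real (k choose m) / real (n choose m)\<bar>
              \<le> real m * (real m / real (n - m))"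
            using power_close[of k n m] elim by (subst abs_minus_commute) simp
          then show "norm (w n k * ((real k / real n) ^ m - real (k choose m) / real (n choose m)))
              \<le> w n k * (real m * (real m / real (n - m)))"
            unfolding real_norm_def abs_mult abs_of_nonneg[OF w_nonneg]
            by (rule mult_left_mono) (rule w_nonneg)
        qed
        also have "\<dots> = real m * (real m / real (n - m))"
          by (simp only: sum_distrib_right[symmetric] w_sum mult_1)
        finally show ?case .
      qed
      show "(\<lambda>n. real m * (real m / real (n - m))) \<longlonglongrightarrow> 0"
      proof (rule tendsto_mult_right_zero, rule LIMSEQ_offset[of _ m])
        show "(\<lambda>n. real m / real (n + m - m)) \<longlonglongrightarrow> 0"
          using lim_const_over_n[of "real m"] by simp
      qed
    qed
    then show ?thesis by (rule LIM_zero_cancel)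
  qed

  define P where "P n = point_measure {..n} (\<lambda>k. ennreal (w n k))" for n
  define \<mu> where "\<mu> n = distr (P n) borel (\<lambda>k. real k / real n)" for n
  have spP: "space (P n) = {..n}" for n by (simp add: P_def space_point_measure)
  have measP: "(\<lambda>k. real k / real n) \<in> borel_measurable (P n)" for n
    by (simp add: P_def)
  have prob: "prob_space (P n)" for n
  proof
    show "emeasure (P n) (space (P n)) = 1"
      using w_sum[of n] w_nonneg[of n] unfolding spP
      by (simp add: P_def emeasure_point_measure_finite sum_ennreal)
  qed
  have distr: "real_distribution (\<mu> n)" for n
    unfolding \<mu>_def by (intro prob_space.real_distribution_distr prob measP)
  have integral: "integral\<^sup>L (\<mu> n) g = (\<Sum>k\<le>n. w n k * g (real k / real n))"
    if "g \<in> borel_measurable borel" for g :: "real \<Rightarrow> real" and n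
    using integral_distr[OF measP that] w_nonneg[of n]
    by (simp add: \<mu>_def) (simp add: P_def lebesgue_integral_point_measure_finite)
  have clamp: "0 \<le> real k / real n" "real k / real n \<le> 1" if "k \<le> n" for k n
    using that by (auto simp: divide_simps)
  have "tight \<mu>"
    unfolding tight_def
  proof (intro conjI allI impI distr)
    fix e :: real assume "0 < e"
    have "1 - e < measure (\<mu> n) {- 1<..1}" for n
    proof -
      have "(\<lambda>k. real k / real n) -` {- 1<..1} \<inter> space (P n) = space (P n)"
        using clamp by (force simp: spP intro: less_le_trans[of "-1" 0])
      then have "measure (\<mu> n) {- 1<..1} = 1"
        using prob_space.prob_space[OF prob] by (simp add: \<mu>_def measure_distr measP)
      then show ?thesis using \<open>0 < e\<close> by simp
    qed
    then show "\<exists>a b. a < b \<and> (\<forall>n. 1 - e < measure (\<mu> n) {a<..b})"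
      by (intro exI[of _ "- 1"] exI[of _ 1]) simp
  qed
  then obtain r M where r: "strict_mono r" and M: "real_distribution M"
    and conv: "weak_conv_m (\<mu> \<circ> id \<circ> r) M"
    using tight_imp_convergent_subsubsequence[of \<mu> id] by (auto simp: strict_mono_id)
  interpret M: real_distribution M by (rule M)
  have lim: "(\<lambda>n. integral\<^sup>L (\<mu> (r n)) g) \<longlonglongrightarrow> integral\<^sup>L M g"
    if "\<And>x. isCont g x" "\<And>x. norm (g x) \<le> 1" for g :: "real \<Rightarrow> real"
    using weak_conv_imp_integral_bdd_continuous_conv[of "\<mu> \<circ> id \<circ> r" M g 1] that distr M conv by simp
  \<comment> \<open>test function that is positive exactly off the unit interval\<close>
  define h :: "real \<Rightarrow> real" where "h t = min 1 \<bar>t - max 0 (min 1 t)\<bar>" for t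
  have hcont: "isCont h x" for x unfolding h_def by (intro continuous_intros)
  have "(\<lambda>n. integral\<^sup>L (\<mu> (r n)) h) \<longlonglongrightarrow> integral\<^sup>L M h"
    by (rule lim[OF hcont]) (simp add: h_def)
  moreover have "integral\<^sup>L (\<mu> n) h = 0" for n
  proof -
    have "h \<in> borel_measurable borel" unfolding h_def by measurable
    then have "integral\<^sup>L (\<mu> n) h = (\<Sum>k\<le>n. w n k * h (real k / real n))" by (rule integral)
    also have "\<dots> = 0" by (rule sum.neutral) (use clamp in \<open>simp add: h_def\<close>)
    finally show ?thesis .
  qed
  ultimately have int0: "integral\<^sup>L M h = 0"
    by (simp add: LIMSEQ_const_iff)
  have hM: "integrable M h"
  proof (rule M.integrable_const_bound[of _ 1])
    show "h \<in> borel_measurable M" unfolding h_def by measurable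
  qed (simp add: h_def)
  have "AE t in M. h t = 0"
    using int0 integral_nonneg_eq_0_iff_AE[OF hM] by (simp add: h_def)
  then have AE: "AE t in M. t \<in> {0..1}"
    by eventually_elim (auto simp: h_def min_def max_def split: if_splits)
  have moment: "integral\<^sup>L M (\<lambda>t. t ^ m) = L (?X ^ m)" for m
  proof -
    \<comment> \<open>Weak convergence needs bounded test functions, so the power is frozen off the unit interval.\<close>
    let ?g = "\<lambda>t::real. (max 0 (min 1 t)) ^ m"
    have "(\<lambda>n. integral\<^sup>L (\<mu> (r n)) ?g) \<longlonglongrightarrow> integral\<^sup>L M ?g"
      by (rule lim) (auto intro!: continuous_intros power_le_one)
    moreover have "integral\<^sup>L (\<mu> n) ?g = (\<Sum>k\<le>n. w n k * (real k / real n) ^ m)" for n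
    proof -
      have "integral\<^sup>L (\<mu> n) ?g = (\<Sum>k\<le>n. w n k * ?g (real k / real n))"
        by (rule integral) measurable
      also have "\<dots> = (\<Sum>k\<le>n. w n k * (real k / real n) ^ m)"
        by (rule sum.cong) (use clamp in \<open>auto simp: min_absorb2\<close>)
      finally show ?thesis .
    qed
    moreover have "(\<lambda>n. \<Sum>k\<le>r n. w (r n) k * (real k / real (r n)) ^ m) \<longlonglongrightarrow> L (?X ^ m)"
      using LIMSEQ_subseq_LIMSEQ[OF power_lim r] by (simp add: o_def)
    ultimately have "integral\<^sup>L M ?g = L (?X ^ m)"
      using LIMSEQ_unique by simp
    moreover have "integral\<^sup>L M (\<lambda>t. t ^ m) = integral\<^sup>L M ?g"
    proof (rule integral_cong_AE)
      show "AE t in M. t ^ m = ?g t"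
        using AE by (rule eventually_mono) auto
    qed simp_all
    ultimately show ?thesis by simp
  qed
  have int: "integrable M (\<lambda>t. t ^ m)" for m
  proof (rule M.integrable_const_bound[of _ 1])
    show "AE t in M. norm (t ^ m) \<le> 1"
      using AE by (rule eventually_mono) (auto simp: power_le_one power_abs)
  qed simp
  have poly: "integrable M (poly p) \<and> integral\<^sup>L M (poly p) = L p" for p
  proof -
    have p: "p = (\<Sum>i\<le>degree p. smult (coeff p i) (?X ^ i))"
      using poly_as_sum_of_monoms[of p] by (simp add: monom_altdef)
    have eq: "poly p = (\<lambda>t. \<Sum>i\<le>degree p. coeff p i * t ^ i)"
      by (rule ext) (simp add: poly_altdef)
    show ?thesis
      unfolding eq by (subst (3) p) (simp add: L_sum smult int moment)
  qed
  show ?thesis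
    using AE poly M.finite_measure_axioms M.events_eq_borel by blast
qed

text \<open>
  Normalisation by \<open>L 1\<close>. If \<open>L 1 = 0\<close> then \<open>L\<close> vanishes, because
  \<open>L(X\<^sup>m) = L(X\<^sup>m\<^sup>+\<^sup>1) + L(X\<^sup>m (1 - X))\<close> exhibits \<open>0\<close> as a sum of two nonnegative numbers, inductively in \<open>m\<close>.
\<close>

lemma moment_problem_unit_interval:
  fixes L :: "real poly \<Rightarrow> real"
  assumes add: "\<And>p q. L (p + q) = L p + L q" and smult: "\<And>c p. L (smult c p) = c * L p"
    and pos: "\<And>k l. 0 \<le> L ([:0, 1:] ^ k * [:1, - 1:] ^ l)"
  shows "\<exists>M. finite_measure M \<and> sets M = sets borel \<and> (AE t in M. t \<in> {0..1}) \<and>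
    (\<forall>p. integral\<^sup>L M (poly p) = L p)"
proof (cases "L 1 = 0")
  case True
  let ?X = "[:0, 1:] :: real poly" and ?Y = "[:1, - 1:] :: real poly"
  have L_sum: "L (\<Sum>i\<in>I. c i) = (\<Sum>i\<in>I. L (c i))" if "finite I" for I :: "nat set" and c
    using that smult[of 0 0] by (induction I rule: finite_induct) (simp_all add: add)
  have "L (?X ^ m) = 0" for m
  proof (induction m)
    case (Suc m)
    have "?X ^ m = ?X ^ Suc m + ?X ^ m * ?Y ^ 1"
    proof -
      have "?X ^ m = ?X ^ m * (?X + ?Y)" by (simp add: one_pCons)
      then show ?thesis by (simp only: distrib_left power_Suc2 power_one_right)
    qed
    then have "L (?X ^ m) = L (?X ^ Suc m) + L (?X ^ m * ?Y ^ 1)"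
      by (metis add)
    then show ?case
      using Suc pos[of m 1] pos[of "Suc m" 0] by simp
  qed (use True in simp)
  then have "L p = 0" for p
    using poly_as_sum_of_monoms[of p] by (metis (no_types, lifting) L_sum finite_atMost monom_altdef mult_zero_right smult sum.neutral)
  then show ?thesis
    by (intro exI[of _ "null_measure borel"])
      (auto intro!: finite_measureI simp: AE_iff_null)
next
  case False
  define c where "c = L 1"
  have c: "c > 0" using pos[of 0 0] False by (simp add: c_def)
  obtain N where N: "finite_measure N" "sets N = sets borel" "AE t in N. t \<in> {0..1}"
    and int: "\<And>p. integral\<^sup>L N (poly p) = L p / c"
    using moment_problem_prob_unit_interval[of "\<lambda>p. L p / c"] pos c
    by (auto simp: add smult add_divide_distrib c_def)
  interpret N: finite_measure N by (rule N)
  have [measurable_cong]: "sets N = sets borel" by (rule N)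
  let ?M = "density N (\<lambda>_. ennreal c)"
  have "finite_measure ?M"
    by (rule finite_measureI)
      (simp add: emeasure_density ennreal_mult_eq_top_iff N.emeasure_eq_measure)
  moreover have "integral\<^sup>L ?M (poly p) = L p" for p
  proof -
    have "poly p \<in> borel_measurable borel"
      by (intro borel_measurable_continuous_onI continuous_intros)
    then have "integral\<^sup>L ?M (poly p) = (\<integral>t. c * poly p t \<partial>N)"
      using c by (subst integral_density) (auto simp: N(2) cong: measurable_cong_sets)
    also have "\<dots> = L p" using int[of p] c by simp
    finally show ?thesis .
  qed
  ultimately show ?thesis
    using N by (intro exI[of _ ?M]) (simp add: AE_density c)
qed

text \<open>
  Transport along the affine bijections \<open>\<phi>\<close> from \<open>[a, b]\<close> to \<open>[0, 1]\<close> and \<open>\<psi>\<close> back.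
\<close>

lemma moment_problem_interval:
  fixes L :: "real poly \<Rightarrow> real"
  assumes add: "\<And>p q. L (p + q) = L p + L q" and smult: "\<And>c p. L (smult c p) = c * L p"
    and "a < b"
    and pos: "\<And>k l. 0 \<le> L ([:- a, 1:] ^ k * [:b, - 1:] ^ l)"
  shows "\<exists>M. finite_measure M \<and> sets M = sets borel \<and> (AE t in M. t \<in> {a..b}) \<and>
    (\<forall>p. integral\<^sup>L M (poly p) = L p)"
proof -
  define d where "d = b - a"
  have d: "d > 0" using \<open>a < b\<close> by (simp add: d_def)
  define \<phi> where "\<phi> = [:- a / d, 1 / d:]"
  define \<psi> where "\<psi> = [:a, d:]"
  have X: "pcompose [:0, 1:] \<phi> = smult (1 / d) [:- a, 1:]"
    by (simp add: \<phi>_def pcompose_pCons)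
  have Y: "pcompose [:1, - 1:] \<phi> = smult (1 / d) [:b, - 1:]"
    using d by (simp add: \<phi>_def pcompose_pCons field_simps one_pCons) (simp add: d_def)
  have "0 \<le> L (pcompose ([:0, 1:] ^ k * [:1, - 1:] ^ l) \<phi>)" for k l
  proof -
    have pw: "pcompose (p ^ n) \<phi> = pcompose p \<phi> ^ n" for p n
      by (induction n) (simp_all add: pcompose_mult pcompose_1)
    have "pcompose ([:0, 1:] ^ k * [:1, - 1:] ^ l) \<phi>
        = smult ((1 / d) ^ k * (1 / d) ^ l) ([:- a, 1:] ^ k * [:b, - 1:] ^ l)"
      unfolding pcompose_mult pw X Y smult_power
      by (simp only: mult_smult_left mult_smult_right smult_smult mult.commute[of "(1 / d) ^ l"])
    then show ?thesis using pos[of k l] d by (simp add: smult)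
  qed
  then obtain N where N: "finite_measure N" "sets N = sets borel" "AE t in N. t \<in> {0..1}"
    and int: "\<And>p. integral\<^sup>L N (poly p) = L (pcompose p \<phi>)"
    using moment_problem_unit_interval[of "\<lambda>p. L (pcompose p \<phi>)"]
    by (auto simp: add smult pcompose_add pcompose_smult)
  interpret N: finite_measure N by (rule N)
  have [measurable_cong]: "sets N = sets borel" by (rule N)
  have poly_meas: "poly p \<in> borel_measurable borel" for p :: "real poly"
    by (intro borel_measurable_continuous_onI continuous_intros)
  have \<psi>_meas: "poly \<psi> \<in> borel_measurable N"
    using poly_meas by (simp add: N(2) cong: measurable_cong_sets)
  let ?M = "distr N borel (poly \<psi>)"
  have "finite_measure ?M" by (rule N.finite_measure_distr[OF \<psi>_meas])
  moreover have "AE t in ?M. t \<in> {a..b}"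
  proof (subst AE_distr_iff[OF \<psi>_meas])
    have "poly \<psi> t \<in> {a..b}" if "t \<in> {0..1}" for t
    proof -
      have "0 \<le> t * d" "t * d \<le> 1 * d" using that d by (auto intro: mult_right_mono)
      then show ?thesis by (simp add: \<psi>_def d_def)
    qed
    with N(3) show "AE t in N. poly \<psi> t \<in> {a..b}"
      by (rule eventually_mono)
  qed simp
  moreover have "integral\<^sup>L ?M (poly p) = L p" for p
  proof -
    have "integral\<^sup>L ?M (poly p) = integral\<^sup>L N (poly (pcompose p \<psi>))"
      by (subst integral_distr[OF \<psi>_meas poly_meas]) (simp add: poly_pcompose fun_eq_iff[of "poly (pcompose p \<psi>)"] cong: Bochner_Integration.integral_cong)
    also have "\<dots> = L (pcompose (pcompose p \<psi>) \<phi>)" by (rule int)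
    also have "pcompose (pcompose p \<psi>) \<phi> = pcompose p (pcompose \<psi> \<phi>)"
      by (simp add: pcompose_assoc)
    also have "pcompose \<psi> \<phi> = [:0, 1:]"
      using d by (simp add: \<psi>_def \<phi>_def pcompose_pCons)
    finally show ?thesis by (simp add: pcompose_idR)
  qed
  ultimately show ?thesis by (intro exI[of _ ?M]) simp
qed


section \<open>Density of the polynomials in \<open>L\<^sup>2\<close>\<close>

text \<open>
  Boundedness is asked on \<open>K\<close> only, so that polynomials qualify when \<open>K\<close> is compact; measurability is
  asked on the whole line, as the measures below are measures on the line that live on an interval.
\<close>

definition bounded_borel_on :: "real set \<Rightarrow> (real \<Rightarrow> real) \<Rightarrow> bool"
  where "bounded_borel_on K g \<longleftrightarrow> g \<in> borel_measurable borel \<and> bounded (g ` K)"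

lemma bounded_borel_onD: "bounded_borel_on K g \<Longrightarrow> g \<in> borel_measurable borel"
  by (simp add: bounded_borel_on_def)

lemma bounded_borel_on_iff:
  "bounded_borel_on K g \<longleftrightarrow> g \<in> borel_measurable borel \<and> (\<exists>B. \<forall>t\<in>K. \<bar>g t\<bar> \<le> B)"
  by (simp add: bounded_borel_on_def bounded_iff)

lemma bounded_borel_onI:
  "g \<in> borel_measurable borel \<Longrightarrow> (\<And>t. t \<in> K \<Longrightarrow> \<bar>g t\<bar> \<le> B) \<Longrightarrow> bounded_borel_on K g"
  unfolding bounded_borel_on_iff by blast

lemma bounded_borel_on_const [simp]: "bounded_borel_on K (\<lambda>t. c)"
  by (rule bounded_borel_onI[of _ _ "\<bar>c\<bar>"]) auto

lemma bounded_borel_on_indicator [simp]: "S \<in> sets borel \<Longrightarrow> bounded_borel_on K (indicator S)"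
  by (rule bounded_borel_onI[of _ _ 1]) (auto simp: indicator_def)

lemma bounded_borel_on_add:
  assumes "bounded_borel_on K g" "bounded_borel_on K h"
  shows "bounded_borel_on K (\<lambda>t. g t + h t)"
  using assms by (auto simp: bounded_borel_on_def intro: bounded_plus_comp)

lemma bounded_borel_on_mult:
  assumes "bounded_borel_on K g" "bounded_borel_on K h"
  shows "bounded_borel_on K (\<lambda>t. g t * h t)"
proof -
  from assms obtain B C where B: "\<And>t. t \<in> K \<Longrightarrow> \<bar>g t\<bar> \<le> B" and C: "\<And>t. t \<in> K \<Longrightarrow> \<bar>h t\<bar> \<le> C"
    and m: "g \<in> borel_measurable borel" "h \<in> borel_measurable borel"
    unfolding bounded_borel_on_iff by blast
  show ?thesis
  proof (rule bounded_borel_onI)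
    show "\<bar>g t * h t\<bar> \<le> B * C" if "t \<in> K" for t
      unfolding abs_mult using B[OF that] C[OF that] by (intro mult_mono) auto
  qed (use m in simp)
qed

lemma bounded_borel_on_diff:
  assumes "bounded_borel_on K g" "bounded_borel_on K h"
  shows "bounded_borel_on K (\<lambda>t. g t - h t)"
  using bounded_borel_on_add[OF assms(1) bounded_borel_on_mult[OF bounded_borel_on_const assms(2), of "-1"]]
  by simp

lemma bounded_borel_on_power2:
  "bounded_borel_on K g \<Longrightarrow> bounded_borel_on K (\<lambda>t. (g t)\<^sup>2)"
  by (simp add: power2_eq_square bounded_borel_on_mult)

lemma bounded_borel_on_sum:
  "(\<And>i. i \<in> I \<Longrightarrow> bounded_borel_on K (g i)) \<Longrightarrow> bounded_borel_on K (\<lambda>t. \<Sum>i\<in>I. g i t)"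
  by (induction I rule: infinite_finite_induct) (simp_all add: bounded_borel_on_add)

lemma bounded_borel_on_continuous:
  assumes "compact K" "\<And>t. isCont g t"
  shows "bounded_borel_on K g"
  unfolding bounded_borel_on_def
  using assms by (intro conjI borel_measurable_continuous_onI compact_imp_bounded compact_continuous_image)
    (auto intro: continuous_at_imp_continuous_on)

lemma bounded_borel_on_poly [simp]: "bounded_borel_on {a..b} (poly p)"
  by (rule bounded_borel_on_continuous) auto

lemmas bounded_borel_on_intros =
  bounded_borel_on_add bounded_borel_on_mult bounded_borel_on_diff bounded_borel_on_power2
  bounded_borel_on_poly bounded_borel_on_const

locale measure_on_interval = finite_measure M for M :: "real measure" +
  fixes a b :: real
  assumes sets_M: "sets M = sets borel" and AE_M: "AE t in M. t \<in> {a..b}"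
begin

lemma measurable_M: "g \<in> borel_measurable borel \<Longrightarrow> g \<in> borel_measurable M"
  by (simp add: sets_M cong: measurable_cong_sets)

lemma space_M: "space M = UNIV"
  using sets_eq_imp_space_eq[OF sets_M] by simp

lemma integrable_bounded_borel:
  assumes "bounded_borel_on {a..b} g"
  shows "integrable M g"
proof -
  from assms obtain B where "\<And>t. t \<in> {a..b} \<Longrightarrow> \<bar>g t\<bar> \<le> B" "g \<in> borel_measurable borel"
    unfolding bounded_borel_on_iff by blast
  note B = this
  have "AE t in M. norm (g t) \<le> B"
    using AE_M by (rule eventually_mono) (use B(1) in simp)
  then show ?thesis
    by (rule integrable_const_bound) (rule measurable_M[OF B(2)])
qed

lemma L2_triangle:
  assumes "bounded_borel_on {a..b} f" "bounded_borel_on {a..b} g" "bounded_borel_on {a..b} h"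
  shows "(\<integral>t. (f t - h t)\<^sup>2 \<partial>M) \<le> 2 * (\<integral>t. (f t - g t)\<^sup>2 \<partial>M) + 2 * (\<integral>t. (g t - h t)\<^sup>2 \<partial>M)"
proof -
  have "(\<integral>t. (f t - h t)\<^sup>2 \<partial>M) \<le> (\<integral>t. 2 * (f t - g t)\<^sup>2 + 2 * (g t - h t)\<^sup>2 \<partial>M)"
  proof (rule integral_mono)
    show "(f t - h t)\<^sup>2 \<le> 2 * (f t - g t)\<^sup>2 + 2 * (g t - h t)\<^sup>2" for t
      using zero_le_power2[of "(f t - g t) - (g t - h t)"] by (simp add: power2_eq_square algebra_simps)
  qed (use assms in \<open>intro integrable_bounded_borel bounded_borel_on_intros; simp\<close>)+
  also have "\<dots> = 2 * (\<integral>t. (f t - g t)\<^sup>2 \<partial>M) + 2 * (\<integral>t. (g t - h t)\<^sup>2 \<partial>M)"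
    using assms by (subst Bochner_Integration.integral_add)
      (auto intro!: integrable_bounded_borel bounded_borel_on_intros)
  finally show ?thesis .
qed

lemma L2_dominated_convergence:
  fixes g :: "nat \<Rightarrow> real \<Rightarrow> real" and h :: "real \<Rightarrow> real"
  assumes "\<And>n. g n \<in> borel_measurable borel" "h \<in> borel_measurable borel"
    and bound: "\<And>n t. t \<in> {a..b} \<Longrightarrow> \<bar>g n t\<bar> \<le> B"
    and lim: "\<And>t. t \<in> {a..b} \<Longrightarrow> (\<lambda>n. g n t) \<longlonglongrightarrow> h t"
  shows "(\<lambda>n. \<integral>t. (h t - g n t)\<^sup>2 \<partial>M) \<longlonglongrightarrow> 0"
proof -
  have bound_h: "\<bar>h t\<bar> \<le> B" if "t \<in> {a..b}" for t
    by (rule LIMSEQ_le_const2[OF tendsto_rabs[OF lim[OF that]]]) (use bound[OF that] in blast)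
  have "(\<lambda>n. \<integral>t. (h t - g n t)\<^sup>2 \<partial>M) \<longlonglongrightarrow> (\<integral>t. 0 \<partial>M)"
  proof (rule integral_dominated_convergence[where w="\<lambda>_. (2 * B)\<^sup>2"])
    show "AE t in M. (\<lambda>n. (h t - g n t)\<^sup>2) \<longlonglongrightarrow> 0"
      using AE_M
    proof eventually_elim
      case (elim t)
      have "(\<lambda>n. (h t - g n t)\<^sup>2) \<longlonglongrightarrow> (h t - h t)\<^sup>2"
        by (intro tendsto_intros lim elim)
      then show ?case by simp
    qed
    show "AE t in M. norm ((h t - g n t)\<^sup>2) \<le> (2 * B)\<^sup>2" for n
      using AE_M
    proof eventually_elim
      case (elim t)
      then have "\<bar>h t - g n t\<bar> \<le> 2 * B" using bound[of t n] bound_h[of t] by linarith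
      then have "\<bar>h t - g n t\<bar>\<^sup>2 \<le> (2 * B)\<^sup>2" by (rule power_mono) simp
      then show ?case by simp
    qed
  qed (use assms in \<open>auto intro!: measurable_M\<close>)
  then show ?thesis by simp
qed

text \<open>Cauchy--Schwarz against the constant function.\<close>

lemma integral_power2_le:
  assumes "bounded_borel_on {a..b} g"
  shows "(\<integral>t. g t \<partial>M)\<^sup>2 \<le> measure M UNIV * (\<integral>t. (g t)\<^sup>2 \<partial>M)"
proof (cases "measure M UNIV = 0")
  case True
  then have "emeasure M (space M) = 0" by (simp add: emeasure_eq_measure space_M)
  then have "AE t in M. g t = 0" by (rule emeasure_0_AE)
  then have "(\<integral>t. g t \<partial>M) = 0" by (rule integral_eq_zero_AE)
  with True show ?thesis by simp
next
  case False
  define c where "c = measure M UNIV"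
  define I where "I = (\<integral>t. g t \<partial>M)"
  have c: "c > 0" using False by (simp add: c_def zero_less_measure_iff)
  have "0 \<le> (\<integral>t. (c * g t - I)\<^sup>2 \<partial>M)" by simp
  also have "(\<lambda>t. (c * g t - I)\<^sup>2) = (\<lambda>t. c\<^sup>2 * (g t)\<^sup>2 - 2 * c * I * g t + I\<^sup>2)"
    by (rule ext) (simp add: power2_eq_square algebra_simps)
  also have "(\<integral>t. c\<^sup>2 * (g t)\<^sup>2 - 2 * c * I * g t + I\<^sup>2 \<partial>M)
     = c\<^sup>2 * (\<integral>t. (g t)\<^sup>2 \<partial>M) - 2 * c * I * I + I\<^sup>2 * c"
    using assms by (simp add: integrable_bounded_borel bounded_borel_on_intros I_def c_def space_M)
  also have "\<dots> = c * (c * (\<integral>t. (g t)\<^sup>2 \<partial>M) - I\<^sup>2)"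
    by (simp add: power2_eq_square algebra_simps)
  finally show ?thesis
    using c by (simp add: zero_le_mult_iff c_def I_def)
qed

end

text \<open>
  One polynomial has to approximate with respect to all measures in \<open>\<M>\<close> simultaneously.
\<close>

definition L2_poly_approximable :: "real measure set \<Rightarrow> (real \<Rightarrow> real) \<Rightarrow> bool"
  where "L2_poly_approximable \<M> g \<longleftrightarrow>
    (\<forall>e>0. \<exists>p. \<forall>M\<in>\<M>. (\<integral>t. (g t - poly p t)\<^sup>2 \<partial>M) < e)"

context
  fixes \<M> :: "real measure set" and a b :: real
  assumes fin: "finite \<M>" and moi: "\<And>M. M \<in> \<M> \<Longrightarrow> measure_on_interval M a b"
begin

text \<open>
  Approximable functions are closed under bounded pointwise limits. Together with closure under
  linear combinations this is the monotone class argument: it leads from polynomials to continuous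
  functions, to indicators of half-lines, to indicators of Borel sets, and to all bounded Borel
  functions.
\<close>

lemma approximable_lim:
  assumes approx: "\<And>n. L2_poly_approximable \<M> (g n)"
    and meas: "\<And>n. g n \<in> borel_measurable borel" "h \<in> borel_measurable borel"
    and bound: "\<And>n t. t \<in> {a..b} \<Longrightarrow> \<bar>g n t\<bar> \<le> B"
    and lim: "\<And>t. t \<in> {a..b} \<Longrightarrow> (\<lambda>n. g n t) \<longlonglongrightarrow> h t"
  shows "L2_poly_approximable \<M> h"
  unfolding L2_poly_approximable_def
proof (intro allI impI)
  fix e :: real assume e: "e > 0"
  have bb: "bounded_borel_on {a..b} h" "\<And>n. bounded_borel_on {a..b} (g n)"
  proof -
    have "\<bar>h t\<bar> \<le> B" if "t \<in> {a..b}" for t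
      by (rule LIMSEQ_le_const2[OF tendsto_rabs[OF lim[OF that]]]) (use bound[OF that] in blast)
    with meas(2) show "bounded_borel_on {a..b} h" by (rule bounded_borel_onI)
    show "bounded_borel_on {a..b} (g n)" for n
      using meas(1) bound by (rule bounded_borel_onI)
  qed
  have "\<forall>M\<in>\<M>. \<forall>\<^sub>F n in sequentially. (\<integral>t. (h t - g n t)\<^sup>2 \<partial>M) < e / 4"
  proof
    fix M assume "M \<in> \<M>"
    then have "(\<lambda>n. \<integral>t. (h t - g n t)\<^sup>2 \<partial>M) \<longlonglongrightarrow> 0"
      using measure_on_interval.L2_dominated_convergence[OF moi meas bound lim] by blast
    then show "\<forall>\<^sub>F n in sequentially. (\<integral>t. (h t - g n t)\<^sup>2 \<partial>M) < e / 4"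
      by (rule order_tendstoD(2)) (use e in simp)
  qed
  then have "\<forall>\<^sub>F n in sequentially. \<forall>M\<in>\<M>. (\<integral>t. (h t - g n t)\<^sup>2 \<partial>M) < e / 4"
    using fin by (simp add: eventually_ball_finite)
  then obtain n where n: "\<forall>M\<in>\<M>. (\<integral>t. (h t - g n t)\<^sup>2 \<partial>M) < e / 4"
    using eventually_happens'[OF sequentially_bot] by blast
  obtain p where p: "\<forall>M\<in>\<M>. (\<integral>t. (g n t - poly p t)\<^sup>2 \<partial>M) < e / 4"
    using approx[of n] e unfolding L2_poly_approximable_def by (meson divide_pos_pos zero_less_numeral)
  have "(\<integral>t. (h t - poly p t)\<^sup>2 \<partial>M) < e" if M: "M \<in> \<M>" for M
    using measure_on_interval.L2_triangle[OF moi[OF M] bb(1) bb(2)[of n] bounded_borel_on_poly[of a b p]]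
      bspec[OF n M] bspec[OF p M] by linarith
  then show "\<exists>p. \<forall>M\<in>\<M>. (\<integral>t. (h t - poly p t)\<^sup>2 \<partial>M) < e" by blast
qed

lemma approximable_poly: "L2_poly_approximable \<M> (poly p)"
  unfolding L2_poly_approximable_def by (auto intro!: exI[of _ p])

lemma approximable_zero: "L2_poly_approximable \<M> (\<lambda>t. 0)"
proof -
  have "poly 0 = (\<lambda>t::real. 0)" by (rule ext) simp
  then show ?thesis using approximable_poly[of 0] by simp
qed

lemma approximable_add:
  assumes "bounded_borel_on {a..b} g" "bounded_borel_on {a..b} h"
    and g: "L2_poly_approximable \<M> g" and h: "L2_poly_approximable \<M> h"
  shows "L2_poly_approximable \<M> (\<lambda>t. g t + h t)"
  unfolding L2_poly_approximable_def
proof (intro allI impI)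
  fix e :: real assume "e > 0"
  then have "e / 4 > 0" by simp
  with g h obtain p q where p: "\<forall>M\<in>\<M>. (\<integral>t. (g t - poly p t)\<^sup>2 \<partial>M) < e / 4"
    and q: "\<forall>M\<in>\<M>. (\<integral>t. (h t - poly q t)\<^sup>2 \<partial>M) < e / 4"
    unfolding L2_poly_approximable_def by meson
  have "(\<integral>t. (g t + h t - poly (p + q) t)\<^sup>2 \<partial>M) < e" if "M \<in> \<M>" for M
  proof -
    have "(\<integral>t. (g t + h t - poly (p + q) t)\<^sup>2 \<partial>M)
       \<le> 2 * (\<integral>t. (g t + h t - (poly p t + h t))\<^sup>2 \<partial>M) + 2 * (\<integral>t. (poly p t + h t - poly (p + q) t)\<^sup>2 \<partial>M)"
      by (intro measure_on_interval.L2_triangle[OF moi[OF that]] bounded_borel_on_intros assms)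
    also have "\<dots> < e"
    proof -
      have "(\<integral>t. (g t - poly p t)\<^sup>2 \<partial>M) < e / 4" "(\<integral>t. (h t - poly q t)\<^sup>2 \<partial>M) < e / 4"
        using p q that by blast+
      then show ?thesis by (simp add: field_simps)
    qed
    finally show ?thesis .
  qed
  then show "\<exists>p. \<forall>M\<in>\<M>. (\<integral>t. (g t + h t - poly p t)\<^sup>2 \<partial>M) < e" by blast
qed

lemma approximable_scale:
  assumes g: "L2_poly_approximable \<M> g"
  shows "L2_poly_approximable \<M> (\<lambda>t. c * g t)"
proof (cases "c = 0")
  case True
  then show ?thesis using approximable_zero by simp
next
  case False
  show ?thesis
    unfolding L2_poly_approximable_def
  proof (intro allI impI)
    fix e :: real assume "e > 0"
    with False have "e / c\<^sup>2 > 0" by simp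
    with g obtain p where p: "\<forall>M\<in>\<M>. (\<integral>t. (g t - poly p t)\<^sup>2 \<partial>M) < e / c\<^sup>2"
      unfolding L2_poly_approximable_def by meson
    have "(\<integral>t. (c * g t - poly (smult c p) t)\<^sup>2 \<partial>M) < e" if "M \<in> \<M>" for M
    proof -
      have "(\<lambda>t. (c * g t - poly (smult c p) t)\<^sup>2) = (\<lambda>t. c\<^sup>2 * (g t - poly p t)\<^sup>2)"
        by (simp add: power_mult_distrib flip: right_diff_distrib)
      then show ?thesis
        using p that False by (simp add: field_simps)
    qed
    then show "\<exists>p. \<forall>M\<in>\<M>. (\<integral>t. (c * g t - poly p t)\<^sup>2 \<partial>M) < e" by blast
  qed
qed

lemma approximable_sum:
  assumes "\<And>i. i \<in> I \<Longrightarrow> bounded_borel_on {a..b} (g i)" "\<And>i. i \<in> I \<Longrightarrow> L2_poly_approximable \<M> (g i)"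
  shows "L2_poly_approximable \<M> (\<lambda>t. \<Sum>i\<in>I. g i t)"
  using assms
proof (induction I rule: infinite_finite_induct)
  case (insert i I)
  then show ?case by (simp add: approximable_add bounded_borel_on_sum)
qed (use approximable_zero in simp_all)

lemma approximable_continuous:
  assumes cont: "\<And>t. isCont g t"
  shows "L2_poly_approximable \<M> g"
proof -
  have bb: "bounded_borel_on {a..b} g" by (rule bounded_borel_on_continuous[OF compact_Icc cont])
  then obtain B where B: "\<And>t. t \<in> {a..b} \<Longrightarrow> \<bar>g t\<bar> \<le> B" and meas: "g \<in> borel_measurable borel"
    unfolding bounded_borel_on_iff by blast
  have "\<exists>p. \<forall>t\<in>{a..b}. \<bar>g t - poly p t\<bar> < 1 / real (Suc n)" for n
  proof -
    obtain q where q: "real_polynomial_function q" "\<And>t. t \<in> {a..b} \<Longrightarrow> \<bar>g t - q t\<bar> < 1 / real (Suc n)"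
      using Stone_Weierstrass_real_polynomial_function[of "{a..b}" g "1 / real (Suc n)"] cont
      by (auto intro: continuous_at_imp_continuous_on)
    then obtain c N where c: "q = (\<lambda>x. \<Sum>i\<le>N. c i * x ^ i)"
      by (auto simp: real_polynomial_function_iff_sum)
    have "poly (\<Sum>i\<le>N. monom (c i) i) = q"
      by (rule ext) (simp add: c poly_sum poly_monom)
    with q show ?thesis by metis
  qed
  then obtain p where p: "\<And>n t. t \<in> {a..b} \<Longrightarrow> \<bar>g t - poly (p n) t\<bar> < 1 / real (Suc n)"
    by metis
  show ?thesis
  proof (rule approximable_lim[of "\<lambda>n. poly (p n)"])
    show "\<bar>poly (p n) t\<bar> \<le> B + 1" if "t \<in> {a..b}" for n t
    proof -
      have "1 / real (Suc n) \<le> 1" by simp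
      then show ?thesis using p[OF that, of n] B[OF that] by linarith
    qed
    show "(\<lambda>n. poly (p n) t) \<longlonglongrightarrow> g t" if "t \<in> {a..b}" for t
    proof (rule LIM_zero_cancel, rule Lim_null_comparison)
      show "\<forall>\<^sub>F n in sequentially. norm (poly (p n) t - g t) \<le> 1 / real (Suc n)"
        using p[OF that] by (auto intro!: always_eventually less_imp_le simp: abs_minus_commute)
      show "(\<lambda>n. 1 / real (Suc n)) \<longlonglongrightarrow> 0"
        using LIMSEQ_Suc[OF lim_1_over_n] by simp
    qed
  qed (use approximable_poly meas bounded_borel_onD[OF bounded_borel_on_poly] in auto)
qed

lemma approximable_indicator:
  assumes "S \<in> sets borel"
  shows "L2_poly_approximable \<M> (indicator S)"
proof -
  have borel: "sets borel = sigma_sets UNIV (range (\<lambda>c::real. {..c}))"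
    by (subst borel_eq_atMost) simp
  have "Int_stable (range (\<lambda>c::real. {..c}))"
    by (auto simp: Int_stable_def intro: min.commute)
  moreover have "range (\<lambda>c::real. {..c}) \<subseteq> Pow UNIV" by simp
  moreover have "S \<in> sigma_sets UNIV (range (\<lambda>c::real. {..c}))"
    using assms borel by simp
  ultimately show ?thesis
  proof (induction rule: sigma_sets_induct_disjoint)
    case (basic S)
    then obtain c where S: "S = {..c}" by auto
    \<comment> \<open>equal to \<open>1\<close> up to \<open>c\<close>, then falling linearly to \<open>0\<close> with slope \<open>- n\<close>\<close>
    define g where "g n t = max 0 (min 1 (1 - real n * (t - c)))" for n t
    show ?case
    proof (rule approximable_lim[of g])
      fix n
      have cont: "isCont (g n) t" for t unfolding g_def by (intro continuous_intros)
      then show "L2_poly_approximable \<M> (g n)" by (rule approximable_continuous)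
      show "g n \<in> borel_measurable borel" unfolding g_def by measurable
      show "\<bar>g n t\<bar> \<le> 1" for t by (simp add: g_def)
    next
      show "indicator S \<in> borel_measurable borel" by (simp add: S)
    next
      fix t
      show "(\<lambda>n. g n t) \<longlonglongrightarrow> indicator S t"
      proof (cases "t \<le> c")
        case True
        then have "g n t = 1" for n by (simp add: g_def mult_nonneg_nonpos)
        then show ?thesis using True by (simp add: S)
      next
        case False
        then obtain N where N: "1 < real N * (t - c)"
          using reals_Archimedean3[of "t - c"] by auto
        have "\<forall>\<^sub>F n in sequentially. g n t = 0"
          using eventually_ge_at_top[of N]
        proof eventually_elim
          case (elim n)
          then have "real N * (t - c) \<le> real n * (t - c)" using False by (intro mult_right_mono) auto
          with N show ?case by (simp add: g_def)
        qed
        then show ?thesis using False by (simp add: S tendsto_eventually)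
      qed
    qed
  next
    case empty
    then show ?case using approximable_zero by (simp add: indicator_def)
  next
    case (compl S)
    then have S: "S \<in> sets borel" by (simp add: borel)
    have "L2_poly_approximable \<M> (\<lambda>t. poly 1 t + (- 1) * indicator S t)"
      by (intro approximable_add approximable_scale approximable_poly compl bounded_borel_on_intros
          bounded_borel_on_indicator S)
    also have "(\<lambda>t. poly 1 t + (- 1) * indicator S t) = (indicator (UNIV - S) :: real \<Rightarrow> real)"
      by (rule ext) (simp add: indicator_def)
    finally show ?case .
  next
    case (union S)
    then have S: "S i \<in> sets borel" for i by (auto simp: borel)
    have eq: "(\<lambda>t. \<Sum>i<n. indicator (S i) t) = (indicator (\<Union>i<n. S i) :: real \<Rightarrow> real)" for n
      by (rule ext) (use union(1) in \<open>simp add: indicator_UN_disjoint disjoint_family_on_def\<close>)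
    show ?case
    proof (rule approximable_lim[of "\<lambda>n t. \<Sum>i<n. indicator (S i) t"])
      show "L2_poly_approximable \<M> (\<lambda>t. \<Sum>i<n. indicator (S i) t)" for n
        by (intro approximable_sum union bounded_borel_on_indicator S)
      show "\<bar>\<Sum>i<n. indicator (S i) t\<bar> \<le> (1::real)" for n t
        using fun_cong[OF eq, of t n] by (simp add: indicator_def)
      show "(\<lambda>n. \<Sum>i<n. indicator (S i) t) \<longlonglongrightarrow> (indicator (\<Union>i. S i) t :: real)" for t
        using LIMSEQ_indicator_UN[of S t] by (simp add: fun_cong[OF eq])
    qed (use S in auto)
  qed
qed

lemma L2_poly_dense:
  assumes "bounded_borel_on {a..b} g"
  shows "L2_poly_approximable \<M> g"
proof -
  from assms obtain B where B: "\<And>t. t \<in> {a..b} \<Longrightarrow> \<bar>g t\<bar> \<le> B" and meas: "g \<in> borel_measurable borel"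
    unfolding bounded_borel_on_iff by blast
  from borel_measurable_implies_sequence_metric[OF meas, of 0]
  obtain F where F: "\<And>i. simple_function borel (F i)" "\<And>t. (\<lambda>i. F i t) \<longlonglongrightarrow> g t"
    "\<And>i t. \<bar>F i t\<bar> \<le> 2 * \<bar>g t\<bar>"
    by (auto simp: dist_real_def)
  show ?thesis
  proof (rule approximable_lim[of F])
    fix i
    have eq: "F i = (\<lambda>t. \<Sum>y\<in>range (F i). y * indicator (F i -` {y}) t)"
    proof
      fix t
      have "(\<Sum>y\<in>range (F i). y * indicator (F i -` {y}) t) = (\<Sum>y\<in>{F i t}. y * indicator (F i -` {y}) t)"
        using F(1)[of i] by (intro sum.mono_neutral_right) (auto simp: simple_function_def indicator_def)
      then show "F i t = (\<Sum>y\<in>range (F i). y * indicator (F i -` {y}) t)" by simp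
    qed
    have "F i -` {y} \<in> sets borel" for y
      using simple_functionD(2)[OF F(1)[of i], of "{y}"] by simp
    then show "L2_poly_approximable \<M> (F i)"
      by (subst eq) (intro approximable_sum approximable_scale approximable_indicator
          bounded_borel_on_mult bounded_borel_on_const bounded_borel_on_indicator)
    show "F i \<in> borel_measurable borel" using F(1) by (rule borel_measurable_simple_function)
    show "\<bar>F i t\<bar> \<le> 2 * B" if "t \<in> {a..b}" for t
      using F(3)[of i t] B[OF that] by linarith
  qed (use F(2) meas in auto)
qed

end


section \<open>The Borel functional calculus from moments\<close>

text \<open>
  The measures \<open>\<mu> x\<close> will turn out to be the scalar spectral measures \<open>S \<mapsto> \<langle>E(S)x, x\<rangle>\<close> of \<open>A\<close>. A family of
  solutions of the moment problems, chosen independently for each \<open>x\<close>, determines the calculus.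
\<close>

locale moment_family =
  fixes A :: "'a::chilbert_space bounded_op" and a b :: real and \<mu> :: "'a \<Rightarrow> real measure"
  assumes selfadjoint_A: "selfadjoint A"
    and moi: "measure_on_interval (\<mu> x) a b"
    and moments: "integral\<^sup>L (\<mu> x) (poly p) = Re (cinner (poly_op A p *\<^sub>V x) x)"
begin

abbreviation bb :: "(real \<Rightarrow> real) \<Rightarrow> bool" where "bb \<equiv> bounded_borel_on {a..b}"

definition L2_lim :: "(nat \<Rightarrow> real poly) \<Rightarrow> (real \<Rightarrow> real) \<Rightarrow> 'a \<Rightarrow> bool"
  where "L2_lim p g x \<longleftrightarrow> (\<lambda>n. \<integral>t. (g t - poly (p n) t)\<^sup>2 \<partial>\<mu> x) \<longlonglongrightarrow> 0"

lemma integrable_bb: "bb g \<Longrightarrow> integrable (\<mu> x) g"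
  by (rule measure_on_interval.integrable_bounded_borel[OF moi])

lemma mass: "measure (\<mu> x) UNIV = (norm x)\<^sup>2"
proof -
  have "integral\<^sup>L (\<mu> x) (poly 1) = (norm x)\<^sup>2"
    by (simp add: moments one_pCons Re_cinner_self)
  moreover have "poly 1 = (\<lambda>t::real. 1)" by (rule ext) simp
  ultimately show ?thesis by (simp add: measure_on_interval.space_M[OF moi])
qed

lemma ex_L2_lim:
  assumes "finite X" "bb g"
  obtains p where "\<And>x. x \<in> X \<Longrightarrow> L2_lim p g x"
proof -
  have "L2_poly_approximable (\<mu> ` X) g"
    by (rule L2_poly_dense[where a=a and b=b]) (use assms moi in auto)
  then have "\<exists>p. \<forall>x\<in>X. (\<integral>t. (g t - poly p t)\<^sup>2 \<partial>\<mu> x) < 1 / real (Suc n)" for n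
    unfolding L2_poly_approximable_def by (auto elim!: allE[of _ "1 / real (Suc n)"])
  then obtain p where p: "\<And>n x. x \<in> X \<Longrightarrow> (\<integral>t. (g t - poly (p n) t)\<^sup>2 \<partial>\<mu> x) < 1 / real (Suc n)"
    by metis
  have "L2_lim p g x" if "x \<in> X" for x
    unfolding L2_lim_def
  proof (rule Lim_null_comparison)
    show "\<forall>\<^sub>F n in sequentially. norm (\<integral>t. (g t - poly (p n) t)\<^sup>2 \<partial>\<mu> x) \<le> 1 / real (Suc n)"
      using p[OF that] by (intro always_eventually allI) (simp add: less_imp_le)
    show "(\<lambda>n. 1 / real (Suc n)) \<longlonglongrightarrow> 0"
      using LIMSEQ_Suc[OF lim_1_over_n] by simp
  qed
  then show ?thesis by (rule that)
qed

lemma norm_poly_op_integral: "(norm (poly_op A p *\<^sub>V x))\<^sup>2 = (\<integral>t. (poly p t)\<^sup>2 \<partial>\<mu> x)"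
proof -
  have "poly (p\<^sup>2) = (\<lambda>t. (poly p t)\<^sup>2)" by (rule ext) simp
  then show ?thesis
    using moments[of x "p\<^sup>2"] by (simp add: norm_poly_op[OF selfadjoint_A])
qed

text \<open>
  The isometry \<open>p \<mapsto> p(A)x\<close> from \<open>L\<^sup>2(\<mu> x)\<close>, in the form in which it shows that \<open>p\<^sub>n(A)x\<close> converges
  whenever \<open>p\<^sub>n\<close> converges in \<open>L\<^sup>2(\<mu> x)\<close>, with a limit that depends only on the limit of \<open>p\<^sub>n\<close>.
\<close>

lemma dist_poly_op_le:
  assumes "bb g"
  shows "(norm (poly_op A p *\<^sub>V x - poly_op A q *\<^sub>V x))\<^sup>2
    \<le> 2 * (\<integral>t. (g t - poly p t)\<^sup>2 \<partial>\<mu> x) + 2 * (\<integral>t. (g t - poly q t)\<^sup>2 \<partial>\<mu> x)"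
proof -
  have "(norm (poly_op A p *\<^sub>V x - poly_op A q *\<^sub>V x))\<^sup>2 = (\<integral>t. (poly p t - poly q t)\<^sup>2 \<partial>\<mu> x)"
    using norm_poly_op_integral[of "p - q" x] by (simp add: poly_op_diff apply_op_diff)
  also have "\<dots> \<le> 2 * (\<integral>t. (poly p t - g t)\<^sup>2 \<partial>\<mu> x) + 2 * (\<integral>t. (g t - poly q t)\<^sup>2 \<partial>\<mu> x)"
    by (intro measure_on_interval.L2_triangle[OF moi] assms bounded_borel_on_poly)
  finally show ?thesis by (simp add: power2_commute)
qed

lemma L2_lim_imp_convergent:
  assumes "bb g" "L2_lim p g x"
  shows "convergent (\<lambda>n. poly_op A (p n) *\<^sub>V x)"
proof (rule Cauchy_convergent, rule metric_CauchyI)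
  fix e :: real assume e: "e > 0"
  then have "\<forall>\<^sub>F n in sequentially. (\<integral>t. (g t - poly (p n) t)\<^sup>2 \<partial>\<mu> x) < e\<^sup>2 / 4"
    using assms(2) unfolding L2_lim_def by (intro order_tendstoD(2)) auto
  then obtain N where N: "\<And>n. n \<ge> N \<Longrightarrow> (\<integral>t. (g t - poly (p n) t)\<^sup>2 \<partial>\<mu> x) < e\<^sup>2 / 4"
    unfolding eventually_sequentially by blast
  show "\<exists>N. \<forall>m\<ge>N. \<forall>n\<ge>N. dist (poly_op A (p m) *\<^sub>V x) (poly_op A (p n) *\<^sub>V x) < e"
  proof (intro exI allI impI)
    fix m n assume "N \<le> m" "N \<le> n"
    then have "(norm (poly_op A (p m) *\<^sub>V x - poly_op A (p n) *\<^sub>V x))\<^sup>2 < e\<^sup>2"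
      using dist_poly_op_le[OF assms(1), of "p m" x "p n"] N[of m] N[of n] by simp
    then show "dist (poly_op A (p m) *\<^sub>V x) (poly_op A (p n) *\<^sub>V x) < e"
      using e by (simp add: dist_norm power2_less_imp_less)
  qed
qed

text \<open>
  The vector \<open>g(A)x\<close>. The approximating polynomials may be chosen anew for every \<open>x\<close>;
  \<open>calc_fun_tendsto\<close> shows that the choice does not matter.
\<close>

definition calc_fun :: "(real \<Rightarrow> real) \<Rightarrow> 'a \<Rightarrow> 'a"
  where "calc_fun g x = lim (\<lambda>n. poly_op A ((SOME p. L2_lim p g x) n) *\<^sub>V x)"

lemma calc_fun_tendsto:
  assumes g: "bb g" and p: "L2_lim p g x"
  shows "(\<lambda>n. poly_op A (p n) *\<^sub>V x) \<longlonglongrightarrow> calc_fun g x"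
proof -
  define q where "q = (SOME p. L2_lim p g x)"
  have q: "L2_lim q g x"
    unfolding q_def by (rule someI[of "\<lambda>p. L2_lim p g x", OF p])
  have "(\<lambda>n. poly_op A (q n) *\<^sub>V x) \<longlonglongrightarrow> calc_fun g x"
    using L2_lim_imp_convergent[OF g q] by (simp add: calc_fun_def q_def convergent_LIMSEQ_iff)
  moreover have "(\<lambda>n. poly_op A (p n) *\<^sub>V x - poly_op A (q n) *\<^sub>V x) \<longlonglongrightarrow> 0"
  proof -
    have "(\<lambda>n. (norm (poly_op A (p n) *\<^sub>V x - poly_op A (q n) *\<^sub>V x))\<^sup>2) \<longlonglongrightarrow> 0"
    proof (rule Lim_null_comparison)
      show "(\<lambda>n. 2 * (\<integral>t. (g t - poly (p n) t)\<^sup>2 \<partial>\<mu> x) + 2 * (\<integral>t. (g t - poly (q n) t)\<^sup>2 \<partial>\<mu> x)) \<longlonglongrightarrow> 0"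
        using tendsto_add[OF tendsto_mult_left[OF p[unfolded L2_lim_def], of 2]
            tendsto_mult_left[OF q[unfolded L2_lim_def], of 2]] by simp
    qed (use dist_poly_op_le[OF g] in simp)
    then show ?thesis
      by (simp add: tendsto_norm_zero_iff)
  qed
  ultimately have "(\<lambda>n. (poly_op A (p n) *\<^sub>V x - poly_op A (q n) *\<^sub>V x) + poly_op A (q n) *\<^sub>V x)
      \<longlonglongrightarrow> 0 + calc_fun g x"
    by (intro tendsto_add)
  then show ?thesis by simp
qed

lemma norm_calc_fun_le:
  assumes g: "bb g"
  shows "(norm (calc_fun g x))\<^sup>2 \<le> 2 * (\<integral>t. (g t)\<^sup>2 \<partial>\<mu> x)"
proof -
  obtain p where p: "L2_lim p g x" using ex_L2_lim[of "{x}" g] g by auto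
  have "(\<lambda>n. (norm (poly_op A (p n) *\<^sub>V x))\<^sup>2) \<longlonglongrightarrow> (norm (calc_fun g x))\<^sup>2"
    by (intro tendsto_intros calc_fun_tendsto g p)
  moreover have "(\<lambda>n. 2 * (\<integral>t. (g t - poly (p n) t)\<^sup>2 \<partial>\<mu> x) + 2 * (\<integral>t. (g t - 0)\<^sup>2 \<partial>\<mu> x))
      \<longlonglongrightarrow> 2 * 0 + 2 * (\<integral>t. (g t - 0)\<^sup>2 \<partial>\<mu> x)"
    using p unfolding L2_lim_def by (intro tendsto_intros)
  ultimately have "(norm (calc_fun g x))\<^sup>2 \<le> 2 * 0 + 2 * (\<integral>t. (g t - 0)\<^sup>2 \<partial>\<mu> x)"
    by (rule LIMSEQ_le) (use dist_poly_op_le[OF g, of _ x 0] in auto)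
  then show ?thesis by simp
qed

text \<open>
  Additivity holds for \<open>p\<^sub>n(A)\<close>; it passes to the limit along a sequence that approximates \<open>g\<close> for
  \<open>x\<close>, \<open>y\<close> and \<open>x + y\<close> at the same time.
\<close>

lemma calc_fun_add:
  assumes g: "bb g"
  shows "calc_fun g (x + y) = calc_fun g x + calc_fun g y"
proof -
  obtain p where p: "\<And>z. z \<in> {x, y, x + y} \<Longrightarrow> L2_lim p g z" using ex_L2_lim[of "{x, y, x + y}" g] g by auto
  have "(\<lambda>n. poly_op A (p n) *\<^sub>V x + poly_op A (p n) *\<^sub>V y) \<longlonglongrightarrow> calc_fun g x + calc_fun g y"
    by (intro tendsto_add calc_fun_tendsto g p) auto
  moreover have "(\<lambda>n. poly_op A (p n) *\<^sub>V (x + y)) \<longlonglongrightarrow> calc_fun g (x + y)"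
    by (intro calc_fun_tendsto g p) auto
  ultimately show ?thesis
    by (simp add: apply_op_add_right LIMSEQ_unique)
qed

lemma calc_fun_scaleC:
  assumes g: "bb g"
  shows "calc_fun g (c *\<^sub>C x) = c *\<^sub>C calc_fun g x"
proof -
  obtain p where p: "\<And>z. z \<in> {x, c *\<^sub>C x} \<Longrightarrow> L2_lim p g z" using ex_L2_lim[of "{x, c *\<^sub>C x}" g] g by auto
  have "(\<lambda>n. (c *\<^sub>C 1) *\<^sub>V poly_op A (p n) *\<^sub>V x) \<longlonglongrightarrow> (c *\<^sub>C 1) *\<^sub>V calc_fun g x"
    by (intro tendsto_apply_op calc_fun_tendsto g p) auto
  moreover have "(\<lambda>n. poly_op A (p n) *\<^sub>V (c *\<^sub>C x)) \<longlonglongrightarrow> calc_fun g (c *\<^sub>C x)"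
    by (intro calc_fun_tendsto g p) auto
  ultimately show ?thesis
    by (simp add: apply_op_scaleC_right apply_op_scaleC LIMSEQ_unique)
qed

definition calc :: "(real \<Rightarrow> real) \<Rightarrow> 'a bounded_op"
  where "calc g = Abs_bounded_op (calc_fun g)"

lemma apply_calc:
  assumes g: "bb g"
  shows "calc g *\<^sub>V x = calc_fun g x"
proof -
  from g obtain B where B: "\<And>t. t \<in> {a..b} \<Longrightarrow> \<bar>g t\<bar> \<le> B" "B \<ge> 0"
  proof -
    from g obtain B where "\<And>t. t \<in> {a..b} \<Longrightarrow> \<bar>g t\<bar> \<le> B"
      unfolding bounded_borel_on_iff by blast
    then have "\<bar>g t\<bar> \<le> max B 0" if "t \<in> {a..b}" for t
      using that by (simp add: le_max_iff_disj)
    then show ?thesis using that[of "max B 0"] by simp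
  qed
  have "norm (calc_fun g x) \<le> (2 * B) * norm x" for x
  proof -
    have "AE t in \<mu> x. (g t)\<^sup>2 \<le> B\<^sup>2"
      using measure_on_interval.AE_M[OF moi]
    proof (rule eventually_mono)
      show "(g t)\<^sup>2 \<le> B\<^sup>2" if "t \<in> {a..b}" for t
        using power_mono[OF B(1)[OF that], of 2] by simp
    qed
    then have "(\<integral>t. (g t)\<^sup>2 \<partial>\<mu> x) \<le> (\<integral>t. B\<^sup>2 \<partial>\<mu> x)"
      using g by (intro integral_mono_AE integrable_bb bounded_borel_on_intros)
    also have "\<dots> = B\<^sup>2 * (norm x)\<^sup>2"
      using mass[of x] by (simp add: measure_on_interval.space_M[OF moi])
    finally have "(norm (calc_fun g x))\<^sup>2 \<le> 2 * (B\<^sup>2 * (norm x)\<^sup>2)"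
      using norm_calc_fun_le[OF g, of x] by linarith
    also have "\<dots> \<le> 4 * (B\<^sup>2 * (norm x)\<^sup>2)" by simp
    also have "\<dots> = (2 * B * norm x)\<^sup>2" by (simp add: power_mult_distrib)
    finally have "(norm (calc_fun g x))\<^sup>2 \<le> (2 * B * norm x)\<^sup>2" .
    then show ?thesis by (rule power2_le_imp_le) (use B(2) in simp)
  qed
  then show ?thesis
    unfolding calc_def by (subst Abs_bounded_op_inverse)
      (auto simp: clinear_def calc_fun_add[OF g] calc_fun_scaleC[OF g])
qed

lemma calc_tendsto:
  "bb g \<Longrightarrow> L2_lim p g x \<Longrightarrow> (\<lambda>n. poly_op A (p n) *\<^sub>V x) \<longlonglongrightarrow> calc g *\<^sub>V x"
  by (simp add: apply_calc calc_fun_tendsto)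

lemma norm_calc_le: "bb g \<Longrightarrow> (norm (calc g *\<^sub>V x))\<^sup>2 \<le> 2 * (\<integral>t. (g t)\<^sup>2 \<partial>\<mu> x)"
  by (simp add: apply_calc norm_calc_fun_le)

lemma calc_poly: "calc (poly p) = poly_op A p"
proof (rule bounded_op_eqI)
  fix x
  have "(\<lambda>n::nat. poly_op A p *\<^sub>V x) \<longlonglongrightarrow> calc (poly p) *\<^sub>V x"
    by (rule calc_tendsto) (simp_all add: L2_lim_def)
  then show "calc (poly p) *\<^sub>V x = poly_op A p *\<^sub>V x"
    by (simp add: LIMSEQ_const_iff)
qed

lemma calc_const: "calc (\<lambda>t. c) = c *\<^sub>R 1"
proof -
  have "poly [:c:] = (\<lambda>t. c)" by (rule ext) simp
  then show ?thesis using calc_poly[of "[:c:]"] by simp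
qed

lemma calc_id: "calc (\<lambda>t. t) = A"
proof -
  have "poly [:0, 1:] = (\<lambda>t::real. t)" by (rule ext) simp
  then show ?thesis using calc_poly[of "[:0, 1:]"] by simp
qed

lemma selfadjoint_calc:
  assumes g: "bb g"
  shows "selfadjoint (calc g)"
  unfolding selfadjoint_def
proof (intro allI)
  fix x y
  obtain p where p: "\<And>z. z \<in> {x, y} \<Longrightarrow> L2_lim p g z" using ex_L2_lim[of "{x, y}" g] g by auto
  have "(\<lambda>n. cinner (poly_op A (p n) *\<^sub>V x) y) \<longlonglongrightarrow> cinner (calc g *\<^sub>V x) y"
    by (intro cinner.tendsto tendsto_const calc_tendsto g p) auto
  moreover have "(\<lambda>n. cinner x (poly_op A (p n) *\<^sub>V y)) \<longlonglongrightarrow> cinner x (calc g *\<^sub>V y)"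
    by (intro cinner.tendsto tendsto_const calc_tendsto g p) auto
  ultimately show "cinner (calc g *\<^sub>V x) y = cinner x (calc g *\<^sub>V y)"
    by (simp add: selfadjointD[OF selfadjoint_poly_op[OF selfadjoint_A]] LIMSEQ_unique)
qed

lemma calc_form:
  assumes g: "bb g"
  shows "cinner (calc g *\<^sub>V x) x = complex_of_real (\<integral>t. g t \<partial>\<mu> x)"
proof -
  obtain p where p: "L2_lim p g x" using ex_L2_lim[of "{x}" g] g by auto
  have "(\<lambda>n. Re (cinner (poly_op A (p n) *\<^sub>V x) x)) \<longlonglongrightarrow> Re (cinner (calc g *\<^sub>V x) x)"
    by (intro tendsto_Re cinner.tendsto tendsto_const calc_tendsto g p)
  moreover have "(\<lambda>n. Re (cinner (poly_op A (p n) *\<^sub>V x) x)) \<longlonglongrightarrow> (\<integral>t. g t \<partial>\<mu> x)"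
  proof -
    have "(\<lambda>n. (\<integral>t. g t - poly (p n) t \<partial>\<mu> x)\<^sup>2) \<longlonglongrightarrow> 0"
    proof (rule Lim_null_comparison)
      show "(\<lambda>n. (norm x)\<^sup>2 * (\<integral>t. (g t - poly (p n) t)\<^sup>2 \<partial>\<mu> x)) \<longlonglongrightarrow> 0"
        using p unfolding L2_lim_def by (rule tendsto_mult_right_zero)
      have "(\<integral>t. g t - poly (p n) t \<partial>\<mu> x)\<^sup>2 \<le> (norm x)\<^sup>2 * (\<integral>t. (g t - poly (p n) t)\<^sup>2 \<partial>\<mu> x)" for n
        unfolding mass[symmetric]
        by (intro measure_on_interval.integral_power2_le[OF moi] bounded_borel_on_intros g)
      then show "\<forall>\<^sub>F n in sequentially. norm ((\<integral>t. g t - poly (p n) t \<partial>\<mu> x)\<^sup>2)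
          \<le> (norm x)\<^sup>2 * (\<integral>t. (g t - poly (p n) t)\<^sup>2 \<partial>\<mu> x)"
        by simp
    qed
    then have "(\<lambda>n. \<integral>t. g t - poly (p n) t \<partial>\<mu> x) \<longlonglongrightarrow> 0"
      by (simp add: power_tendsto_0_iff)
    then have "(\<lambda>n. (\<integral>t. g t \<partial>\<mu> x) - (\<integral>t. poly (p n) t \<partial>\<mu> x)) \<longlonglongrightarrow> 0"
      using g by (simp add: integrable_bb)
    from tendsto_diff[OF tendsto_const[of "\<integral>t. g t \<partial>\<mu> x"] this]
    show ?thesis by (simp add: moments)
  qed
  ultimately have "Re (cinner (calc g *\<^sub>V x) x) = (\<integral>t. g t \<partial>\<mu> x)"
    by (rule LIMSEQ_unique)
  then show ?thesis
    using selfadjoint_form_real[OF selfadjoint_calc[OF g]] by metis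
qed

lemma calc_Re_form: "bb g \<Longrightarrow> Re (cinner (calc g *\<^sub>V x) x) = (\<integral>t. g t \<partial>\<mu> x)"
  by (simp add: calc_form)

lemma calc_eqI:
  assumes "bb g" "bb h" "\<And>x. (\<integral>t. g t \<partial>\<mu> x) = (\<integral>t. h t \<partial>\<mu> x)"
  shows "calc g = calc h"
  using assms by (intro selfadjoint_eqI selfadjoint_calc) (simp_all add: calc_Re_form)

lemma calc_add: "bb g \<Longrightarrow> bb h \<Longrightarrow> calc (\<lambda>t. g t + h t) = calc g + calc h"
  by (intro selfadjoint_eqI selfadjoint_calc selfadjoint_add bounded_borel_on_add)
    (simp_all add: apply_op_add cinner_add_left calc_Re_form bounded_borel_on_add integrable_bb)

lemma calc_scale: "bb g \<Longrightarrow> calc (\<lambda>t. c * g t) = c *\<^sub>R calc g"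
  by (intro selfadjoint_eqI selfadjoint_calc selfadjoint_scaleR bounded_borel_on_intros)
    (simp_all add: apply_op_scaleR cinner_scaleR_left calc_Re_form bounded_borel_on_intros)

lemma calc_diff: "bb g \<Longrightarrow> bb h \<Longrightarrow> calc (\<lambda>t. g t - h t) = calc g - calc h"
  by (intro selfadjoint_eqI selfadjoint_calc selfadjoint_diff bounded_borel_on_diff)
    (simp_all add: apply_op_diff cinner_diff_left calc_Re_form bounded_borel_on_diff integrable_bb)

lemma calc_mult_poly:
  assumes h: "bb h"
  shows "calc (\<lambda>t. poly p t * h t) = poly_op A p * calc h"
proof (rule bounded_op_eqI)
  fix x
  from bounded_borel_on_poly[of a b p] obtain B where B: "\<And>t. t \<in> {a..b} \<Longrightarrow> \<bar>poly p t\<bar> \<le> B"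
    unfolding bounded_borel_on_iff by blast
  obtain q where q: "L2_lim q h x" using ex_L2_lim[of "{x}" h] h by auto
  have "L2_lim (\<lambda>n. p * q n) (\<lambda>t. poly p t * h t) x"
    unfolding L2_lim_def
  proof (rule Lim_null_comparison)
    show "(\<lambda>n. B\<^sup>2 * (\<integral>t. (h t - poly (q n) t)\<^sup>2 \<partial>\<mu> x)) \<longlonglongrightarrow> 0"
      using q unfolding L2_lim_def by (rule tendsto_mult_right_zero)
    have "(\<integral>t. (poly p t * h t - poly (p * q n) t)\<^sup>2 \<partial>\<mu> x) \<le> B\<^sup>2 * (\<integral>t. (h t - poly (q n) t)\<^sup>2 \<partial>\<mu> x)" for n
    proof -
      have "(\<integral>t. (poly p t * h t - poly (p * q n) t)\<^sup>2 \<partial>\<mu> x) \<le> (\<integral>t. B\<^sup>2 * (h t - poly (q n) t)\<^sup>2 \<partial>\<mu> x)"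
      proof (rule integral_mono_AE)
        show "AE t in \<mu> x. (poly p t * h t - poly (p * q n) t)\<^sup>2 \<le> B\<^sup>2 * (h t - poly (q n) t)\<^sup>2"
          using measure_on_interval.AE_M[OF moi]
        proof (rule eventually_mono)
          show "(poly p t * h t - poly (p * q n) t)\<^sup>2 \<le> B\<^sup>2 * (h t - poly (q n) t)\<^sup>2" if "t \<in> {a..b}" for t
            using power_mono[OF B[OF that], of 2]
            by (simp add: power_mult_distrib mult_right_mono flip: right_diff_distrib)
        qed
      qed (intro integrable_bb bounded_borel_on_intros h)+
      then show ?thesis by simp
    qed
    then show "\<forall>\<^sub>F n in sequentially. norm (\<integral>t. (poly p t * h t - poly (p * q n) t)\<^sup>2 \<partial>\<mu> x)
        \<le> B\<^sup>2 * (\<integral>t. (h t - poly (q n) t)\<^sup>2 \<partial>\<mu> x)"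
      by simp
  qed
  then have "(\<lambda>n. poly_op A (p * q n) *\<^sub>V x) \<longlonglongrightarrow> calc (\<lambda>t. poly p t * h t) *\<^sub>V x"
    by (intro calc_tendsto bounded_borel_on_intros h)
  moreover have "(\<lambda>n. poly_op A p *\<^sub>V poly_op A (q n) *\<^sub>V x) \<longlonglongrightarrow> poly_op A p *\<^sub>V calc h *\<^sub>V x"
    by (intro tendsto_apply_op calc_tendsto h q)
  ultimately show "calc (\<lambda>t. poly p t * h t) *\<^sub>V x = (poly_op A p * calc h) *\<^sub>V x"
    by (simp add: poly_op_mult apply_op_times LIMSEQ_unique)
qed

text \<open>
  With \<open>p\<^sub>n \<rightarrow> g\<close> for the two vectors \<open>x\<close> and \<open>h(A)x\<close>, the vectors \<open>p\<^sub>n(A) h(A) x\<close> tend to \<open>g(A) h(A) x\<close>.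
  But they equal \<open>(p\<^sub>n h)(A) x\<close>, and \<open>p\<^sub>n h \<rightarrow> g h\<close> in \<open>L\<^sup>2(\<mu> x)\<close> since \<open>h\<close> is bounded.
\<close>

lemma calc_mult:
  assumes g: "bb g" and h: "bb h"
  shows "calc (\<lambda>t. g t * h t) = calc g * calc h"
proof (rule bounded_op_eqI)
  fix x
  from h obtain B where B: "\<And>t. t \<in> {a..b} \<Longrightarrow> \<bar>h t\<bar> \<le> B"
    unfolding bounded_borel_on_iff by blast
  obtain p where p: "\<And>z. z \<in> {x, calc h *\<^sub>V x} \<Longrightarrow> L2_lim p g z"
    using ex_L2_lim[of "{x, calc h *\<^sub>V x}" g] g by auto
  have "(\<lambda>n. poly_op A (p n) *\<^sub>V calc h *\<^sub>V x) \<longlonglongrightarrow> calc g *\<^sub>V calc h *\<^sub>V x"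
    by (intro calc_tendsto g p) auto
  moreover have "(\<lambda>n. poly_op A (p n) *\<^sub>V calc h *\<^sub>V x - calc (\<lambda>t. g t * h t) *\<^sub>V x) \<longlonglongrightarrow> 0"
  proof -
    have "(\<lambda>n. (norm (poly_op A (p n) *\<^sub>V calc h *\<^sub>V x - calc (\<lambda>t. g t * h t) *\<^sub>V x))\<^sup>2) \<longlonglongrightarrow> 0"
    proof (rule Lim_null_comparison)
      show "(\<lambda>n. 2 * B\<^sup>2 * (\<integral>t. (g t - poly (p n) t)\<^sup>2 \<partial>\<mu> x)) \<longlonglongrightarrow> 0"
        using p[of x] unfolding L2_lim_def by (intro tendsto_mult_right_zero) simp
      have "(norm (poly_op A (p n) *\<^sub>V calc h *\<^sub>V x - calc (\<lambda>t. g t * h t) *\<^sub>V x))\<^sup>2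
          \<le> 2 * B\<^sup>2 * (\<integral>t. (g t - poly (p n) t)\<^sup>2 \<partial>\<mu> x)" for n
      proof -
        have "poly_op A (p n) * calc h - calc (\<lambda>t. g t * h t) = calc (\<lambda>t. poly (p n) t * h t - g t * h t)"
          using calc_diff[of "\<lambda>t. poly (p n) t * h t" "\<lambda>t. g t * h t"] calc_mult_poly[OF h, of "p n"] g h
          by (simp add: bounded_borel_on_intros)
        then have "(norm (poly_op A (p n) *\<^sub>V calc h *\<^sub>V x - calc (\<lambda>t. g t * h t) *\<^sub>V x))\<^sup>2
          = (norm (calc (\<lambda>t. poly (p n) t * h t - g t * h t) *\<^sub>V x))\<^sup>2"
          by (metis apply_op_diff apply_op_times)
        also have "\<dots> \<le> 2 * (\<integral>t. (poly (p n) t * h t - g t * h t)\<^sup>2 \<partial>\<mu> x)"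
          by (intro norm_calc_le bounded_borel_on_intros g h)
        also have "(\<integral>t. (poly (p n) t * h t - g t * h t)\<^sup>2 \<partial>\<mu> x) \<le> (\<integral>t. B\<^sup>2 * (g t - poly (p n) t)\<^sup>2 \<partial>\<mu> x)"
        proof (rule integral_mono_AE)
          show "AE t in \<mu> x. (poly (p n) t * h t - g t * h t)\<^sup>2 \<le> B\<^sup>2 * (g t - poly (p n) t)\<^sup>2"
            using measure_on_interval.AE_M[OF moi]
          proof (rule eventually_mono)
            show "(poly (p n) t * h t - g t * h t)\<^sup>2 \<le> B\<^sup>2 * (g t - poly (p n) t)\<^sup>2" if "t \<in> {a..b}" for t
              using power_mono[OF B[OF that], of 2]
              by (simp add: power_mult_distrib mult_left_mono power2_commute[of "g t"] mult.commute[of "B\<^sup>2"]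
                flip: left_diff_distrib)
          qed
        qed (intro integrable_bb bounded_borel_on_intros g h)+
        finally show ?thesis by simp
      qed
      then show "\<forall>\<^sub>F n in sequentially. norm ((norm (poly_op A (p n) *\<^sub>V calc h *\<^sub>V x - calc (\<lambda>t. g t * h t) *\<^sub>V x))\<^sup>2)
          \<le> 2 * B\<^sup>2 * (\<integral>t. (g t - poly (p n) t)\<^sup>2 \<partial>\<mu> x)" by simp
    qed
    then show ?thesis by (simp add: tendsto_norm_zero_iff)
  qed
  ultimately show "calc (\<lambda>t. g t * h t) *\<^sub>V x = (calc g * calc h) *\<^sub>V x"
    unfolding apply_op_times by (intro LIMSEQ_unique[OF LIM_zero_cancel])
qed

lemma norm_calc:
  assumes g: "bb g"
  shows "(norm (calc g *\<^sub>V x))\<^sup>2 = (\<integral>t. (g t)\<^sup>2 \<partial>\<mu> x)"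
proof -
  have "(norm (calc g *\<^sub>V x))\<^sup>2 = Re (cinner ((calc g * calc g) *\<^sub>V x) x)"
    by (simp add: apply_op_times selfadjointD[OF selfadjoint_calc[OF g], of "calc g *\<^sub>V x" x] Re_cinner_self)
  also have "\<dots> = (\<integral>t. g t * g t \<partial>\<mu> x)"
    using g by (simp add: calc_mult[symmetric] calc_Re_form bounded_borel_on_intros)
  finally show ?thesis by (simp add: power2_eq_square)
qed

lemma calc_commutes:
  assumes S: "S * A = A * S" and g: "bb g"
  shows "S * calc g = calc g * S"
proof (rule bounded_op_eqI)
  fix x
  obtain p where p: "\<And>z. z \<in> {x, S *\<^sub>V x} \<Longrightarrow> L2_lim p g z"
    using ex_L2_lim[of "{x, S *\<^sub>V x}" g] g by auto
  have "(\<lambda>n. S *\<^sub>V poly_op A (p n) *\<^sub>V x) \<longlonglongrightarrow> S *\<^sub>V calc g *\<^sub>V x"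
    by (intro tendsto_apply_op calc_tendsto g p) auto
  moreover have "(\<lambda>n. poly_op A (p n) *\<^sub>V S *\<^sub>V x) \<longlonglongrightarrow> calc g *\<^sub>V S *\<^sub>V x"
    by (intro calc_tendsto g p) auto
  moreover have "S *\<^sub>V poly_op A q *\<^sub>V x = poly_op A q *\<^sub>V S *\<^sub>V x" for q
    using poly_op_commutes[OF S, of q] by (metis apply_op_times)
  ultimately show "(S * calc g) *\<^sub>V x = (calc g * S) *\<^sub>V x"
    by (simp add: apply_op_times LIMSEQ_unique)
qed

end


section \<open>Spectrum and spectral measure\<close>

text \<open>
  Polarization: over the complex numbers the quadratic form determines the operator, whether or not
  it is self-adjoint.
\<close>

lemma bounded_op_form_zero:
  assumes "\<And>x. cinner (T *\<^sub>V x) x = 0"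
  shows "T = 0"
proof (rule bounded_op_eqI)
  fix x
  have sym: "cinner (T *\<^sub>V x) y + cinner (T *\<^sub>V y) x = 0" for y
    using assms[of "x + y"] by (simp add: assms apply_op_add_right cinner_add_left cinner_add_right add.commute)
  have "cinner (T *\<^sub>V x) (T *\<^sub>V x) = 0"
    using sym[of "T *\<^sub>V x"] sym[of "\<i> *\<^sub>C (T *\<^sub>V x)"]
    by (simp add: apply_op_scaleC_right cinner_scaleC_left cinner_scaleC_right)
  then show "T *\<^sub>V x = 0 *\<^sub>V x"
    by (simp add: cinner_self_real)
qed

lemma cinner_eqI:
  assumes "\<And>z. cinner x z = cinner y z"
  shows "x = (y::'a::chilbert_space)"
proof -
  have "cinner (x - y) (x - y) = 0"
    using assms[of "x - y"] by (simp add: cinner_diff_left)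
  then show ?thesis by (simp add: cinner_self_real)
qed

lemma bounded_op_norm_bound:
  obtains K where "K > 0" "\<And>x. norm (T *\<^sub>V x) \<le> K * norm x"
proof -
  have "\<exists>K>0. \<forall>x. norm (T *\<^sub>V x) \<le> norm x * K"
    using bounded_linear.pos_bounded[OF bounded_linear_apply_op] .
  then show ?thesis using that by (auto simp: mult.commute)
qed

lemma ex_moment_family:
  assumes A: "selfadjoint A" and "a < b" "a *\<^sub>R 1 \<le> A" "A \<le> b *\<^sub>R 1"
  shows "\<exists>\<mu>. moment_family A a b \<mu>"
proof -
  have lo: "a * (norm x)\<^sup>2 \<le> Re (cinner (A *\<^sub>V x) x)" and hi: "Re (cinner (A *\<^sub>V x) x) \<le> b * (norm x)\<^sup>2" for x
    using assms by (simp_all add: bounded_op_le_iff apply_op_scaleR cinner_scaleR_left Re_cinner_self)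
  have "\<exists>M. finite_measure M \<and> sets M = sets borel \<and> (AE t in M. t \<in> {a..b}) \<and>
      (\<forall>p. integral\<^sup>L M (poly p) = Re (cinner (poly_op A p *\<^sub>V x) x))" for x
    using form_poly_op_nonneg[OF A \<open>a < b\<close> lo hi] \<open>a < b\<close>
    by (intro moment_problem_interval)
      (simp_all add: poly_op_add poly_op_smult apply_op_add apply_op_scaleR cinner_add_left cinner_scaleR_left
        del: mult_pCons_left mult_pCons_right)
  then obtain \<mu> where "\<And>x. finite_measure (\<mu> x) \<and> sets (\<mu> x) = sets borel \<and> (AE t in \<mu> x. t \<in> {a..b}) \<and>
      (\<forall>p. integral\<^sup>L (\<mu> x) (poly p) = Re (cinner (poly_op A p *\<^sub>V x) x))"
    by metis
  then have "moment_family A a b \<mu>"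
    by (intro moment_family.intro A measure_on_interval.intro measure_on_interval_axioms.intro) blast+
  then show ?thesis by blast
qed

lemma selfadjoint_bounds:
  assumes A: "selfadjoint A"
  obtains K where "K > 0" "(- K) *\<^sub>R 1 \<le> A" "A \<le> K *\<^sub>R 1"
proof -
  obtain K where K: "K > 0" "\<And>x. norm (A *\<^sub>V x) \<le> K * norm x"
    using bounded_op_norm_bound by blast
  have "\<bar>Re (cinner (A *\<^sub>V x) x)\<bar> \<le> K * (norm x)\<^sup>2" for x
  proof -
    have "\<bar>Re (cinner (A *\<^sub>V x) x)\<bar> \<le> cmod (cinner (A *\<^sub>V x) x)" by (rule abs_Re_le_cmod)
    also have "\<dots> \<le> norm (A *\<^sub>V x) * norm x" by (rule Cauchy_Schwarz_cinner)
    also have "\<dots> \<le> K * norm x * norm x" by (intro mult_right_mono K) simp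
    finally show ?thesis by (simp add: power2_eq_square)
  qed
  note bd = this
  have "- (K * (norm x)\<^sup>2) \<le> Re (cinner (A *\<^sub>V x) x)" "Re (cinner (A *\<^sub>V x) x) \<le> K * (norm x)\<^sup>2" for x
    using bd[of x] by linarith+
  then have "(- K) *\<^sub>R 1 \<le> A" "A \<le> K *\<^sub>R 1"
    by (simp_all add: bounded_op_le_iff apply_op_minus apply_op_scaleR cinner_minus_left cinner_scaleR_left Re_cinner_self
        selfadjoint_diff selfadjoint_add selfadjoint_scaleR A)
  then show ?thesis using that K(1) by blast
qed

context moment_family
begin

abbreviation proj :: "real set \<Rightarrow> 'a bounded_op" where "proj S \<equiv> calc (indicator S)"

lemma finite_measure_\<mu>: "finite_measure (\<mu> x)"
  using moi by (rule measure_on_interval.axioms)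

lemma sets_\<mu> [simp]: "sets (\<mu> x) = sets borel"
  by (rule measure_on_interval.sets_M[OF moi])

lemma space_\<mu> [simp]: "space (\<mu> x) = UNIV"
  by (rule measure_on_interval.space_M[OF moi])

lemma bb_id [simp]: "bb (\<lambda>t. t)"
  by (rule bounded_borel_on_continuous) auto

lemma norm_proj: "S \<in> sets borel \<Longrightarrow> (norm (proj S *\<^sub>V x))\<^sup>2 = measure (\<mu> x) S"
proof -
  assume S: "S \<in> sets borel"
  have "(\<lambda>t. (indicator S t :: real)\<^sup>2) = indicator S"
    by (rule ext) (simp add: indicator_def)
  then show ?thesis using norm_calc[of "indicator S" x] S by simp
qed

lemma calc_sum:
  assumes "finite I" "\<And>i. i \<in> I \<Longrightarrow> bb (g i)"
  shows "calc (\<lambda>t. \<Sum>i\<in>I. g i t) = (\<Sum>i\<in>I. calc (g i))"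
  using assms by (induction I rule: finite_induct) (simp_all add: calc_const calc_add bounded_borel_on_sum)

lemma projection_valued_measure_proj: "projection_valued_measure proj"
  unfolding projection_valued_measure_def
proof (intro conjI ballI allI impI)
  fix S :: "real set" assume S: "S \<in> sets borel"
  show "selfadjoint (proj S)" by (rule selfadjoint_calc) (simp add: S)
  show "proj S * proj S = proj S"
    using calc_mult[of "indicator S" "indicator S"] S by (simp flip: indicator_inter_arith)
next
  have "(indicator UNIV :: real \<Rightarrow> real) = (\<lambda>t. 1)" by (rule ext) simp
  then show "proj UNIV = 1" by (simp add: calc_const)
next
  fix S T :: "real set" assume "S \<in> sets borel" "T \<in> sets borel"
  then show "proj (S \<inter> T) = proj S * proj T"
    using calc_mult[of "indicator S" "indicator T"] by (simp flip: indicator_inter_arith)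
next
  fix S :: "nat \<Rightarrow> real set" and x
  assume *: "range S \<subseteq> sets borel \<and> disjoint_family S"
  then have S: "S i \<in> sets borel" for i by auto
  have eq: "(\<lambda>t. \<Sum>i<n. indicator (S i) t) = (indicator (\<Union>i<n. S i) :: real \<Rightarrow> real)" for n
    by (rule ext) (use * in \<open>simp add: indicator_UN_disjoint disjoint_family_on_def\<close>)
  have U: "(\<Union>i<n. S i) \<in> sets borel" "(\<Union>i. S i) \<in> sets borel" for n using S by auto
  have "(norm ((\<Sum>i<n. proj (S i) *\<^sub>V x) - proj (\<Union>i. S i) *\<^sub>V x))\<^sup>2
    = (\<integral>t. (indicator (\<Union>i. S i) t - indicator (\<Union>i<n. S i) t)\<^sup>2 \<partial>\<mu> x)" for n
  proof -
    have "(\<Sum>i<n. proj (S i)) = proj (\<Union>i<n. S i)"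
      using calc_sum[of "{..<n}" "\<lambda>i. indicator (S i)"] S by (simp add: eq)
    then have "(\<Sum>i<n. proj (S i) *\<^sub>V x) - proj (\<Union>i. S i) *\<^sub>V x
        = calc (\<lambda>t. indicator (\<Union>i<n. S i) t - indicator (\<Union>i. S i) t) *\<^sub>V x"
      using calc_diff[of "indicator (\<Union>i<n. S i)" "indicator (\<Union>i. S i)"] U
      by (simp add: apply_op_diff flip: apply_op_sum)
    then show ?thesis
      using norm_calc[of "\<lambda>t. indicator (\<Union>i<n. S i) t - indicator (\<Union>i. S i) t" x] U
      by (simp add: bounded_borel_on_diff power2_commute)
  qed
  moreover have "(\<lambda>n. \<integral>t. (indicator (\<Union>i. S i) t - indicator (\<Union>i<n. S i) t :: real)\<^sup>2 \<partial>\<mu> x) \<longlonglongrightarrow> 0"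
  proof (rule measure_on_interval.L2_dominated_convergence[OF moi])
    show "\<bar>indicator (\<Union>i<n. S i) t\<bar> \<le> (1::real)" for n t by (simp add: indicator_def)
    show "(\<lambda>n. indicator (\<Union>i<n. S i) t) \<longlonglongrightarrow> (indicator (\<Union>i. S i) t :: real)" for t
      by (rule LIMSEQ_indicator_UN)
  qed (use U in auto)
  ultimately have "(\<lambda>n. norm ((\<Sum>i<n. proj (S i) *\<^sub>V x) - proj (\<Union>i. S i) *\<^sub>V x)) \<longlonglongrightarrow> 0"
    by (subst power_tendsto_0_iff[symmetric, of 2]) simp_all
  then show "(\<lambda>n. proj (S n) *\<^sub>V x) sums (proj (\<Union>n. S n) *\<^sub>V x)"
    unfolding sums_def by (simp add: LIM_zero_cancel tendsto_norm_zero_iff)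
qed

lemma scalar_measure_proj: "scalar_measure proj x = \<mu> x"
proof -
  have "scalar_measure proj x = measure_of UNIV (sets borel) (emeasure (\<mu> x))"
    unfolding scalar_measure_def
  proof (rule measure_of_eq)
    show "(sets borel :: real set set) \<subseteq> Pow UNIV" by simp
    fix S :: "real set" assume "S \<in> sigma_sets UNIV (sets borel)"
    then have S: "S \<in> sets borel" using sets.sigma_sets_eq[of "borel :: real measure"] by simp
    have "Re (cinner (proj S *\<^sub>V x) x) = measure (\<mu> x) S"
      using S by (simp add: calc_Re_form)
    then show "ennreal (Re (cinner (proj S *\<^sub>V x) x)) = emeasure (\<mu> x) S"
      by (simp add: finite_measure.emeasure_eq_measure[OF finite_measure_\<mu>])
  qed
  then show ?thesis
    using measure_of_of_measure[of "\<mu> x"] by simp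
qed

text \<open>
  If all measures live on a set at positive distance from \<open>s\<close>, then \<open>t \<mapsto> 1 / (t - s)\<close> is a bounded
  function there, and its value at \<open>A\<close> inverts \<open>A - s\<close>.
\<close>

lemma resolvent_calc:
  assumes S: "S \<in> sets borel" "\<And>x. AE t in \<mu> x. t \<in> S"
    and e: "e > 0" "\<And>t. t \<in> S \<Longrightarrow> e \<le> \<bar>t - s\<bar>"
  shows "s \<notin> real_spectrum A"
proof -
  define r where "r t = indicator S t * inverse (t - s)" for t
  have r: "bb r"
  proof (rule bounded_borel_onI)
    show "r \<in> borel_measurable borel" unfolding r_def using S(1) by measurable
    show "\<bar>r t\<bar> \<le> inverse e" for t
      using e(1) le_imp_inverse_le[OF e(2) e(1), of t] by (auto simp: r_def indicator_def abs_inverse)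
  qed
  have As: "calc (\<lambda>t. t - s) = A - complex_of_real s *\<^sub>C 1"
    by (simp add: calc_diff calc_id calc_const scaleR_scaleC)
  have bbs: "bb (\<lambda>t. t - s)" by (simp add: bounded_borel_on_diff)
  have rs: "AE t in \<mu> x. r t * (t - s) = 1" for x
    using S(2)
  proof (rule eventually_mono)
    show "r t * (t - s) = 1" if "t \<in> S" for t
      using e(2)[OF that] e(1) that by (simp add: r_def)
  qed
  have "calc (\<lambda>t. r t * (t - s)) = calc (\<lambda>t. 1)"
    using rs r bbs by (intro calc_eqI integral_cong_AE bounded_borel_on_intros)
      (auto simp: borel_measurable_integrable integrable_bb bounded_borel_on_mult)
  then have "calc r * calc (\<lambda>t. t - s) = 1" "calc (\<lambda>t. t - s) * calc r = 1"
    using calc_mult[OF r bbs] calc_mult[OF bbs r] by (simp_all add: calc_const mult.commute)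
  then show ?thesis
    unfolding real_spectrum_def spectrum_def As by auto
qed

text \<open>
  Conversely, if \<open>A - s\<close> has an inverse of norm \<open>K\<close>, then a vector \<open>y\<close> in the spectral subspace of the
  interval of radius \<open>e\<close> around \<open>s\<close> satisfies \<open>\<parallel>y\<parallel> \<le> K \<parallel>(A - s)y\<parallel> \<le> K e \<parallel>y\<parallel>\<close>, hence is zero once
  \<open>K e < 1\<close>.
\<close>

lemma null_nbhd_of_resolvent:
  assumes "s \<notin> real_spectrum A"
  obtains e where "e > 0" "\<And>x. emeasure (\<mu> x) {s - e<..<s + e} = 0"
proof -
  from assms obtain R where R: "R * (A - complex_of_real s *\<^sub>C 1) = 1"
    by (auto simp: real_spectrum_def spectrum_def)
  obtain K where K: "K > 0" "\<And>x. norm (R *\<^sub>V x) \<le> K * norm x"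
    using bounded_op_norm_bound by blast
  define e where "e = 1 / (2 * K)"
  have e: "e > 0" using K by (simp add: e_def)
  define U where "U = {s - e<..<s + e}"
  have U: "U \<in> sets borel" by (simp add: U_def)
  have As: "calc (\<lambda>t. t - s) = A - complex_of_real s *\<^sub>C 1"
    by (simp add: calc_diff calc_id calc_const scaleR_scaleC)
  have bbs: "bb (\<lambda>t. t - s)" by (simp add: bounded_borel_on_diff)
  have "emeasure (\<mu> x) U = 0" for x
  proof -
    define y where "y = proj U *\<^sub>V x"
    have "(norm ((A - complex_of_real s *\<^sub>C 1) *\<^sub>V y))\<^sup>2 = (\<integral>t. ((t - s) * indicator U t)\<^sup>2 \<partial>\<mu> x)"
      using norm_calc[of "\<lambda>t. (t - s) * indicator U t" x] calc_mult[OF bbs, of "indicator U"] U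
      by (simp add: y_def As bounded_borel_on_mult bbs apply_op_times)
    also have "\<dots> \<le> (\<integral>t. e\<^sup>2 * indicator U t \<partial>\<mu> x)"
    proof (rule integral_mono)
      show "((t - s) * indicator U t)\<^sup>2 \<le> e\<^sup>2 * indicator U t" for t
        using power_mono[of "\<bar>t - s\<bar>" e 2] by (auto simp: U_def indicator_def)
    qed (use U bbs in \<open>auto intro!: integrable_bb bounded_borel_on_intros\<close>)
    also have "\<dots> = e\<^sup>2 * (norm y)\<^sup>2"
      using U by (simp add: y_def norm_proj)
    finally have "(norm ((A - complex_of_real s *\<^sub>C 1) *\<^sub>V y))\<^sup>2 \<le> (e * norm y)\<^sup>2"
      by (simp add: power_mult_distrib)
    then have le: "norm ((A - complex_of_real s *\<^sub>C 1) *\<^sub>V y) \<le> e * norm y"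
      by (rule power2_le_imp_le) (use e in simp)
    have "norm y = norm (R *\<^sub>V (A - complex_of_real s *\<^sub>C 1) *\<^sub>V y)"
      by (simp flip: apply_op_times add: R)
    also have "\<dots> \<le> K * norm ((A - complex_of_real s *\<^sub>C 1) *\<^sub>V y)" by (rule K)
    also have "\<dots> \<le> K * (e * norm y)" using le K(1) by simp
    also have "\<dots> = norm y / 2" using K(1) by (simp add: e_def)
    finally have "norm y = 0" by simp
    then show ?thesis
      using norm_proj[OF U, of x] by (simp add: y_def finite_measure.emeasure_eq_measure[OF finite_measure_\<mu>])
  qed
  then show ?thesis using that e unfolding U_def by blast
qed

lemma real_spectrum_subset: "real_spectrum A \<subseteq> {a..b}"
proof
  fix s assume s: "s \<in> real_spectrum A"
  show "s \<in> {a..b}"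
  proof (rule ccontr)
    assume "s \<notin> {a..b}"
    then have "s \<in> - {a..b}" "open (- {a..b})" by auto
    then obtain e where e: "e > 0" "\<And>t. dist t s < e \<Longrightarrow> t \<notin> {a..b}"
      unfolding open_dist by (meson ComplD)
    then have "e \<le> \<bar>t - s\<bar>" if "t \<in> {a..b}" for t
      using that by (force simp: dist_real_def)
    then have "s \<notin> real_spectrum A"
      using resolvent_calc[of "{a..b}" e s] measure_on_interval.AE_M[OF moi] e(1) by simp
    with s show False by simp
  qed
qed

lemma closed_real_spectrum: "closed (real_spectrum A)"
  unfolding closed_def open_dist
proof
  fix s assume "s \<in> - real_spectrum A"
  then obtain e where e: "e > 0" "\<And>x. emeasure (\<mu> x) {s - e<..<s + e} = 0"
    using null_nbhd_of_resolvent by auto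
  have AE: "AE t in \<mu> x. t \<in> - {s - e<..<s + e}" for x
    by (rule AE_I[of _ _ "{s - e<..<s + e}"]) (use e(2) in auto)
  show "\<exists>e>0. \<forall>y. dist y s < e \<longrightarrow> y \<in> - real_spectrum A"
  proof (intro exI[of _ "e / 2"] conjI allI impI)
    fix y assume "dist y s < e / 2"
    then have y: "\<bar>y - s\<bar> < e / 2" by (simp add: dist_real_def)
    have far: "e / 2 \<le> \<bar>t - y\<bar>" if "t \<in> - {s - e<..<s + e}" for t
    proof -
      have "e \<le> \<bar>t - s\<bar>" using that by auto
      with y show ?thesis by linarith
    qed
    show "y \<in> - real_spectrum A"
      using resolvent_calc[of "- {s - e<..<s + e}" "e / 2" y, OF _ AE _ far] e(1) by simp
  qed (use e(1) in simp)
qed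

lemma borel_real_spectrum [simp]: "real_spectrum A \<in> sets borel"
  using closed_real_spectrum by (rule borel_closed)

text \<open>
  The complement of the spectrum is covered by null intervals, and countably many of them suffice.
\<close>

lemma AE_real_spectrum: "AE t in \<mu> x. t \<in> real_spectrum A"
proof -
  define F where "F = {{s - e<..<s + e} | s e. e > 0 \<and> emeasure (\<mu> x) {s - e<..<s + e :: real} = 0}"
  obtain F' where F': "F' \<subseteq> F" "countable F'" "\<Union>F' = \<Union>F"
    by (rule Lindelof[of F]) (auto simp: F_def)
  have "\<Union>F' \<in> null_sets (\<mu> x)"
  proof -
    have "(\<Union>N\<in>F'. N) \<in> null_sets (\<mu> x)"
      by (rule null_sets_UN'[OF F'(2)]) (use F'(1) in \<open>auto simp: F_def null_sets_def\<close>)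
    then show ?thesis by simp
  qed
  moreover have "- real_spectrum A \<subseteq> \<Union>F'"
  proof
    fix s assume "s \<in> - real_spectrum A"
    then obtain e where "e > 0" "\<And>x. emeasure (\<mu> x) {s - e<..<s + e} = 0"
      using null_nbhd_of_resolvent by auto
    then have "{s - e<..<s + e} \<in> F" "s \<in> {s - e<..<s + e}" by (auto simp: F_def)
    then show "s \<in> \<Union>F'" unfolding F'(3) by blast
  qed
  ultimately show ?thesis by (auto intro!: AE_I'[of "\<Union>F'"])
qed

lemma has_spectral_integral_calc:
  assumes "bb (\<lambda>t. indicator (real_spectrum A) t * g t)"
  shows "has_spectral_integral proj (real_spectrum A) g (calc (\<lambda>t. indicator (real_spectrum A) t * g t))"
  using assms
  by (simp add: has_spectral_integral_def scalar_measure_proj set_integrable_def set_lebesgue_integral_def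
      integrable_bb calc_form)

lemma calc_real_spectrum:
  assumes g: "bb g"
  shows "calc (\<lambda>t. indicator (real_spectrum A) t * g t) = calc g"
proof (rule calc_eqI)
  show *: "bb (\<lambda>t. indicator (real_spectrum A) t * g t)"
    by (intro bounded_borel_on_mult g) simp
  show "(\<integral>t. indicator (real_spectrum A) t * g t \<partial>\<mu> x) = (\<integral>t. g t \<partial>\<mu> x)" for x
  proof (rule integral_cong_AE)
    show "AE t in \<mu> x. indicator (real_spectrum A) t * g t = g t"
      using AE_real_spectrum by (rule eventually_mono) simp
  qed (use * g in \<open>auto intro: borel_measurable_integrable integrable_bb\<close>)
qed (rule g)

lemma spectral_measure_proj: "spectral_measure A proj"
proof -
  have "proj (real_spectrum A) = 1"
    using calc_real_spectrum[of "\<lambda>t. 1"] by (simp add: calc_const)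
  moreover have "has_spectral_integral proj (real_spectrum A) (\<lambda>t. t) A"
    using has_spectral_integral_calc[of "\<lambda>t. t"] calc_real_spectrum[of "\<lambda>t. t"]
    by (simp add: bounded_borel_on_mult calc_id)
  ultimately show ?thesis
    using projection_valued_measure_proj by (simp add: spectral_measure_def)
qed

end


section \<open>Uniqueness of the spectral measure\<close>

locale pvm =
  fixes E :: "real set \<Rightarrow> 'a::chilbert_space bounded_op"
  assumes pvm: "projection_valued_measure E"
begin

lemma selfadjoint_E: "S \<in> sets borel \<Longrightarrow> selfadjoint (E S)"
  and E_idem: "S \<in> sets borel \<Longrightarrow> E S * E S = E S"
  and E_UNIV [simp]: "E UNIV = 1"
  and E_Int: "S \<in> sets borel \<Longrightarrow> T \<in> sets borel \<Longrightarrow> E (S \<inter> T) = E S * E T"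
  and E_sums: "range F \<subseteq> sets borel \<Longrightarrow> disjoint_family F \<Longrightarrow> (\<lambda>n::nat. E (F n) *\<^sub>V x) sums (E (\<Union>n. F n) *\<^sub>V x)"
  using pvm unfolding projection_valued_measure_def by auto

lemma E_empty: "E {} = 0"
proof (rule bounded_op_eqI)
  fix x
  have "(\<lambda>n::nat. E {} *\<^sub>V x) sums (E {} *\<^sub>V x)"
    using E_sums[of "\<lambda>_. {}" x] by (simp add: disjoint_family_on_def)
  then have "(\<lambda>n::nat. E {} *\<^sub>V x) \<longlonglongrightarrow> 0"
    by (intro summable_LIMSEQ_zero) (rule sums_summable)
  then show "E {} *\<^sub>V x = 0 *\<^sub>V x" by (simp add: LIMSEQ_const_iff)
qed

lemma form_E: "S \<in> sets borel \<Longrightarrow> Re (cinner (E S *\<^sub>V x) x) = (norm (E S *\<^sub>V x))\<^sup>2"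
proof -
  assume S: "S \<in> sets borel"
  have "cinner (E S *\<^sub>V x) x = cinner (E S *\<^sub>V E S *\<^sub>V x) x"
    by (metis E_idem[OF S] apply_op_times)
  also have "\<dots> = cinner (E S *\<^sub>V x) (E S *\<^sub>V x)"
    by (rule selfadjointD[OF selfadjoint_E[OF S]])
  finally show ?thesis by (simp add: Re_cinner_self)
qed

lemma sets_scalar_measure [simp]: "sets (scalar_measure E x) = sets borel"
  and space_scalar_measure [simp]: "space (scalar_measure E x) = UNIV"
  using sets.sigma_sets_eq[of "borel :: real measure"] by (simp_all add: scalar_measure_def)

lemma emeasure_scalar_measure:
  assumes S: "S \<in> sets borel"
  shows "emeasure (scalar_measure E x) S = ennreal ((norm (E S *\<^sub>V x))\<^sup>2)"
proof -
  have "emeasure (scalar_measure E x) S = ennreal (Re (cinner (E S *\<^sub>V x) x))"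
  proof (rule emeasure_measure_of[OF scalar_measure_def])
    show "positive (sets (scalar_measure E x)) (\<lambda>S. ennreal (Re (cinner (E S *\<^sub>V x) x)))"
      by (simp add: positive_def E_empty)
    show "countably_additive (sets (scalar_measure E x)) (\<lambda>S. ennreal (Re (cinner (E S *\<^sub>V x) x)))"
      unfolding countably_additive_def
    proof (intro allI impI)
      fix F :: "nat \<Rightarrow> real set"
      assume F: "range F \<subseteq> sets (scalar_measure E x)" "disjoint_family F"
      then have F': "F n \<in> sets borel" for n by auto
      have "(\<lambda>n. E (F n) *\<^sub>V x) sums (E (\<Union>n. F n) *\<^sub>V x)"
        using E_sums[of F x] F by simp
      then have "(\<lambda>n. Re (cinner (E (F n) *\<^sub>V x) x)) sums Re (cinner (E (\<Union>n. F n) *\<^sub>V x) x)"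
        by (intro bounded_linear.sums[OF bounded_linear_Re] bounded_linear.sums[OF cinner.bounded_linear_left])
      then have "(\<lambda>n. ennreal (Re (cinner (E (F n) *\<^sub>V x) x))) sums ennreal (Re (cinner (E (\<Union>n. F n) *\<^sub>V x) x))"
        using F' by (subst sums_ennreal) (simp_all add: form_E)
      then show "(\<Sum>n. ennreal (Re (cinner (E (F n) *\<^sub>V x) x))) = ennreal (Re (cinner (E (\<Union>n. F n) *\<^sub>V x) x))"
        by (rule sums_unique[symmetric])
    qed
  qed (use S in auto)
  then show ?thesis by (simp add: form_E S)
qed

lemma finite_measure_scalar_measure: "finite_measure (scalar_measure E x)"
  by (rule finite_measureI) (simp add: emeasure_scalar_measure)

lemma measure_scalar_measure: "S \<in> sets borel \<Longrightarrow> measure (scalar_measure E x) S = (norm (E S *\<^sub>V x))\<^sup>2"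
  by (simp add: measure_def emeasure_scalar_measure)

lemma E_Compl: "S \<in> sets borel \<Longrightarrow> E (- S) = 1 - E S"
proof -
  assume S: "S \<in> sets borel"
  then have S': "- S \<in> sets borel" by simp
  show ?thesis
  proof (rule selfadjoint_eqI)
    fix x
    have "(norm (E (- S) *\<^sub>V x))\<^sup>2 = (norm x)\<^sup>2 - (norm (E S *\<^sub>V x))\<^sup>2"
      using finite_measure.finite_measure_compl[OF finite_measure_scalar_measure[of x], of S] S S'
      by (simp add: measure_scalar_measure flip: Compl_eq_Diff_UNIV)
    then show "Re (cinner (E (- S) *\<^sub>V x) x) = Re (cinner ((1 - E S) *\<^sub>V x) x)"
      by (simp add: form_E S S' apply_op_diff cinner_diff_left Re_cinner_self)
  qed (use S S' in \<open>simp_all add: selfadjoint_E selfadjoint_diff\<close>)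
qed

lemma AE_of_range:
  assumes S: "S \<in> sets borel" and y: "E S *\<^sub>V y = y"
  shows "AE t in scalar_measure E y. t \<in> S"
proof (rule AE_I[of _ _ "- S"])
  have "E (- S) *\<^sub>V y = 0" using y by (simp add: E_Compl S apply_op_diff)
  then show "emeasure (scalar_measure E y) (- S) = 0" using S by (simp add: emeasure_scalar_measure)
qed (use S in auto)

lemma scalar_measure_range:
  assumes S: "S \<in> sets borel"
  shows "scalar_measure E (E S *\<^sub>V x) = density (scalar_measure E x) (indicator S)"
proof (rule measure_eqI)
  fix T assume "T \<in> sets (scalar_measure E (E S *\<^sub>V x))"
  then have T: "T \<in> sets borel" by simp
  have "emeasure (density (scalar_measure E x) (indicator S)) T = emeasure (scalar_measure E x) (S \<inter> T)"
    using S T by (intro emeasure_restricted) simp_all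
  also have "\<dots> = ennreal ((norm (E T *\<^sub>V E S *\<^sub>V x))\<^sup>2)"
    using S T by (simp add: emeasure_scalar_measure Int_commute[of S] E_Int apply_op_times)
  finally show "emeasure (scalar_measure E (E S *\<^sub>V x)) T = emeasure (density (scalar_measure E x) (indicator S)) T"
    using T by (simp add: emeasure_scalar_measure)
qed simp

end

locale spectral_pvm = pvm E for A :: "'a::chilbert_space bounded_op" and E +
  assumes selfadjoint_A: "selfadjoint A"
    and E_spectrum: "E (real_spectrum A) = 1"
    and integral_A: "has_spectral_integral E (real_spectrum A) (\<lambda>t. t) A"
    and borel_spectrum: "real_spectrum A \<in> sets borel"
begin

lemma integrable_spectrum:
  "integrable (scalar_measure E x) (\<lambda>t. indicator (real_spectrum A) t * t)"
  and form_A: "Re (cinner (A *\<^sub>V x) x) = (\<integral>t. indicator (real_spectrum A) t * t \<partial>scalar_measure E x)"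
  using integral_A by (simp_all add: has_spectral_integral_def set_integrable_def set_lebesgue_integral_def)

lemma AE_spectrum: "AE t in scalar_measure E x. t \<in> real_spectrum A"
  by (rule AE_of_range[OF borel_spectrum]) (simp add: E_spectrum)

lemma integral_const: "(\<integral>t. c \<partial>scalar_measure E x) = c * (norm x)\<^sup>2"
  using measure_scalar_measure[of UNIV x] by simp

lemma integrable_const: "integrable (scalar_measure E x) (\<lambda>t. c::real)"
  by (rule finite_measure.integrable_const[OF finite_measure_scalar_measure])

lemma form_le_on_range_atMost:
  assumes "E {..c} *\<^sub>V y = y"
  shows "Re (cinner (A *\<^sub>V y) y) \<le> c * (norm y)\<^sup>2"
  unfolding form_A integral_const[symmetric]
proof (rule integral_mono_AE[OF integrable_spectrum integrable_const])
  show "AE t in scalar_measure E y. indicator (real_spectrum A) t * t \<le> c"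
    using AE_of_range[OF _ assms, simplified] AE_spectrum by eventually_elim simp
qed

lemma form_ge_on_range_atLeast:
  assumes "E {d..} *\<^sub>V y = y"
  shows "d * (norm y)\<^sup>2 \<le> Re (cinner (A *\<^sub>V y) y)"
  unfolding form_A integral_const[symmetric]
proof (rule integral_mono_AE[OF integrable_const integrable_spectrum])
  show "AE t in scalar_measure E y. d \<le> indicator (real_spectrum A) t * t"
    using AE_of_range[OF _ assms, simplified] AE_spectrum by eventually_elim simp
qed

text \<open>
  The scalar measure of \<open>E(S)x\<close> is the restriction to \<open>S\<close> of the scalar measure of \<open>x\<close>, so that
  splitting the integral over \<open>S\<close> and its complement splits the quadratic form of \<open>A\<close>.
\<close>

lemma form_A_split:
  assumes S: "S \<in> sets borel"
  shows "Re (cinner (A *\<^sub>V x) x)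
    = Re (cinner (A *\<^sub>V E S *\<^sub>V x) (E S *\<^sub>V x)) + Re (cinner (A *\<^sub>V E (- S) *\<^sub>V x) (E (- S) *\<^sub>V x))"
proof -
  let ?g = "\<lambda>t. indicator (real_spectrum A) t * t"
  let ?M = "scalar_measure E x"
  have m: "?g \<in> borel_measurable ?M" using integrable_spectrum by (rule borel_measurable_integrable)
  have part: "Re (cinner (A *\<^sub>V E T *\<^sub>V x) (E T *\<^sub>V x)) = (\<integral>t. indicator T t * ?g t \<partial>?M)"
    if T: "T \<in> sets borel" for T
  proof -
    have "(indicator T :: real \<Rightarrow> ennreal) = (\<lambda>t. ennreal (indicator T t))"
      by (rule ext) (simp add: indicator_def)
    then have "scalar_measure E (E T *\<^sub>V x) = density ?M (\<lambda>t. ennreal (indicator T t))"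
      by (simp add: scalar_measure_range T)
    then show ?thesis
      unfolding form_A using m T by (simp only:) (subst integral_density, auto intro!: borel_measurable_indicator)
  qed
  have int: "integrable ?M (\<lambda>t. indicator T t * ?g t)" if "T \<in> sets borel" for T
    using integrable_mult_indicator[of T ?M ?g] integrable_spectrum that by simp
  have "(\<lambda>t. indicator S t * ?g t + indicator (- S) t * ?g t) = ?g"
    by (rule ext) (simp add: indicator_def)
  then have "(\<integral>t. ?g t \<partial>?M) = (\<integral>t. indicator S t * ?g t \<partial>?M) + (\<integral>t. indicator (- S) t * ?g t \<partial>?M)"
    using Bochner_Integration.integral_add[OF int[of S] int[of "- S"]] S by simp
  then show ?thesis using part[of S] part[of "- S"] S by (simp add: form_A)
qed

text \<open>
  For \<open>u\<close> in the range of \<open>E(S)\<close> and \<open>v\<close> in that of \<open>E(-S)\<close> the splitting of the form at \<open>u + v\<close> leaves no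
  room for the cross term: \<open>Re \<langle>Au, v\<rangle> = 0\<close>, and \<open>\<langle>Au, v\<rangle> = 0\<close> on replacing \<open>v\<close> by \<open>\<i> v\<close>. So \<open>A\<close> maps the
  range of \<open>E(S)\<close> into itself, and as both operators are self-adjoint they commute.
\<close>

lemma A_commutes_E:
  assumes S: "S \<in> sets borel"
  shows "A * E S = E S * A"
proof -
  have S': "- S \<in> sets borel" using S by simp
  have Re0: "Re (cinner (A *\<^sub>V u) v) = 0" if u: "E S *\<^sub>V u = u" and v: "E (- S) *\<^sub>V v = v" for u v
  proof -
    have "E S *\<^sub>V v = 0" "E (- S) *\<^sub>V u = 0"
      using u v by (simp_all add: E_Compl S apply_op_diff)
    then have eq: "E S *\<^sub>V (u + v) = u" "E (- S) *\<^sub>V (u + v) = v"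
      using u v by (simp_all add: apply_op_add_right)
    have "Re (cinner (A *\<^sub>V (u + v)) (u + v)) = Re (cinner (A *\<^sub>V u) u) + Re (cinner (A *\<^sub>V v) v)"
      using form_A_split[OF S, of "u + v"] by (simp only: eq)
    moreover have "Re (cinner (A *\<^sub>V v) u) = Re (cinner (A *\<^sub>V u) v)"
      using selfadjointD[OF selfadjoint_A, of v u] cinner_commute[of v "A *\<^sub>V u"] by simp
    ultimately show ?thesis
      by (simp add: apply_op_add_right cinner_add_left cinner_add_right)
  qed
  have zero: "cinner (A *\<^sub>V u) v = 0" if u: "E S *\<^sub>V u = u" and v: "E (- S) *\<^sub>V v = v" for u v
  proof -
    have "Re (cinner (A *\<^sub>V u) (\<i> *\<^sub>C v)) = 0"
      by (rule Re0[OF u]) (simp add: apply_op_scaleC_right v)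
    then show ?thesis
      using Re0[OF u v] by (simp add: cinner_scaleC_right complex_eq_iff)
  qed
  have range: "E (- S) *\<^sub>V A *\<^sub>V E S *\<^sub>V x = 0" for x
  proof (rule cinner_eqI)
    fix z
    have "cinner (E (- S) *\<^sub>V A *\<^sub>V E S *\<^sub>V x) z = cinner (A *\<^sub>V E S *\<^sub>V x) (E (- S) *\<^sub>V z)"
      by (rule selfadjointD[OF selfadjoint_E[OF S']])
    also have "\<dots> = 0"
      by (rule zero) (simp_all flip: apply_op_times add: E_idem S S')
    finally show "cinner (E (- S) *\<^sub>V A *\<^sub>V E S *\<^sub>V x) z = cinner 0 z" by simp
  qed
  have AE: "A *\<^sub>V E S *\<^sub>V x = E S *\<^sub>V A *\<^sub>V E S *\<^sub>V x" for x
    using range[of x] by (simp add: E_Compl S apply_op_diff)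
  have "E S *\<^sub>V A *\<^sub>V x = E S *\<^sub>V A *\<^sub>V E S *\<^sub>V x" for x
  proof (rule cinner_eqI)
    fix z
    note adj = selfadjointD[OF selfadjoint_A] selfadjointD[OF selfadjoint_E[OF S]]
    have "cinner (E S *\<^sub>V A *\<^sub>V x) z = cinner x (A *\<^sub>V E S *\<^sub>V z)" by (simp add: adj)
    also have "\<dots> = cinner x (E S *\<^sub>V A *\<^sub>V E S *\<^sub>V z)" by (simp only: AE[symmetric])
    also have "\<dots> = cinner (E S *\<^sub>V A *\<^sub>V E S *\<^sub>V x) z" by (simp add: adj)
    finally show "cinner (E S *\<^sub>V A *\<^sub>V x) z = cinner (E S *\<^sub>V A *\<^sub>V E S *\<^sub>V x) z" .
  qed
  then show ?thesis
    using AE by (intro bounded_op_eqI) (simp add: apply_op_times)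
qed

end

text \<open>
  A vector in the ranges of \<open>P {..c}\<close> and \<open>Q {d..}\<close> at once, with \<open>c < d\<close>, must vanish, by the two bounds
  on its form. Letting \<open>d\<close> decrease to \<open>c\<close> shows that \<open>Q {c<..}\<close> kills the range of \<open>P {..c}\<close>.
\<close>

lemma spectral_pvm_absorb:
  assumes P: "spectral_pvm A P" and Q: "spectral_pvm A Q"
    and comm: "\<And>S T. S \<in> sets borel \<Longrightarrow> T \<in> sets borel \<Longrightarrow> P S * Q T = Q T * P S"
  shows "Q {..c} * P {..c} = P {..c}"
proof (rule bounded_op_eqI)
  fix z
  interpret P: spectral_pvm A P by (rule P)
  interpret Q: spectral_pvm A Q by (rule Q)
  define w where "w = P {..c} *\<^sub>V z"
  have zero: "Q {d..} *\<^sub>V w = 0" if "c < d" for d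
  proof -
    define y where "y = Q {d..} *\<^sub>V w"
    have "P {..c} *\<^sub>V y = (P {..c} * Q {d..} * P {..c}) *\<^sub>V z"
      by (simp add: y_def w_def apply_op_times)
    also have "P {..c} * Q {d..} * P {..c} = Q {d..} * P {..c}"
      using P.E_idem[of "{..c}"] comm[of "{..c}" "{d..}"] by (simp flip: mult.assoc) (simp add: mult.assoc)
    finally have "P {..c} *\<^sub>V y = y"
      by (simp only: apply_op_times y_def w_def)
    then have "Re (cinner (A *\<^sub>V y) y) \<le> c * (norm y)\<^sup>2" by (rule P.form_le_on_range_atMost)
    moreover have "Q {d..} *\<^sub>V y = y"
      using Q.E_idem[of "{d..}"] by (simp add: y_def flip: apply_op_times)
    then have "d * (norm y)\<^sup>2 \<le> Re (cinner (A *\<^sub>V y) y)" by (rule Q.form_ge_on_range_atLeast)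
    ultimately have "(d - c) * (norm y)\<^sup>2 \<le> 0" by (simp add: left_diff_distrib)
    then have "(norm y)\<^sup>2 \<le> 0" using that by (simp add: mult_le_0_iff)
    then show ?thesis by (simp add: y_def)
  qed
  have union: "{c<..} = (\<Union>n. {c + inverse (real (Suc n))..})"
  proof (intro set_eqI iffI)
    fix t assume "t \<in> {c<..}"
    then obtain n where "inverse (real (Suc n)) < t - c"
      using reals_Archimedean[of "t - c"] by auto
    then have "t \<in> {c + inverse (real (Suc n))..}" by simp
    then show "t \<in> (\<Union>n. {c + inverse (real (Suc n))..})" by blast
  next
    fix t assume "t \<in> (\<Union>n. {c + inverse (real (Suc n))..})"
    then obtain n where "c + inverse (real (Suc n)) \<le> t" by blast
    moreover have "inverse (real (Suc n)) > 0" by simp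
    ultimately have "c < t" by linarith
    then show "t \<in> {c<..}" by simp
  qed
  have "emeasure (scalar_measure Q w) (\<Union>n. {c + inverse (real (Suc n))..}) = 0"
  proof (rule emeasure_UN_eq_0)
    have "Q {c + inverse (real (Suc n))..} *\<^sub>V w = 0" for n
      by (rule zero) simp
    then show "emeasure (scalar_measure Q w) {c + inverse (real (Suc n))..} = 0" for n
      by (simp add: Q.emeasure_scalar_measure)
  qed auto
  then have "Q {c<..} *\<^sub>V w = 0"
    unfolding union[symmetric] by (simp add: Q.emeasure_scalar_measure ennreal_eq_0_iff)
  moreover have "Q {c<..} = 1 - Q {..c}"
    using Q.E_Compl[of "{..c}"] by simp
  ultimately have "Q {..c} *\<^sub>V w = w"
    by (simp add: apply_op_diff)
  then show "(Q {..c} * P {..c}) *\<^sub>V z = P {..c} *\<^sub>V z"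
    by (simp add: apply_op_times w_def)
qed

context moment_family
begin

lemma spectral_pvmI: "spectral_measure A E \<Longrightarrow> spectral_pvm A E"
  by (simp add: spectral_measure_def spectral_pvm_def spectral_pvm_axioms_def pvm_def selfadjoint_A)

text \<open>
  Everything that commutes with \<open>A\<close> commutes with its calculus, so the absorption above works in both
  directions and identifies \<open>E\<close> with \<open>proj\<close> on half-lines, which generate the Borel sets.
\<close>

lemma scalar_measure_unique:
  assumes E: "spectral_measure A E"
  shows "scalar_measure E x = \<mu> x"
proof -
  interpret E: spectral_pvm A E by (rule spectral_pvmI[OF E])
  interpret F: spectral_pvm A proj by (rule spectral_pvmI[OF spectral_measure_proj])
  have comm: "E S * proj T = proj T * E S" if "S \<in> sets borel" "T \<in> sets borel" for S T
    using that by (intro calc_commutes) (simp_all add: E.A_commutes_E)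
  have half_line: "E {..c} = proj {..c}" for c
  proof -
    have "proj {..c} * E {..c} = E {..c}"
      by (rule spectral_pvm_absorb[OF E.spectral_pvm_axioms F.spectral_pvm_axioms comm])
    moreover have "E {..c} * proj {..c} = proj {..c}"
      by (rule spectral_pvm_absorb[OF F.spectral_pvm_axioms E.spectral_pvm_axioms comm[symmetric]])
    ultimately show ?thesis by (simp add: comm)
  qed
  show ?thesis
  proof (rule measure_eqI_generator_eq[where \<Omega>=UNIV and E="range (\<lambda>c::real. {..c})" and A="\<lambda>n. {..real n}"])
    show "Int_stable (range (\<lambda>c::real. {..c}))"
      by (auto simp: Int_stable_def)
    show "emeasure (scalar_measure E x) S = emeasure (\<mu> x) S" if S: "S \<in> range (\<lambda>c::real. {..c})" for S
    proof -
      from S obtain c where c: "S = {..c}" by auto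
      have "emeasure (scalar_measure E x) S = emeasure (scalar_measure proj x) S"
        unfolding c by (simp add: E.emeasure_scalar_measure F.emeasure_scalar_measure half_line)
      then show ?thesis by (simp add: scalar_measure_proj)
    qed
    have "sets (borel :: real measure) = sigma_sets UNIV (range (\<lambda>c::real. {..c}))"
      by (subst borel_eq_atMost) simp
    then show "sets (scalar_measure E x) = sigma_sets UNIV (range (\<lambda>c::real. {..c}))"
      "sets (\<mu> x) = sigma_sets UNIV (range (\<lambda>c::real. {..c}))" by simp_all
    show "(\<Union>n. {..real n}) = UNIV"
      using real_arch_simple by auto
    show "emeasure (scalar_measure E x) {..real n} \<noteq> \<infinity>" for n
      by (simp add: E.emeasure_scalar_measure)
  qed auto
qed

lemma functional_calculus_eq_calc:
  assumes g: "bb (\<lambda>t. indicator (real_spectrum A) t * g t)"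
  shows "functional_calculus g A = calc (\<lambda>t. indicator (real_spectrum A) t * g t)"
  unfolding functional_calculus_def
proof (rule the_equality)
  show "\<exists>E. spectral_measure A E \<and>
      has_spectral_integral E (real_spectrum A) g (calc (\<lambda>t. indicator (real_spectrum A) t * g t))"
    using spectral_measure_proj has_spectral_integral_calc[OF g] by blast
next
  fix T assume "\<exists>E. spectral_measure A E \<and> has_spectral_integral E (real_spectrum A) g T"
  then have form: "cinner (T *\<^sub>V x) x = complex_of_real (LINT t:real_spectrum A|\<mu> x. g t)" for x
    by (auto simp: has_spectral_integral_def scalar_measure_unique)
  have "T - calc (\<lambda>t. indicator (real_spectrum A) t * g t) = 0"
    using form g by (intro bounded_op_form_zero)
      (simp add: apply_op_diff cinner_diff_left calc_form set_lebesgue_integral_def)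
  then show "T = calc (\<lambda>t. indicator (real_spectrum A) t * g t)" by simp
qed

end

section \<open>Rules of the functional calculus\<close>

text \<open>
  The functions for which the description in \<open>functional_calculus\<close> is known to succeed; as there, only
  the values on the spectrum matter.
\<close>

definition calculus_admissible :: "'a::chilbert_space bounded_op \<Rightarrow> (real \<Rightarrow> real) \<Rightarrow> bool"
  where "calculus_admissible A g \<longleftrightarrow> bounded_borel_on UNIV (\<lambda>t. indicator (real_spectrum A) t * g t)"

lemma selfadjoint_moment_family:
  assumes "selfadjoint A"
  obtains a b \<mu> where "moment_family A a b \<mu>"
proof -
  obtain K where "K > 0" "(- K) *\<^sub>R 1 \<le> A" "A \<le> K *\<^sub>R 1"
    using selfadjoint_bounds[OF assms] .
  then show ?thesis
    using ex_moment_family[OF assms, of "- K" K] that by auto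
qed

lemma bounded_borel_on_UNIV_imp: "bounded_borel_on UNIV g \<Longrightarrow> bounded_borel_on K g"
  unfolding bounded_borel_on_iff by blast

lemma compact_real_spectrum:
  assumes "selfadjoint A"
  shows "compact (real_spectrum A)"
proof -
  obtain a b \<mu> where "moment_family A a b \<mu>" by (rule selfadjoint_moment_family[OF assms])
  then interpret moment_family A a b \<mu> .
  show ?thesis
    using compact_Int_closed[OF compact_Icc closed_real_spectrum, of a b] real_spectrum_subset
    by (simp add: Int_absorb1)
qed

lemma real_spectrum_nonempty:
  assumes "selfadjoint A" and "(x::'a::chilbert_space) \<noteq> 0"
  shows "real_spectrum (A :: 'a bounded_op) \<noteq> {}"
proof
  assume empty: "real_spectrum A = {}"
  obtain a b \<mu> where "moment_family A a b \<mu>" by (rule selfadjoint_moment_family[OF assms(1)])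
  then interpret moment_family A a b \<mu> .
  interpret pvm proj by unfold_locales (rule projection_valued_measure_proj)
  have "proj {} = (1 :: 'a bounded_op)"
    using spectral_measure_proj by (simp add: spectral_measure_def empty)
  then have "1 *\<^sub>V x = 0 *\<^sub>V x" by (simp only: E_empty)
  with assms(2) show False by simp
qed

lemma scaleR_one_mono: "c \<le> d \<Longrightarrow> c *\<^sub>R 1 \<le> d *\<^sub>R (1 :: 'a::chilbert_space bounded_op)"
  by (simp add: bounded_op_le_iff apply_op_scaleR cinner_scaleR_left Re_cinner_self mult_right_mono
      selfadjoint_diff selfadjoint_scaleR)

text \<open>
  The moment problem was solved on intervals of positive length only, so the interval is first widened
  by \<open>e\<close>; this also covers \<open>a = b\<close>, the case of a scalar operator.
\<close>

lemma real_spectrum_bounds: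
  assumes "selfadjoint A" "a \<le> b" "a *\<^sub>R 1 \<le> A" "A \<le> b *\<^sub>R 1"
  shows "real_spectrum A \<subseteq> {a..b}"
proof
  fix s assume s: "s \<in> real_spectrum A"
  have wide: "s \<in> {a - e..b + e}" if "e > 0" for e
  proof -
    have "(a - e) *\<^sub>R 1 \<le> A" "A \<le> (b + e) *\<^sub>R 1"
      using scaleR_one_mono[of "a - e" a] scaleR_one_mono[of b "b + e"] assms(3,4) that
      by (auto intro: order_trans)
    moreover have "a - e < b + e" using \<open>a \<le> b\<close> that by linarith
    ultimately obtain \<mu> where "moment_family A (a - e) (b + e) \<mu>"
      using ex_moment_family[OF assms(1), of "a - e" "b + e"] by blast
    then show ?thesis
      using moment_family.real_spectrum_subset s by blast
  qed
  have "a \<le> s + e" "s \<le> b + e" if "e > 0" for e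
    using wide[OF that] by auto
  then show "s \<in> {a..b}"
    by (auto intro: field_le_epsilon)
qed


lemma calculus_admissible_add:
  "calculus_admissible A g \<Longrightarrow> calculus_admissible A h \<Longrightarrow> calculus_admissible A (\<lambda>t. g t + h t)"
  unfolding calculus_admissible_def distrib_left by (rule bounded_borel_on_add)

lemma calculus_admissible_scale:
  "calculus_admissible A g \<Longrightarrow> calculus_admissible A (\<lambda>t. c * g t)"
  unfolding calculus_admissible_def mult.left_commute[of _ c]
  by (rule bounded_borel_on_mult[OF bounded_borel_on_const])

lemma indicator_times_mult:
  "(indicator S t * (g t * h t) :: real) = (indicator S t * g t) * (indicator S t * h t)"
  by (simp add: indicator_def)

lemma calculus_admissible_mult:
  "calculus_admissible A g \<Longrightarrow> calculus_admissible A h \<Longrightarrow> calculus_admissible A (\<lambda>t. g t * h t)"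
  unfolding calculus_admissible_def indicator_times_mult by (rule bounded_borel_on_mult)

text \<open>
  A monotone function is Borel, and on a compact set it is bounded by its values at the two extreme
  points of the set.
\<close>

lemma calculus_admissible_mono_on:
  assumes A: "selfadjoint A" and mono: "mono_on (real_spectrum A) g"
  shows "calculus_admissible A g"
proof -
  let ?S = "real_spectrum A"
  have compact: "compact ?S" by (rule compact_real_spectrum[OF A])
  have "g \<in> borel_measurable (restrict_space borel ?S)"
    by (rule borel_measurable_mono_on_fnc[OF mono])
  then have meas: "(\<lambda>t. indicator ?S t * g t) \<in> borel_measurable borel"
    using compact by (subst (asm) borel_measurable_restrict_space_iff) (simp_all add: borel_compact)
  have "\<exists>B. \<forall>t. \<bar>indicator ?S t * g t\<bar> \<le> B"
  proof (cases "?S = {}")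
    case False
    obtain l where l: "l \<in> ?S" "\<And>t. t \<in> ?S \<Longrightarrow> l \<le> t" using compact_attains_inf[OF compact False] by blast
    obtain u where u: "u \<in> ?S" "\<And>t. t \<in> ?S \<Longrightarrow> t \<le> u" using compact_attains_sup[OF compact False] by blast
    have "\<bar>indicator ?S t * g t\<bar> \<le> \<bar>g l\<bar> + \<bar>g u\<bar>" for t
    proof (cases "t \<in> ?S")
      case True
      then have "g l \<le> g t" "g t \<le> g u"
        using l u mono by (auto intro: mono_onD)
      with True show ?thesis by simp
    qed simp
    then show ?thesis by blast
  qed auto
  with meas show ?thesis
    by (auto simp: calculus_admissible_def bounded_borel_on_iff)
qed

lemma calculus_admissible_const: "selfadjoint A \<Longrightarrow> calculus_admissible A (\<lambda>t. c)"
  by (rule calculus_admissible_mono_on) (auto intro: mono_onI)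

lemma calculus_admissible_id: "selfadjoint A \<Longrightarrow> calculus_admissible A (\<lambda>t. t)"
  by (rule calculus_admissible_mono_on) (auto intro: mono_onI)

lemma calculus_admissible_monotone:
  assumes A: "selfadjoint A"
    and "mono_on (real_spectrum A) g \<or> monotone_on (real_spectrum A) (\<le>) (\<ge>) g"
  shows "calculus_admissible A g"
  using assms(2)
proof
  assume "monotone_on (real_spectrum A) (\<le>) (\<ge>) g"
  then have "mono_on (real_spectrum A) (\<lambda>t. - g t)"
    by (auto simp: monotone_on_def)
  then have "calculus_admissible A (\<lambda>t. (- 1) * (- g t))"
    by (intro calculus_admissible_scale calculus_admissible_mono_on A)
  then show ?thesis by simp
qed (rule calculus_admissible_mono_on[OF A])

context
  fixes A :: "'a::chilbert_space bounded_op"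
  assumes A: "selfadjoint A"
begin

lemma functional_calculus_mono:
  assumes g: "calculus_admissible A g" and h: "calculus_admissible A h"
    and le: "\<And>t. t \<in> real_spectrum A \<Longrightarrow> g t \<le> h t"
  shows "functional_calculus g A \<le> functional_calculus h A"
proof -
  obtain a b \<mu> where "moment_family A a b \<mu>" by (rule selfadjoint_moment_family[OF A])
  then interpret moment_family A a b \<mu> .
  let ?i = "\<lambda>g t. indicator (real_spectrum A) t * g t :: real"
  have bb: "bb (?i g)" "bb (?i h)"
    using g h by (auto simp: calculus_admissible_def intro: bounded_borel_on_UNIV_imp)
  have "(\<integral>t. ?i g t \<partial>\<mu> x) \<le> (\<integral>t. ?i h t \<partial>\<mu> x)" for x
    by (intro integral_mono integrable_bb bb) (simp add: indicator_def le)
  then show ?thesis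
    using bb by (simp add: functional_calculus_eq_calc bounded_op_le_iff calc_Re_form selfadjoint_diff selfadjoint_calc)
qed

lemma selfadjoint_functional_calculus:
  assumes g: "calculus_admissible A g"
  shows "selfadjoint (functional_calculus g A)"
proof -
  obtain a b \<mu> where "moment_family A a b \<mu>" by (rule selfadjoint_moment_family[OF A])
  then interpret moment_family A a b \<mu> .
  have "bb (\<lambda>t. indicator (real_spectrum A) t * g t)"
    using g by (auto simp: calculus_admissible_def intro: bounded_borel_on_UNIV_imp)
  then show ?thesis by (simp add: functional_calculus_eq_calc selfadjoint_calc)
qed

lemma functional_calculus_add:
  assumes g: "calculus_admissible A g" and h: "calculus_admissible A h"
  shows "functional_calculus (\<lambda>t. g t + h t) A = functional_calculus g A + functional_calculus h A"
proof -
  obtain a b \<mu> where "moment_family A a b \<mu>" by (rule selfadjoint_moment_family[OF A])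
  then interpret moment_family A a b \<mu> .
  have bb: "bb (\<lambda>t. indicator (real_spectrum A) t * g t)" "bb (\<lambda>t. indicator (real_spectrum A) t * h t)"
    using g h by (auto simp: calculus_admissible_def intro: bounded_borel_on_UNIV_imp)
  show ?thesis
    using bb bounded_borel_on_add[OF bb] calc_add[OF bb]
    by (simp add: functional_calculus_eq_calc distrib_left)
qed

lemma functional_calculus_scale:
  assumes g: "calculus_admissible A g"
  shows "functional_calculus (\<lambda>t. c * g t) A = c *\<^sub>R functional_calculus g A"
proof -
  obtain a b \<mu> where "moment_family A a b \<mu>" by (rule selfadjoint_moment_family[OF A])
  then interpret moment_family A a b \<mu> .
  have bb: "bb (\<lambda>t. indicator (real_spectrum A) t * g t)"
    using g by (auto simp: calculus_admissible_def intro: bounded_borel_on_UNIV_imp)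
  show ?thesis
    using bb bounded_borel_on_mult[OF bounded_borel_on_const[of _ c] bb] calc_scale[OF bb, of c]
    by (simp add: functional_calculus_eq_calc mult.left_commute[of _ c])
qed

lemma functional_calculus_mult:
  assumes g: "calculus_admissible A g" and h: "calculus_admissible A h"
  shows "functional_calculus (\<lambda>t. g t * h t) A = functional_calculus g A * functional_calculus h A"
proof -
  obtain a b \<mu> where "moment_family A a b \<mu>" by (rule selfadjoint_moment_family[OF A])
  then interpret moment_family A a b \<mu> .
  have bb: "bb (\<lambda>t. indicator (real_spectrum A) t * g t)" "bb (\<lambda>t. indicator (real_spectrum A) t * h t)"
    using g h by (auto simp: calculus_admissible_def intro: bounded_borel_on_UNIV_imp)
  show ?thesis
    using bb bounded_borel_on_mult[OF bb] calc_mult[OF bb]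
    by (simp only: functional_calculus_eq_calc indicator_times_mult)
qed

lemma functional_calculus_const: "functional_calculus (\<lambda>t. c) A = c *\<^sub>R 1"
proof -
  obtain a b \<mu> where "moment_family A a b \<mu>" by (rule selfadjoint_moment_family[OF A])
  then interpret moment_family A a b \<mu> .
  show ?thesis
    using calc_real_spectrum[of "\<lambda>t. c"] functional_calculus_eq_calc[of "\<lambda>t. c"]
    by (simp add: calc_const bounded_borel_on_mult)
qed

lemma functional_calculus_id: "functional_calculus (\<lambda>t. t) A = A"
proof -
  obtain a b \<mu> where "moment_family A a b \<mu>" by (rule selfadjoint_moment_family[OF A])
  then interpret moment_family A a b \<mu> .
  show ?thesis
    using calc_real_spectrum[of "\<lambda>t. t"] functional_calculus_eq_calc[of "\<lambda>t. t"]
    by (simp add: calc_id bounded_borel_on_mult)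
qed

end

section \<open>Positive linear maps and the inequality\<close>

lemma positive_linear_map_add: "positive_linear_map \<Phi> \<Longrightarrow> \<Phi> (S + T) = \<Phi> S + \<Phi> T"
  and positive_linear_map_scaleR: "positive_linear_map \<Phi> \<Longrightarrow> \<Phi> (r *\<^sub>R T) = r *\<^sub>R \<Phi> T"
  by (simp_all add: positive_linear_map_def clinear_def scaleR_scaleC)

lemma positive_linear_map_diff: "positive_linear_map \<Phi> \<Longrightarrow> \<Phi> (S - T) = \<Phi> S - \<Phi> T"
  using positive_linear_map_add[of \<Phi> "S - T" T] by simp

lemma positive_linear_map_mono:
  assumes \<Phi>: "positive_linear_map \<Phi>" and "S \<le> T"
  shows "\<Phi> S \<le> \<Phi> T"
proof -
  have "0 \<le> T - S" using \<open>S \<le> T\<close> by simp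
  then have "0 \<le> \<Phi> (T - S)" using \<Phi> by (simp add: positive_linear_map_def)
  then show ?thesis by (simp add: positive_linear_map_diff[OF \<Phi>])
qed

text \<open>
  A self-adjoint operator is a difference of positive ones, \<open>T = (T + K) - K\<close> for large \<open>K\<close>.
\<close>

lemma positive_linear_map_selfadjoint:
  assumes \<Phi>: "positive_linear_map \<Phi>" and T: "selfadjoint T"
  shows "selfadjoint (\<Phi> T)"
proof -
  obtain K where K: "K > 0" "(- K) *\<^sub>R 1 \<le> T" using selfadjoint_bounds[OF T] by blast
  have sa: "selfadjoint (\<Phi> S)" if "0 \<le> S" for S
    using \<Phi> that by (auto simp: positive_linear_map_def bounded_op_le_iff)
  have "0 \<le> T + K *\<^sub>R 1"
    using add_right_mono[OF K(2), of "K *\<^sub>R 1"] by (simp flip: scaleR_add_left)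
  moreover have "0 \<le> K *\<^sub>R (1 :: 'a bounded_op)"
    using scaleR_one_mono[of 0 K] K(1) by simp
  ultimately have "selfadjoint (\<Phi> (T + K *\<^sub>R 1) - \<Phi> (K *\<^sub>R 1))"
    by (intro selfadjoint_diff sa)
  then show ?thesis by (simp add: positive_linear_map_add[OF \<Phi>])
qed

lemma bounded_op_leD: "S \<le> T \<Longrightarrow> Re (cinner (S *\<^sub>V x) x) \<le> Re (cinner (T *\<^sub>V x) x)"
  by (simp add: bounded_op_le_iff)

text \<open>
  The assumption is void on the zero space, where all operators coincide; a proof that works with a
  unit vector may therefore ignore this case.
\<close>

lemma bounded_op_leI:
  assumes unit: "\<And>x. norm x = 1 \<Longrightarrow>
    selfadjoint S \<and> selfadjoint T \<and> Re (cinner (S *\<^sub>V x) x) \<le> Re (cinner (T *\<^sub>V x) x)"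
  shows "S \<le> T"
proof -
  have scaled: "\<exists>u. norm u = 1 \<and> x = norm x *\<^sub>R u" if "x \<noteq> 0" for x :: 'a
    using that by (intro exI[of _ "x /\<^sub>R norm x"]) simp
  have "selfadjoint (T - S)"
  proof (cases "\<exists>x::'a. x \<noteq> 0")
    case True
    then show ?thesis using scaled unit selfadjoint_diff by blast
  next
    case False
    then have "x = 0" for x :: 'a by blast
    then show ?thesis by (metis selfadjoint_def)
  qed
  moreover have "Re (cinner (S *\<^sub>V x) x) \<le> Re (cinner (T *\<^sub>V x) x)" for x
  proof (cases "x = 0")
    case False
    then obtain u where u: "norm u = 1" "x = norm x *\<^sub>R u" using scaled by blast
    have "Re (cinner (V *\<^sub>V x) x) = (norm x)\<^sup>2 * Re (cinner (V *\<^sub>V u) u)" for V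
      by (subst (1 2) u(2)) (simp add: apply_op_scaleR_right cinner_scaleR_left cinner_scaleR_right power2_eq_square)
    then show ?thesis using unit[OF u(1)] by (simp add: mult_left_mono)
  qed simp
  ultimately show ?thesis by (simp add: bounded_op_le_iff)
qed

lemma form_bounded_on_unit:
  obtains K where "K \<ge> 0" "\<And>x. norm x = 1 \<Longrightarrow> cmod (cinner (T *\<^sub>V x) x) \<le> K"
proof -
  obtain K where K: "K > 0" "\<And>x. norm (T *\<^sub>V x) \<le> K * norm x"
    using bounded_op_norm_bound by blast
  have "cmod (cinner (T *\<^sub>V x) x) \<le> K" if "norm x = 1" for x
    using Cauchy_Schwarz_cinner[of "T *\<^sub>V x" x] K(2)[of x] that by simp
  then show ?thesis using that[of K] K(1) by simp
qed

theorem theorem2p1: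
  fixes J :: "real set" and f C :: "real \<Rightarrow> real" and n :: nat
    and A :: "nat \<Rightarrow> 'h::chilbert_space bounded_op"
    and \<Phi> :: "nat \<Rightarrow> 'h bounded_op \<Rightarrow> 'k::chilbert_space bounded_op"
    and \<delta> :: real
  assumes "is_interval J"
    and "convex_on J f"
    and "mono_on J f \<or> monotone_on J (\<le>) (\<ge>) f"
    and "\<And>s t. s \<in> J \<Longrightarrow> t \<in> J \<Longrightarrow> C s * (t - s) + f s \<le> f t"
    and "\<And>i. i \<in> {1..n} \<Longrightarrow> selfadjoint (A i)"
    and "\<And>i. i \<in> {1..n} \<Longrightarrow> spectrum (A i) \<subseteq> complex_of_real ` J"
    and "\<And>i. i \<in> {1..n} \<Longrightarrow> positive_linear_map (\<Phi> i)"
    and "(\<Sum>i=1..n. \<Phi> i 1) = 1"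
    and "\<delta> = (SUP x \<in> {x::'k. norm x = 1}.
           Re (cinner ((\<Sum>i=1..n. \<Phi> i (functional_calculus C (A i) * A i)) *\<^sub>V x) x
             - cinner ((\<Sum>i=1..n. \<Phi> i (A i)) *\<^sub>V x) x
               * cinner ((\<Sum>i=1..n. \<Phi> i (functional_calculus C (A i))) *\<^sub>V x) x))"
  shows "(\<Sum>i=1..n. \<Phi> i (functional_calculus f (A i)))
           \<le> functional_calculus f (\<Sum>i=1..n. \<Phi> i (A i)) + \<delta> *\<^sub>R 1"
proof (rule bounded_op_leI)
  fix x :: 'k assume x: "norm x = 1"
  let ?I = "{1..n}"
  define L where "L = (\<Sum>i=1..n. \<Phi> i (functional_calculus f (A i)))"
  define B where "B = (\<Sum>i=1..n. \<Phi> i (A i))"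
  define P where "P = (\<Sum>i=1..n. \<Phi> i (functional_calculus C (A i) * A i))"
  define Q where "Q = (\<Sum>i=1..n. \<Phi> i (functional_calculus C (A i)))"
  note subgradient = assms(4) and sa = assms(5) and \<Phi> = assms(7)

  \<comment> \<open>Add the two supporting line inequalities at \<open>s\<close> and \<open>t\<close>.\<close>
  have C_mono: "mono_on J C"
  proof (rule mono_onI)
    fix s t assume st: "s \<in> J" "t \<in> J" "s \<le> t"
    have "C s * (t - s) \<le> C t * (t - s)"
      using subgradient[OF st(1,2)] subgradient[OF st(2,1)] by (simp add: algebra_simps)
    then show "C s \<le> C t" using st(3) by (cases "s = t") auto
  qed
  have admissible: "calculus_admissible T f" "calculus_admissible T C"
    if "selfadjoint T" "real_spectrum T \<subseteq> J" for T :: "'c::chilbert_space bounded_op"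
  proof -
    have "mono_on (real_spectrum T) f \<or> monotone_on (real_spectrum T) (\<le>) (\<ge>) f"
      using assms(3) monotone_on_subset[OF _ that(2)] by blast
    then show "calculus_admissible T f" by (rule calculus_admissible_monotone[OF that(1)])
    show "calculus_admissible T C"
      by (rule calculus_admissible_mono_on[OF that(1) monotone_on_subset[OF C_mono that(2)]])
  qed
  have spec_A: "real_spectrum (A i) \<subseteq> J" if "i \<in> ?I" for i
    using assms(6)[OF that] by (force simp: real_spectrum_def)

  \<comment> \<open>The unit vector \<open>x\<close> shows that the maps \<open>\<Phi> i\<close> do not all vanish at \<open>1\<close>. Hence there is at least
    one index, the domain is not the zero space, and the spectra are nonempty.\<close>
  have one: "(1 :: 'k bounded_op) \<noteq> 0"
  proof
    assume "(1 :: 'k bounded_op) = 0"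
    then have "1 *\<^sub>V x = 0 *\<^sub>V x" by simp
    with x show False by simp
  qed
  have "?I \<noteq> {}"
  proof
    assume "?I = {}"
    from assms(8) have "(1 :: 'k bounded_op) = 0"
      unfolding \<open>?I = {}\<close> sum.empty by (rule sym)
    with one show False by (rule notE)
  qed
  have "\<exists>y :: 'h. y \<noteq> 0"
  proof (rule ccontr)
    assume "\<nexists>y :: 'h. y \<noteq> 0"
    then have trivial: "(y :: 'h) = 0" for y by blast
    have "(1 :: 'h bounded_op) = 0"
    proof (rule bounded_op_eqI)
      fix z :: 'h
      have "z = 0" by (rule trivial)
      then show "1 *\<^sub>V z = 0 *\<^sub>V z" by simp
    qed
    note assms(8)[symmetric]
    also have "(\<Sum>i=1..n. \<Phi> i 1) = (\<Sum>i=1..n. \<Phi> i 0)"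
      by (simp only: \<open>(1 :: 'h bounded_op) = 0\<close>)
    also have "\<dots> = 0"
    proof (rule sum.neutral, rule ballI)
      fix i assume "i \<in> ?I"
      from positive_linear_map_diff[OF \<Phi>[OF this], of 0 0] show "\<Phi> i 0 = 0" by simp
    qed
    finally have "(1 :: 'k bounded_op) = 0" .
    with one show False by (rule notE)
  qed
  then obtain y :: 'h where y: "y \<noteq> 0" by blast
  \<comment> \<open>The extreme points \<open>m\<close> and \<open>M\<close> of the union of the spectra belong to \<open>J\<close>, so the bounds
    \<open>m \<le> B \<le> M\<close> keep the spectrum of \<open>B\<close> and the number \<open>t\<close> inside \<open>J\<close>.\<close>
  define U where "U = (\<Union>i\<in>?I. real_spectrum (A i))"
  have U: "compact U" "U \<noteq> {}" "U \<subseteq> J"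
  proof -
    show "compact U"
      unfolding U_def by (rule compact_UN[OF finite_atLeastAtMost]) (rule compact_real_spectrum[OF sa])
    obtain i where i: "i \<in> ?I" using \<open>?I \<noteq> {}\<close> by blast
    show "U \<noteq> {}"
      unfolding U_def using real_spectrum_nonempty[OF sa[OF i] y] i by blast
    show "U \<subseteq> J" unfolding U_def using spec_A by blast
  qed
  obtain m where "m \<in> U" and m_le: "\<And>t. t \<in> U \<Longrightarrow> m \<le> t"
    using compact_attains_inf[OF U(1,2)] by blast
  obtain M where "M \<in> U" and le_M: "\<And>t. t \<in> U \<Longrightarrow> t \<le> M"
    using compact_attains_sup[OF U(1,2)] by blast
  have m: "m \<in> J" "\<And>t. t \<in> U \<Longrightarrow> m \<le> t" and M: "M \<in> J" "\<And>t. t \<in> U \<Longrightarrow> t \<le> M"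
    using \<open>m \<in> U\<close> \<open>M \<in> U\<close> m_le le_M U(3) by auto
  have "m \<le> M" using \<open>M \<in> U\<close> by (rule m_le)
  have mMJ: "{m..M} \<subseteq> J"
    using mem_is_interval_1_I[OF assms(1) m(1) M(1)] by auto

  have bounds: "m *\<^sub>R 1 \<le> A i" "A i \<le> M *\<^sub>R 1" if i: "i \<in> ?I" for i
  proof -
    note adm = calculus_admissible_const[OF sa[OF i]] calculus_admissible_id[OF sa[OF i]]
    have U: "real_spectrum (A i) \<subseteq> U" unfolding U_def using i by blast
    have "functional_calculus (\<lambda>t. m) (A i) \<le> functional_calculus (\<lambda>t. t) (A i)"
      by (rule functional_calculus_mono[OF sa[OF i] adm]) (use m(2) U in blast)
    then show "m *\<^sub>R 1 \<le> A i"
      by (simp only: functional_calculus_const[OF sa[OF i]] functional_calculus_id[OF sa[OF i]])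
    have "functional_calculus (\<lambda>t. t) (A i) \<le> functional_calculus (\<lambda>t. M) (A i)"
      by (rule functional_calculus_mono[OF sa[OF i] adm(2,1)]) (use M(2) U in blast)
    then show "A i \<le> M *\<^sub>R 1"
      by (simp only: functional_calculus_const[OF sa[OF i]] functional_calculus_id[OF sa[OF i]])
  qed
  have sum_one: "(\<Sum>i=1..n. \<Phi> i (c *\<^sub>R 1)) = c *\<^sub>R 1" for c
  proof -
    have "(\<Sum>i=1..n. \<Phi> i (c *\<^sub>R 1)) = (\<Sum>i=1..n. c *\<^sub>R \<Phi> i 1)"
      by (intro sum.cong refl positive_linear_map_scaleR \<Phi>)
    then show ?thesis using assms(8) by (simp flip: scaleR_sum_right)
  qed
  have B_lower: "m *\<^sub>R 1 \<le> B" and B_upper: "B \<le> M *\<^sub>R 1"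
    unfolding B_def sum_one[symmetric]
    by (intro sum_mono positive_linear_map_mono[OF \<Phi>] bounds; assumption)+
  have sa_B: "selfadjoint B"
    unfolding B_def by (intro selfadjoint_sum positive_linear_map_selfadjoint[OF \<Phi> sa])
  have spec_B: "real_spectrum B \<subseteq> J"
    using real_spectrum_bounds[OF sa_B \<open>m \<le> M\<close> B_lower B_upper] mMJ by blast
  have sa_L: "selfadjoint L"
    unfolding L_def
    by (intro selfadjoint_sum positive_linear_map_selfadjoint[OF \<Phi>] selfadjoint_functional_calculus sa
        admissible spec_A)
  have sa_fB: "selfadjoint (functional_calculus f B)"
    by (intro selfadjoint_functional_calculus sa_B admissible spec_B)

  define t where "t = Re (cinner (B *\<^sub>V x) x)"
  have Bx: "cinner (B *\<^sub>V x) x = complex_of_real t"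
    unfolding t_def by (rule selfadjoint_form_real[OF sa_B])
  have "m \<le> t" "t \<le> M"
    using bounded_op_leD[OF B_lower, of x] bounded_op_leD[OF B_upper, of x] x
    by (simp_all add: t_def apply_op_scaleR cinner_scaleR_left Re_cinner_self)
  then have t: "t \<in> J" using mMJ by auto

  have "L \<le> f t *\<^sub>R 1 + P - t *\<^sub>R Q"
  proof -
    have "\<Phi> i (functional_calculus f (A i))
        \<le> f t *\<^sub>R \<Phi> i 1 + \<Phi> i (functional_calculus C (A i) * A i) - t *\<^sub>R \<Phi> i (functional_calculus C (A i))"
      if i: "i \<in> ?I" for i
    proof -
      note f_adm = admissible(1)[OF sa[OF i] spec_A[OF i]] and C_adm = admissible(2)[OF sa[OF i] spec_A[OF i]]
      note const = calculus_admissible_const[OF sa[OF i], of "f t"] and id = calculus_admissible_id[OF sa[OF i]]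
      note C_id = calculus_admissible_mult[OF C_adm id] and tC = calculus_admissible_scale[OF C_adm, of "- t"]
      note sum1 = calculus_admissible_add[OF const C_id]
      note sum2 = calculus_admissible_add[OF sum1 tC]
      have "functional_calculus f (A i) \<le> functional_calculus (\<lambda>s. f t + C s * s + - t * C s) (A i)"
      proof (rule functional_calculus_mono[OF sa[OF i] f_adm sum2])
        fix s assume "s \<in> real_spectrum (A i)"
        then have "s \<in> J" using spec_A[OF i] by blast
        from subgradient[OF this t] show "f s \<le> f t + C s * s + - t * C s"
          by (simp add: algebra_simps)
      qed
      also have "\<dots> = f t *\<^sub>R 1 + functional_calculus C (A i) * A i + (- t) *\<^sub>R functional_calculus C (A i)"
        by (simp only: functional_calculus_add[OF sa[OF i] sum1 tC] functional_calculus_add[OF sa[OF i] const C_id]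
            functional_calculus_mult[OF sa[OF i] C_adm id] functional_calculus_scale[OF sa[OF i] C_adm]
            functional_calculus_const[OF sa[OF i]] functional_calculus_id[OF sa[OF i]])
      also have "\<dots> = f t *\<^sub>R 1 + functional_calculus C (A i) * A i - t *\<^sub>R functional_calculus C (A i)"
        by simp
      finally have "\<Phi> i (functional_calculus f (A i))
          \<le> \<Phi> i (f t *\<^sub>R 1 + functional_calculus C (A i) * A i - t *\<^sub>R functional_calculus C (A i))"
        by (rule positive_linear_map_mono[OF \<Phi>[OF i]])
      then show ?thesis
        by (simp only: positive_linear_map_add[OF \<Phi>[OF i]] positive_linear_map_diff[OF \<Phi>[OF i]]
            positive_linear_map_scaleR[OF \<Phi>[OF i]])
    qed
    then have "L \<le> (\<Sum>i=1..n. f t *\<^sub>R \<Phi> i 1 + \<Phi> i (functional_calculus C (A i) * A i)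
        - t *\<^sub>R \<Phi> i (functional_calculus C (A i)))"
      unfolding L_def by (rule sum_mono)
    then show ?thesis
      using assms(8) by (simp add: sum.distrib sum_subtractf P_def Q_def flip: scaleR_sum_right)
  qed
  then have "Re (cinner (L *\<^sub>V x) x) \<le> f t + Re (cinner (P *\<^sub>V x) x) - t * Re (cinner (Q *\<^sub>V x) x)"
    by (rule order_trans[OF bounded_op_leD]) (use x in \<open>simp add: apply_op_add apply_op_diff apply_op_scaleR cinner_add_left
        cinner_diff_left cinner_scaleR_left Re_cinner_self\<close>)
  also have "\<dots> = f t + Re (cinner (P *\<^sub>V x) x - cinner (B *\<^sub>V x) x * cinner (Q *\<^sub>V x) x)"
    by (simp add: Bx)
  also have "\<dots> \<le> f t + \<delta>"
  proof -
    let ?g = "\<lambda>x. Re (cinner (P *\<^sub>V x) x - cinner (B *\<^sub>V x) x * cinner (Q *\<^sub>V x) x)"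
    obtain KP where KP: "KP \<ge> 0" "\<And>x. norm x = 1 \<Longrightarrow> cmod (cinner (P *\<^sub>V x) x) \<le> KP"
      using form_bounded_on_unit[of P] by blast
    obtain KB where KB: "KB \<ge> 0" "\<And>x. norm x = 1 \<Longrightarrow> cmod (cinner (B *\<^sub>V x) x) \<le> KB"
      using form_bounded_on_unit[of B] by blast
    obtain KQ where KQ: "KQ \<ge> 0" "\<And>x. norm x = 1 \<Longrightarrow> cmod (cinner (Q *\<^sub>V x) x) \<le> KQ"
      using form_bounded_on_unit[of Q] by blast
    have "?g z \<le> KP + KB * KQ" if "norm z = 1" for z
    proof -
      have "?g z \<le> cmod (cinner (P *\<^sub>V z) z - cinner (B *\<^sub>V z) z * cinner (Q *\<^sub>V z) z)"
        by (rule complex_Re_le_cmod)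
      also have "\<dots> \<le> cmod (cinner (P *\<^sub>V z) z) + cmod (cinner (B *\<^sub>V z) z) * cmod (cinner (Q *\<^sub>V z) z)"
        by (metis norm_mult norm_triangle_ineq4)
      also have "\<dots> \<le> KP + KB * KQ"
        by (intro add_mono mult_mono KP KB KQ that norm_ge_zero)
      finally show ?thesis .
    qed
    then have "bdd_above (?g ` {x. norm x = 1})"
      by (intro bdd_aboveI[of _ "KP + KB * KQ"]) auto
    then have "?g x \<le> (SUP x \<in> {x. norm x = 1}. ?g x)"
      by (intro cSUP_upper) (use x in auto)
    then show ?thesis
      unfolding assms(9) B_def P_def Q_def by simp
  qed
  also have "f t \<le> Re (cinner (functional_calculus f B *\<^sub>V x) x)"
  proof -
    note const = calculus_admissible_const[OF sa_B, of "f t - C t * t"]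
      and lin = calculus_admissible_scale[OF calculus_admissible_id[OF sa_B], of "C t"]
    have "functional_calculus (\<lambda>s. (f t - C t * t) + C t * s) B \<le> functional_calculus f B"
    proof (rule functional_calculus_mono[OF sa_B calculus_admissible_add[OF const lin] admissible(1)[OF sa_B spec_B]])
      fix s assume "s \<in> real_spectrum B"
      then have "s \<in> J" using spec_B by blast
      from subgradient[OF t this] show "(f t - C t * t) + C t * s \<le> f s"
        by (simp add: algebra_simps)
    qed
    also have "functional_calculus (\<lambda>s. (f t - C t * t) + C t * s) B = (f t - C t * t) *\<^sub>R 1 + C t *\<^sub>R B"
      by (simp only: functional_calculus_add[OF sa_B const lin] functional_calculus_const[OF sa_B]
          functional_calculus_scale[OF sa_B calculus_admissible_id[OF sa_B]] functional_calculus_id[OF sa_B])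
    finally have "Re (cinner (((f t - C t * t) *\<^sub>R 1 + C t *\<^sub>R B) *\<^sub>V x) x)
        \<le> Re (cinner (functional_calculus f B *\<^sub>V x) x)"
      by (rule bounded_op_leD)
    then show ?thesis
      using x by (simp add: apply_op_add apply_op_scaleR cinner_add_left cinner_scaleR_left Re_cinner_self Bx)
  qed
  finally have "Re (cinner (L *\<^sub>V x) x) \<le> Re (cinner (functional_calculus f B *\<^sub>V x) x) + \<delta>" by simp
  then have "Re (cinner (L *\<^sub>V x) x) \<le> Re (cinner ((functional_calculus f B + \<delta> *\<^sub>R 1) *\<^sub>V x) x)"
    using x by (simp add: apply_op_add apply_op_scaleR cinner_add_left cinner_scaleR_left Re_cinner_self)
  with sa_L sa_fB show "selfadjoint (\<Sum>i=1..n. \<Phi> i (functional_calculus f (A i))) \<and>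
      selfadjoint (functional_calculus f (\<Sum>i=1..n. \<Phi> i (A i)) + \<delta> *\<^sub>R 1) \<and>
      Re (cinner ((\<Sum>i=1..n. \<Phi> i (functional_calculus f (A i))) *\<^sub>V x) x)
      \<le> Re (cinner ((functional_calculus f (\<Sum>i=1..n. \<Phi> i (A i)) + \<delta> *\<^sub>R 1) *\<^sub>V x) x)"
    by (simp add: L_def B_def selfadjoint_add selfadjoint_scaleR)
qed

end
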